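(* Let $p=2n+1$ be a prime with $n$ odd, and let $a,b\in\{1,\ldots,p-1\}$. Then $$(-1)^{\left|\left\{(s,t):\ 0\le t<s\le n,\ \{as^2-b\}_p>\{at^2-b\}_p\right\}\right|-\left|\left\{0<r<b:\ \left(\frac rp\right)=\left(\frac ap\right)\right\}\right|}=\begin{cases}1&\text{if } p\equiv 3\pmod 8,\\ (-1)^{(h(-p)-1)/2}\left(\frac ap\right)&\text{if } p\equiv 7\pmod 8.\end{cases}$$
   Context: For an integer $x$, $\{x\}_p$ denotes the least nonnegative residue of $x$ modulo $p$. $\left(\frac{\cdot}{p}\right)$ is the Legendre symbol, and $h(-p)$ denotes the class number of the imaginary quadratic field $\mathbb{Q}(\sqrt{-p})$. The pairs $(s,t)$ are ordered pairs of integers and $r$ ranges over integers. *)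

theory Defs
  imports
    Complex_Main
    "HOL-Number_Theory.Number_Theory"
    "HOL-Algebra.Ideal"
    "HOL-Computational_Algebra.Polynomial"
begin

definition quadratic_field :: "int \<Rightarrow> complex set" where
  "quadratic_field d = {of_rat x + of_rat y * csqrt (of_int d) | x y. True}"

text \<open>
  Number fields are given as subfields of the complex numbers; \<open>algebraic_int\<close> is
  integrality over the integers.
\<close>

definition ring_of_integers :: "complex set \<Rightarrow> complex ring" where
  "ring_of_integers K =
     \<lparr>carrier = {z \<in> K. algebraic_int z}, mult = (*), one = 1, zero = 0, add = (+)\<rparr>"

definition nonzero_ideals :: "('a, 'b) ring_scheme \<Rightarrow> 'a set set" where
  "nonzero_ideals R = {I. ideal I R \<and> I \<noteq> {\<zero>\<^bsub>R\<^esub>}}"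

text \<open>
  Ideals \<open>I\<close> and \<open>J\<close> lie in the same class if \<open>\<alpha> I = \<beta> J\<close> for some nonzero
  \<open>\<alpha>\<close>, \<open>\<beta>\<close> in the ring. Every fractional ideal is a nonzero scalar multiple of an integral
  one, so these classes correspond to the elements of the ideal class group (fractional ideals
  modulo principal ones) when the ring is a Dedekind domain.
\<close>

definition ideal_class_rel :: "('a, 'b) ring_scheme \<Rightarrow> ('a set \<times> 'a set) set" where
  "ideal_class_rel R =
     {(I, J). I \<in> nonzero_ideals R \<and> J \<in> nonzero_ideals R \<and>
        (\<exists>\<alpha> \<in> carrier R - {\<zero>\<^bsub>R\<^esub>}. \<exists>\<beta> \<in> carrier R - {\<zero>\<^bsub>R\<^esub>}.
           (\<lambda>x. \<alpha> \<otimes>\<^bsub>R\<^esub> x) ` I = (\<lambda>x. \<beta> \<otimes>\<^bsub>R\<^esub> x) ` J)}"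

lemma (in domain) equiv_ideal_class_rel: "equiv (nonzero_ideals R) (ideal_class_rel R)"
proof (rule equivI)
  show "ideal_class_rel R \<subseteq> nonzero_ideals R \<times> nonzero_ideals R"
    by (auto simp: ideal_class_rel_def)
  show "refl_on (nonzero_ideals R) (ideal_class_rel R)"
    using one_not_zero by (auto simp: refl_on_def ideal_class_rel_def intro!: bexI[of _ \<one>])
  show "sym (ideal_class_rel R)"
    by (auto simp: sym_def ideal_class_rel_def) (metis Diff_iff singletonD)
  show "trans (ideal_class_rel R)"
  proof (rule transI)
    fix I J L assume IJ: "(I, J) \<in> ideal_class_rel R" and JL: "(J, L) \<in> ideal_class_rel R"
    obtain a b where ab: "a \<in> carrier R - {\<zero>}" "b \<in> carrier R - {\<zero>}"
      "(\<lambda>x. a \<otimes> x) ` I = (\<lambda>x. b \<otimes> x) ` J"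
      using IJ by (auto simp: ideal_class_rel_def)
    obtain c d where cd: "c \<in> carrier R - {\<zero>}" "d \<in> carrier R - {\<zero>}"
      "(\<lambda>x. c \<otimes> x) ` J = (\<lambda>x. d \<otimes> x) ` L"
      using JL by (auto simp: ideal_class_rel_def)
    have I: "I \<in> nonzero_ideals R" and J: "J \<in> nonzero_ideals R" and L: "L \<in> nonzero_ideals R"
      using IJ JL by (auto simp: ideal_class_rel_def)
    have sub: "M \<subseteq> carrier R" if "M \<in> nonzero_ideals R" for M
      using that by (auto simp: nonzero_ideals_def dest: ideal.Icarr)
    have "(\<lambda>x. (c \<otimes> a) \<otimes> x) ` I = (\<lambda>x. c \<otimes> x) ` (\<lambda>x. a \<otimes> x) ` I"
      unfolding image_image using ab cd sub[OF I] by (intro image_cong) (auto simp: m_assoc)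
    also have "\<dots> = (\<lambda>x. b \<otimes> x) ` (\<lambda>x. c \<otimes> x) ` J"
      unfolding ab(3) image_image using ab cd sub[OF J]
      by (intro image_cong refl) (auto simp: m_lcomm subset_iff)
    also have "\<dots> = (\<lambda>x. (b \<otimes> d) \<otimes> x) ` L"
      unfolding cd(3) image_image using ab cd sub[OF L]
      by (intro image_cong refl) (auto simp: m_assoc)
    finally have "(\<lambda>x. (c \<otimes> a) \<otimes> x) ` I = (\<lambda>x. (b \<otimes> d) \<otimes> x) ` L" .
    moreover have "c \<otimes> a \<in> carrier R - {\<zero>}" "b \<otimes> d \<in> carrier R - {\<zero>}"
      using ab cd by (auto simp: integral_iff)
    ultimately show "(I, L) \<in> ideal_class_rel R"
      using I L unfolding ideal_class_rel_def by blast
  qed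
qed

definition class_number :: "complex set \<Rightarrow> nat" where
  "class_number K =
     (let R = ring_of_integers K in card (nonzero_ideals R // ideal_class_rel R))"

end

theory Submission
  imports Defs "HOL-Analysis.Analysis" "HOL-Computational_Algebra.Squarefree"
    "HOL-Computational_Algebra.Nth_Powers"
begin

text \<open>
  Let \<open>\<chi>\<close> be the Legendre symbol modulo \<open>p\<close>. Shifting the residues \<open>as\<^sup>2\<close> by \<open>b\<close> multiplies the sign of
  the pair \<open>(s, t)\<close> by \<open>e\<^sub>s e\<^sub>t\<close>, where \<open>e\<^sub>s = -1\<close> iff the residue of \<open>as\<^sup>2\<close> is less than \<open>b\<close>; since \<open>n\<close> is odd,
  the product over all pairs is the product of all \<open>e\<^sub>s\<close>, which accounts for the second cardinality. For the
  unshifted residues one compares \<open>\<Prod>\<chi>(as\<^sup>2 - at\<^sup>2)\<close>, which is elementary, with the product of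
  \<open>\<chi>(u - v)\<close> over all \<open>u > v\<close> with \<open>\<chi>(u) = \<chi>(v) = \<chi>(a)\<close>; the latter is determined by the parity of the number
  of pairs \<open>(x, y)\<close> such that \<open>x\<close>, \<open>y\<close> and \<open>x + y < p\<close> all lie in the class of \<open>a\<close>. Swapping \<open>x\<close> and \<open>y\<close>
  leaves only \<open>x = y\<close>, so the parity is that of the number of \<open>x \<le> n\<close> with \<open>\<chi>(x) = \<chi>(a)\<close> if \<open>\<chi>(2) = 1\<close>, and
  even otherwise.

  For \<open>p \<equiv> 7 (mod 8)\<close> it remains to see that \<open>h(-p) = \<Sum>\<^bsub>r \<le> n\<^esub> \<chi>(r)\<close>. Ideals of norm \<open>m\<close> are counted
  in two ways: there are \<open>\<Sum>\<^bsub>d | m\<^esub> \<chi>(d)\<close> of them, and twice the number of those in a given class is the number of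
  representations of \<open>m\<close> by a form \<open>f\<close> of discriminant \<open>-p\<close>. Hence the theta series \<open>\<Sum> exp(-t f(x, y))\<close>, summed over
  the classes, differ from the Lambert series \<open>2 \<Sum> \<chi>(d) / (exp(t d) - 1)\<close> exactly by the constant \<open>h(-p)\<close>.
  As \<open>t \<rightarrow> 0\<close> each theta series is \<open>C / t + o(1)\<close>, so comparing constant terms gives
  \<open>h(-p) = L(0, \<chi>)\<close>; neither \<open>L(1, \<chi>)\<close> nor Gauss sums are needed.
\<close>

section \<open>Order of quadratic residues\<close>

text \<open>A direct comparison of constant terms would require the pole constant C, and its
  equality for all forms of one discriminant. It is eliminated instead by passing from f(t) to f(t)
  - 4 f(4t), which kills 1/t and multiplies a constant by -3. The factor 4 makes both sides
  accessible: scaling t by 4 amounts to restricting a form to the points with even coordinates, so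
  the theta side turns into alternating lattice sums; and with X = exp(t d) the kernel 1/(X - 1) -
  4/(X^4 - 1) equals 1/(X + 1) + 2/(X^2 + 1), which is bounded at X = 1, so the Lambert side is
  governed by the bounded partial sums of \<chi>. The value L(0, \<chi>) thereby appears as the mean
  of these partial sums over a period, and it becomes the half sum because \<chi>(2) = 1. The prime
  3, whose field has additional units, never meets this argument, since it is not 7 modulo
  8.\<close>

lemma Legendre_values: "Legendre a p \<in> {-1, 0, 1}"
  by (simp add: Legendre_def)

lemma Legendre_cong:
  assumes "[a = b] (mod p)"
  shows "Legendre a p = Legendre b p"
proof -
  have "[a = 0] (mod p) \<longleftrightarrow> [b = 0] (mod p)" "QuadRes p a \<longleftrightarrow> QuadRes p b"
    using assms unfolding QuadRes_def by (metis cong_sym cong_trans)+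
  then show ?thesis by (simp add: Legendre_def)
qed

lemma Legendre_eq_0_iff: "Legendre a p = 0 \<longleftrightarrow> p dvd a"
  by (simp add: Legendre_def cong_0_iff)

lemma Legendre_one: "p > 1 \<Longrightarrow> Legendre 1 p = 1"
proof -
  assume "p > 1"
  moreover have "QuadRes p 1" unfolding QuadRes_def by (intro exI[of _ 1]) simp
  ultimately show ?thesis by (auto simp: Legendre_def cong_0_iff)
qed

text \<open>Two elements of {-1, 0, 1} differ by at most 2, less than the modulus. Euler's criterion
  yields congruences; this turns them into equalities of symbols.\<close>

lemma cong_imp_eq_sign:
  fixes x y p :: int
  assumes "[x = y] (mod p)" "p > 2" "x \<in> {-1, 0, 1}" "y \<in> {-1, 0, 1}"
  shows "x = y"
proof -
  have "p dvd x - y" using assms(1) by (simp add: cong_iff_dvd_diff)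
  then show ?thesis
    using assms(2-4) zdvd_imp_le[of p "x - y"] zdvd_imp_le[of p "y - x"] by (auto simp: dvd_minus_iff)
qed

lemma Legendre_mult:
  assumes "prime p" "p > 2"
  shows "Legendre (a * b) (int p) = Legendre a (int p) * Legendre b (int p)"
proof (rule cong_imp_eq_sign[where p = "int p"])
  note e = euler_criterion[OF assms]
  have "[Legendre a p * Legendre b p = a ^ ((p - 1) div 2) * b ^ ((p - 1) div 2)] (mod p)"
    by (rule cong_mult[OF e e])
  then show "[Legendre (a * b) p = Legendre a p * Legendre b p] (mod p)"
    using e[of "a * b"] by (metis cong_sym cong_trans power_mult_distrib)
  show "Legendre a p * Legendre b p \<in> {-1, 0, 1}"
    using Legendre_values[of a p] Legendre_values[of b p] by auto
qed (use assms Legendre_values in auto)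

text \<open>The exponent in Gauss's lemma for the multiplier 2: the multiples \<open>2 * x\<close>
  with \<open>x \<le> n\<close> that exceed \<open>n\<close>.\<close>

lemma card_lessThan_double:
  "card {x :: int. 0 < x \<and> x \<le> int n \<and> int n < 2 * x} = n - n div 2"
proof -
  have "{x :: int. 0 < x \<and> x \<le> int n \<and> int n < 2 * x} = {int (n div 2) <.. int n}"
    by auto
  then show ?thesis by simp
qed

lemma Legendre_two:
  assumes "prime p" "p = 2 * n + 1"
  shows "Legendre 2 (int p) = (- 1) ^ (n - n div 2)"
proof -
  have p2: "p > 2" using assms(2) prime_ge_2_nat[OF assms(1)] by presburger
  have "\<not> [2 = 0] (mod int p)"
    using p2 by (auto simp: cong_0_iff dest: zdvd_imp_le)
  then interpret GAUSS p 2
    using assms p2 by unfold_locales auto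
  have n: "(int p - 1) div 2 = int n" using assms by simp
  \<comment> \<open>With multiplier 2 all multiples stay below \<open>p\<close>, so reducing them
    modulo \<open>p\<close> changes nothing.\<close>
  have "C = B"
    unfolding C_def B_def A_def n image_image using assms by (intro image_cong) auto
  then have "E = (\<lambda>x. x * 2) ` {x. 0 < x \<and> x \<le> int n \<and> int n < 2 * x}"
    unfolding E_def n B_def A_def by auto
  then have "card E = card {x. 0 < x \<and> x \<le> int n \<and> int n < 2 * x}"
    by (simp add: card_image inj_on_def)
  then show ?thesis using gauss_lemma card_lessThan_double[of n] by simp
qed

section \<open>Symbols of factorials and of differences of squares\<close>

locale prime_3_mod_4 =
  fixes p n :: nat
  assumes prime_p: "prime p" and p_eq: "p = 2 * n + 1" and odd_n: "odd n"
begin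

abbreviation chi :: "int \<Rightarrow> int" where "chi r \<equiv> Legendre r (int p)"

lemma p_gt_2: "p > 2"
  using p_eq prime_ge_2_nat[OF prime_p] by presburger

lemma chi_mult: "chi (a * b) = chi a * chi b"
  by (rule Legendre_mult[OF prime_p p_gt_2])

lemma chi_minus: "chi (- a) = - chi a"
proof -
  have "[chi (- 1) = (- 1) ^ ((p - 1) div 2)] (mod p)"
    by (rule euler_criterion[OF prime_p p_gt_2])
  then have "[chi (- 1) = - 1] (mod p)" using p_eq odd_n by simp
  then have "chi (- 1) = - 1"
    using cong_imp_eq_sign[of "chi (- 1)" "- 1" "int p"] Legendre_values p_gt_2 by simp
  then show ?thesis using chi_mult[of "- 1" a] by simp
qed

lemma chi_p_minus: "chi (int p - a) = - chi a"
proof -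
  have "chi (int p - a) = chi (- a)"
    by (rule Legendre_cong) (simp add: cong_iff_dvd_diff)
  then show ?thesis by (simp add: chi_minus)
qed

lemma chi_cases: "\<not> int p dvd a \<Longrightarrow> chi a = 1 \<or> chi a = - 1"
  using Legendre_values[of a p] Legendre_eq_0_iff[of a p] by auto

lemma chi_square: "\<not> int p dvd a \<Longrightarrow> chi a * chi a = 1"
  using chi_cases[of a] by auto

lemma not_dvd_small: "0 < \<bar>x\<bar> \<Longrightarrow> \<bar>x\<bar> < int p \<Longrightarrow> \<not> int p dvd x"
  by (metis abs_of_nat dvd_imp_le_int leD zero_less_abs_iff)

text \<open>By multiplicativity, the symbol of the factorial of \<open>k\<close>.\<close>

definition chi_fact :: "nat \<Rightarrow> int" where "chi_fact k = (\<Prod>j=1..k. chi (int j))"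

lemma chi_fact_Suc: "chi_fact (Suc k) = chi_fact k * chi (int (Suc k))"
  by (simp add: chi_fact_def)

lemma chi_fact_square: "k < p \<Longrightarrow> chi_fact k * chi_fact k = 1"
proof (induction k)
  case (Suc k)
  have "chi_fact (Suc k) * chi_fact (Suc k) =
      (chi_fact k * chi_fact k) * (chi (int (Suc k)) * chi (int (Suc k)))"
    unfolding chi_fact_Suc by (simp add: ac_simps)
  moreover have "chi (int (Suc k)) * chi (int (Suc k)) = 1"
    using Suc.prems by (intro chi_square not_dvd_small) auto
  ultimately show ?case using Suc by simp
qed (simp add: chi_fact_def)

text \<open>The top \<open>k\<close> factors of the factorial of \<open>p - 1\<close> are
  \<open>p - j\<close> for \<open>j = 1..k\<close>, and each has the symbol
  \<open>- chi j\<close>.\<close>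

lemma chi_fact_complement:
  "k \<le> p - 1 \<Longrightarrow> chi_fact (p - 1 - k) * chi_fact k * (- 1) ^ k = chi_fact (p - 1)"
proof (induction k)
  case (Suc k)
  have "p - 1 - k = Suc (p - 1 - Suc k)" using Suc.prems by simp
  then have *: "chi_fact (p - 1 - k) = chi_fact (p - 1 - Suc k) * chi (int (p - 1 - k))"
    by (simp add: chi_fact_Suc)
  have "int (p - 1 - k) = int p - int (Suc k)" using Suc.prems p_gt_2 by simp
  then have "chi (int (p - 1 - k)) = - chi (int (Suc k))" by (simp only: chi_p_minus)
  then show ?case using Suc * by (simp add: chi_fact_Suc ac_simps)
qed (simp add: chi_fact_def)

lemma chi_fact_p_minus_1: "chi_fact (p - 1) = - 1"
  using chi_fact_complement[of n] chi_fact_square[of n] odd_n by (simp add: p_eq)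

text \<open>The complement formula for the odd number \<open>2 * s - 1\<close>: its sign -1 cancels
  against \<open>chi_fact (p - 1) = - 1\<close>, so the two values have product 1 and agree.\<close>

lemma chi_fact_reflect:
  assumes "1 \<le> s" "s \<le> n"
  shows "chi_fact (2 * (n + 1 - s) - 1) = chi_fact (2 * s - 1)"
proof -
  have 1: "2 * (n + 1 - s) - 1 = p - 1 - (2 * s - 1)" using assms p_eq by simp
  have odd: "odd (2 * s - 1)" using assms by simp
  have "chi_fact (2 * (n + 1 - s) - 1) * chi_fact (2 * s - 1) = 1"
    using chi_fact_complement[of "2 * s - 1"] chi_fact_p_minus_1 odd assms p_eq
    unfolding 1 by simp
  then show ?thesis by (auto simp: zmult_eq_1_iff)
qed

text \<open>Factors at mirror positions are equal signs and multiply to 1; only the middle one is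
  unpaired.\<close>

lemma prod_reflect:
  fixes g :: "nat \<Rightarrow> int"
  assumes "\<And>s. 1 \<le> s \<Longrightarrow> s \<le> 2 * m + 1 \<Longrightarrow> g (2 * m + 2 - s) = g s"
    and "\<And>s. 1 \<le> s \<Longrightarrow> s \<le> 2 * m + 1 \<Longrightarrow> g s * g s = 1"
  shows "(\<Prod>s=1..2 * m + 1. g s) = g (m + 1)"
proof -
  have "{1..2 * m + 1} = {1..m} \<union> {m + 1} \<union> {m + 2..2 * m + 1}" by auto
  then have "(\<Prod>s=1..2 * m + 1. g s) = (\<Prod>s=1..m. g s) * g (m + 1) * (\<Prod>s=m + 2..2 * m + 1. g s)"
    by (simp add: prod.union_disjoint)
  also have "(\<Prod>s=m + 2..2 * m + 1. g s) = (\<Prod>s=1..m. g s)"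
    by (rule prod.reindex_bij_witness[of _ "\<lambda>s. 2 * m + 2 - s" "\<lambda>s. 2 * m + 2 - s"])
      (use assms(1) in auto)
  also have "(\<Prod>s=1..m. g s) * g (m + 1) * (\<Prod>s=1..m. g s) = (\<Prod>s=1..m. g s * g s) * g (m + 1)"
    by (simp add: prod.distrib)
  also have "(\<Prod>s=1..m. g s * g s) = 1" using assms(2) by (intro prod.neutral) auto
  finally show ?thesis by simp
qed

text \<open>In \<open>s^2 - t^2 = (s - t) * (s + t)\<close> the two factors together run through
  \<open>1..2 * s - 1\<close> with the exception of \<open>s\<close>. The missing symbol is restored
  by multiplying with \<open>chi s\<close>, which is its own inverse.\<close>

lemma prod_chi_square_diff_row:
  assumes "1 \<le> s" "s \<le> n"
  shows "(\<Prod>t=1..<s. chi ((int s)\<^sup>2 - (int t)\<^sup>2)) = chi_fact (2 * s - 1) * chi (int s)"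
proof -
  have "(\<Prod>t=1..<s. chi ((int s)\<^sup>2 - (int t)\<^sup>2)) = (\<Prod>t=1..<s. chi (int (s - t)) * chi (int (s + t)))"
    by (intro prod.cong refl) (simp add: chi_mult[symmetric] of_nat_diff power2_eq_square algebra_simps)
  also have "\<dots> = (\<Prod>t=1..<s. chi (int (s - t))) * (\<Prod>t=1..<s. chi (int (s + t)))"
    by (rule prod.distrib)
  also have "(\<Prod>t=1..<s. chi (int (s - t))) = (\<Prod>t=1..<s. chi (int t))"
    by (rule prod.reindex_bij_witness[of _ "\<lambda>t. s - t" "\<lambda>t. s - t"]) auto
  also have "(\<Prod>t=1..<s. chi (int (s + t))) = (\<Prod>t=s + 1..2 * s - 1. chi (int t))"
    by (rule prod.reindex_bij_witness[of _ "\<lambda>t. t - s" "\<lambda>t. s + t"]) auto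
  finally have eq: "(\<Prod>t=1..<s. chi ((int s)\<^sup>2 - (int t)\<^sup>2)) =
    (\<Prod>t=1..<s. chi (int t)) * (\<Prod>t=s + 1..2 * s - 1. chi (int t))" .
  have "{1..2 * s - 1} = {1..<s} \<union> {s..2 * s - 1}" using assms by auto
  then have "chi_fact (2 * s - 1) = (\<Prod>t=1..<s. chi (int t)) * (\<Prod>t=s..2 * s - 1. chi (int t))"
    unfolding chi_fact_def by (subst prod.union_disjoint[symmetric]) auto
  also have "(\<Prod>t=s..2 * s - 1. chi (int t)) = chi (int s) * (\<Prod>t=s + 1..2 * s - 1. chi (int t))"
    using assms by (simp add: prod.atLeast_Suc_atMost)
  finally have "chi_fact (2 * s - 1) =
    (\<Prod>t=1..<s. chi (int t)) * (chi (int s) * (\<Prod>t=s + 1..2 * s - 1. chi (int t)))" .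
  then have "chi_fact (2 * s - 1) * chi (int s) =
    (\<Prod>t=1..<s. chi (int t)) * (\<Prod>t=s + 1..2 * s - 1. chi (int t)) * (chi (int s) * chi (int s))"
    by simp
  also have "chi (int s) * chi (int s) = 1"
    using assms p_eq by (intro chi_square not_dvd_small) auto
  finally show ?thesis unfolding eq by simp
qed

text \<open>As \<open>n\<close> is odd, the rows have a middle one, \<open>s = m + 1\<close>, where
  \<open>2 * s - 1 = n\<close>; by reflection the product of the factorial symbols is
  \<open>chi_fact n\<close>. The extra factors \<open>chi s\<close> contribute
  \<open>chi_fact n\<close> once more, and the two cancel.\<close>

lemma prod_chi_square_diff: "(\<Prod>s=1..n. \<Prod>t=1..<s. chi ((int s)\<^sup>2 - (int t)\<^sup>2)) = 1"
proof -
  obtain m where m: "n = 2 * m + 1" using odd_n by (rule oddE)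
  have sq: "chi_fact (2 * s - 1) * chi_fact (2 * s - 1) = 1" if "s \<le> n" for s
    using that p_eq by (intro chi_fact_square) auto
  have "(\<Prod>s=1..n. chi_fact (2 * s - 1)) = chi_fact (2 * (m + 1) - 1)"
    unfolding m
  proof (rule prod_reflect)
    fix s assume s: "1 \<le> s" "s \<le> 2 * m + 1"
    show "chi_fact (2 * (2 * m + 2 - s) - 1) = chi_fact (2 * s - 1)"
      using chi_fact_reflect[of s] s m by simp
    show "chi_fact (2 * s - 1) * chi_fact (2 * s - 1) = 1"
      using sq s m by simp
  qed
  also have "\<dots> = chi_fact n" by (simp add: m)
  finally have "(\<Prod>s=1..n. chi_fact (2 * s - 1)) = chi_fact n" .
  moreover have "(\<Prod>s=1..n. \<Prod>t=1..<s. chi ((int s)\<^sup>2 - (int t)\<^sup>2)) =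
      (\<Prod>s=1..n. chi_fact (2 * s - 1) * chi (int s))"
    by (intro prod.cong refl prod_chi_square_diff_row) auto
  moreover have "(\<Prod>s=1..n. chi (int s)) = chi_fact n" by (simp add: chi_fact_def)
  ultimately show ?thesis using chi_fact_square[of n] p_eq by (simp add: prod.distrib)
qed

end

section \<open>Signs and products over pairs\<close>

lemma even_card_swap_invariant:
  fixes W :: "(int \<times> int) set"
  assumes "finite W" "\<And>x y. (x, y) \<in> W \<Longrightarrow> (y, x) \<in> W"
  shows "(- 1 :: int) ^ card W = (- 1) ^ card {x. (x, x) \<in> W}"
proof -
  define A B C where "A = {w \<in> W. fst w < snd w}" and "B = {w \<in> W. snd w < fst w}"
    and "C = {w \<in> W. fst w = snd w}"
  have fin: "finite A" "finite B" "finite C" using assms(1) by (auto simp: A_def B_def C_def)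
  have "W = A \<union> B \<union> C" by (auto simp: A_def B_def C_def)
  moreover have "card (A \<union> B \<union> C) = card (A \<union> B) + card C"
    by (intro card_Un_disjoint) (use fin in \<open>auto simp: A_def B_def C_def\<close>)
  moreover have "card (A \<union> B) = card A + card B"
    by (intro card_Un_disjoint) (use fin in \<open>auto simp: A_def B_def\<close>)
  moreover have "card A = card B"
    by (rule bij_betw_same_card[of prod.swap], rule bij_betwI[of _ _ _ prod.swap])
      (auto simp: A_def B_def assms(2))
  moreover have "card C = card {x. (x, x) \<in> W}"
    by (rule bij_betw_same_card[of fst], rule bij_betwI[of _ _ _ "\<lambda>x. (x, x)"])
      (auto simp: C_def)
  ultimately show ?thesis by (simp add: power_add power_mult_distrib[symmetric])
qed

lemma neg_one_power_card_eq_prod: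
  assumes "finite A"
  shows "(- 1 :: int) ^ card {x \<in> A. Q x} = (\<Prod>x\<in>A. if Q x then - 1 else 1)"
proof -
  have "(\<Prod>x\<in>A. if Q x then - 1 else 1 :: int) = (\<Prod>x\<in>{x \<in> A. Q x}. - 1)"
    using assms by (rule prod.inter_filter[symmetric])
  then show ?thesis by simp
qed

text \<open>Each unordered pair of indices is sent to the unordered pair of its values, the larger
  value written in front; the absolute difference does not see which index was the larger.\<close>

lemma prod_pairs_abs_diff:
  fixes f :: "nat \<Rightarrow> int" and g :: "int \<Rightarrow> int"
  assumes inj: "inj_on f {1..n}"
  shows "(\<Prod>s=1..n. \<Prod>t=1..<s. g \<bar>f s - f t\<bar>) =
    (\<Prod>(u, v)\<in>{(u, v). u \<in> f ` {1..n} \<and> v \<in> f ` {1..n} \<and> v < u}. g (u - v))"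
proof -
  let ?S = "SIGMA s:{1..n}. {1..<s}"
  have "(\<Prod>s=1..n. \<Prod>t=1..<s. g \<bar>f s - f t\<bar>) = (\<Prod>(s, t)\<in>?S. g \<bar>f s - f t\<bar>)"
    by (rule prod.Sigma) auto
  also have "\<dots> = (\<Prod>(u, v)\<in>{(u, v). u \<in> f ` {1..n} \<and> v \<in> f ` {1..n} \<and> v < u}. g (u - v))"
  proof -
    have "bij_betw (\<lambda>(s, t). (max (f s) (f t), min (f s) (f t))) ?S
        {(u, v). u \<in> f ` {1..n} \<and> v \<in> f ` {1..n} \<and> v < u}"
      unfolding bij_betw_def
    proof
      show "inj_on (\<lambda>(s, t). (max (f s) (f t), min (f s) (f t))) ?S"
      proof (rule inj_onI, clarify)
        fix s t s' t'
        assume *: "s \<in> {1..n}" "t \<in> {1..<s}" "s' \<in> {1..n}" "t' \<in> {1..<s'}"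
          "max (f s) (f t) = max (f s') (f t')" "min (f s) (f t) = min (f s') (f t')"
        then have "f s = f s' \<and> f t = f t' \<or> f s = f t' \<and> f t = f s'"
          by (auto simp: max_def min_def split: if_splits)
        then have "s = s' \<and> t = t' \<or> s = t' \<and> t = s'"
          using * by (simp add: inj_on_eq_iff[OF inj])
        then show "s = s' \<and> t = t'" using * by auto
      qed
      show "(\<lambda>(s, t). (max (f s) (f t), min (f s) (f t))) ` ?S =
        {(u, v). u \<in> f ` {1..n} \<and> v \<in> f ` {1..n} \<and> v < u}" (is "_ = ?R")
      proof (intro equalityI subsetI)
        fix w assume "w \<in> (\<lambda>(s, t). (max (f s) (f t), min (f s) (f t))) ` ?S"
        then obtain s t where st: "s \<in> {1..n}" "t \<in> {1..<s}"
          "w = (max (f s) (f t), min (f s) (f t))" by auto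
        then have "f s \<noteq> f t" "t \<in> {1..n}" using inj by (auto dest: inj_onD)
        with st show "w \<in> ?R" by (auto simp: max_def min_def)
      next
        fix w assume "w \<in> ?R"
        then obtain i j where ij: "i \<in> {1..n}" "j \<in> {1..n}" "f j < f i" "w = (f i, f j)" by auto
        then consider "j < i" | "i < j" by (cases i j rule: linorder_cases) auto
        then show "w \<in> (\<lambda>(s, t). (max (f s) (f t), min (f s) (f t))) ` ?S"
        proof cases
          case 1
          then show ?thesis using ij by (intro image_eqI[of _ _ "(i, j)"]) (auto simp: max_def min_def)
        next
          case 2
          then show ?thesis using ij by (intro image_eqI[of _ _ "(j, i)"]) (auto simp: max_def min_def)
        qed
      qed
    qed
    from prod.reindex_bij_betw[OF this, of "\<lambda>(u, v). g (u - v)"]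
    show ?thesis
      by (rule trans[rotated]) (auto simp: max_def min_def intro!: prod.cong)
  qed
  finally show ?thesis .
qed

lemma sign_cancel:
  fixes N T E :: int
  assumes "N = T * (N * E)" "N * N = 1" "E * E = 1"
  shows "T = E"
proof -
  have "E * (N * N) = E * (T * (N * E) * N)" using assms(1) by simp
  also have "\<dots> = T * (N * N) * (E * E)" by (simp add: ac_simps)
  finally show ?thesis using assms(2,3) by simp
qed

text \<open>Sorting the values of an odd function of differences costs one sign per inversion.\<close>

lemma prod_pairs_sort:
  fixes f :: "nat \<Rightarrow> int" and g :: "int \<Rightarrow> int"
  assumes odd: "\<And>x. g (- x) = - g x" and inj: "inj_on f {1..n}"
  shows "(\<Prod>s=1..n. \<Prod>t=1..<s. g (f t - f s)) =
    (\<Prod>s=1..n. \<Prod>t=1..<s. if f s > f t then - 1 else 1) *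
    (\<Prod>(u, v)\<in>{(u, v). u \<in> f ` {1..n} \<and> v \<in> f ` {1..n} \<and> v < u}. g (u - v))"
proof -
  have "(\<Prod>s=1..n. \<Prod>t=1..<s. g (f t - f s)) =
    (\<Prod>s=1..n. \<Prod>t=1..<s. (if f s > f t then - 1 else 1) * g \<bar>f s - f t\<bar>)"
  proof (intro prod.cong refl)
    fix s t
    have "g (f t - f s) = - g (f s - f t)" using odd[of "f s - f t"] by simp
    then show "g (f t - f s) = (if f s > f t then - 1 else 1) * g \<bar>f s - f t\<bar>"
      by auto
  qed
  also have "\<dots> = (\<Prod>s=1..n. \<Prod>t=1..<s. if f s > f t then - 1 else 1) *
      (\<Prod>s=1..n. \<Prod>t=1..<s. g \<bar>f s - f t\<bar>)"
    by (simp only: prod.distrib)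
  also have "(\<Prod>s=1..n. \<Prod>t=1..<s. g \<bar>f s - f t\<bar>) =
    (\<Prod>(u, v)\<in>{(u, v). u \<in> f ` {1..n} \<and> v \<in> f ` {1..n} \<and> v < u}. g (u - v))"
    by (rule prod_pairs_abs_diff[OF inj])
  finally show ?thesis .
qed

text \<open>Each \<open>g s\<close> occurs once for each of the \<open>n\<close> other indices in
  \<open>0..n\<close>.\<close>

lemma prod_pairs_mult:
  fixes g :: "nat \<Rightarrow> int"
  shows "(\<Prod>s\<le>n. \<Prod>t<s. g s * g t) = (\<Prod>s\<le>n. g s) ^ n"
proof (induction n)
  case (Suc n)
  have "(\<Prod>t<Suc n. g (Suc n) * g t) = g (Suc n) ^ Suc n * (\<Prod>s\<le>n. g s)"
    unfolding prod.distrib by (simp add: lessThan_Suc_atMost)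
  with Suc have "(\<Prod>s\<le>Suc n. \<Prod>t<s. g s * g t) =
      (\<Prod>s\<le>n. g s) ^ n * (g (Suc n) ^ Suc n * (\<Prod>s\<le>n. g s))"
    by (simp only: prod.atMost_Suc)
  also have "\<dots> = (\<Prod>s\<le>Suc n. g s) ^ Suc n"
    by (simp add: power_mult_distrib)
  finally show ?case .
qed simp

lemma neg_one_power_card_pairs:
  fixes n :: nat
  shows "(- 1 :: int) ^ card {(s :: int, t :: int). 0 \<le> t \<and> t < s \<and> s \<le> int n \<and> Q s t} =
    (\<Prod>s\<le>n. \<Prod>t<s. if Q (int s) (int t) then - 1 else 1)"
proof -
  let ?S = "SIGMA s:{..n}. {..<s}"
  have "{(s :: int, t :: int). 0 \<le> t \<and> t < s \<and> s \<le> int n \<and> Q s t} =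
      map_prod int int ` {x \<in> ?S. Q (int (fst x)) (int (snd x))}"
  proof (intro equalityI subsetI)
    fix w assume "w \<in> {(s :: int, t :: int). 0 \<le> t \<and> t < s \<and> s \<le> int n \<and> Q s t}"
    then show "w \<in> map_prod int int ` {x \<in> ?S. Q (int (fst x)) (int (snd x))}"
      by (intro image_eqI[of _ _ "map_prod nat nat w"]) auto
  qed auto
  then have "card {(s :: int, t :: int). 0 \<le> t \<and> t < s \<and> s \<le> int n \<and> Q s t} =
      card {x \<in> ?S. Q (int (fst x)) (int (snd x))}"
    by (simp add: card_image inj_on_def)
  then have "(- 1 :: int) ^ card {(s :: int, t :: int). 0 \<le> t \<and> t < s \<and> s \<le> int n \<and> Q s t} =
      (\<Prod>x\<in>?S. if Q (int (fst x)) (int (snd x)) then - 1 else 1)"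
    by (simp only: neg_one_power_card_eq_prod finite_SigmaI finite_atMost finite_lessThan)
  also have "\<dots> = (\<Prod>s\<le>n. \<Prod>t<s. if Q (int s) (int t) then - 1 else 1)"
    by (subst prod.Sigma) (auto simp: case_prod_unfold)
  finally show ?thesis .
qed

section \<open>The enumeration of a quadratic class by \<open>a * s^2\<close>, and its
  inversions\<close>

context prime_3_mod_4
begin

definition resid :: "int \<Rightarrow> nat \<Rightarrow> int" where "resid a s = (a * (int s)\<^sup>2) mod int p"

text \<open>For \<open>a\<close> prime to \<open>p\<close> this is either the set of quadratic
  residues or the set of nonresidues in \<open>1..p - 1\<close>.\<close>

definition chi_class :: "int \<Rightarrow> int set" where
  "chi_class a = {x. 0 < x \<and> x < int p \<and> chi x = chi a}"

lemma resid_cong: "[resid a s = a * (int s)\<^sup>2] (mod int p)"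
  by (simp add: resid_def)

lemma finite_chi_class: "finite (chi_class a)"
  by (rule finite_subset[of _ "{0..int p}"]) (auto simp: chi_class_def)

lemma resid_bounds: "0 \<le> resid a s" "resid a s < int p"
  using p_gt_2 by (auto simp: resid_def)

lemma resid_0 [simp]: "resid a 0 = 0"
  by (simp add: resid_def)

context
  fixes a :: int
  assumes a: "\<not> int p dvd a"
begin

lemma prime_int_p: "prime (int p)"
  using prime_p by simp

lemma chi_resid:
  assumes "1 \<le> s" "s \<le> n"
  shows "chi (resid a s) = chi a"
proof -
  have "chi (resid a s) = chi (a * (int s)\<^sup>2)"
    by (rule Legendre_cong[OF resid_cong])
  also have "\<dots> = chi a * (chi (int s) * chi (int s))"
    by (simp add: chi_mult power2_eq_square)
  also have "chi (int s) * chi (int s) = 1"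
    using assms p_eq by (intro chi_square not_dvd_small) auto
  finally show ?thesis by simp
qed

lemma chi_a: "chi a * chi a = 1"
  by (rule chi_square[OF a])

lemma resid_pos: "1 \<le> s \<Longrightarrow> s \<le> n \<Longrightarrow> resid a s > 0"
  using chi_resid[of s] resid_bounds(1)[of a s] chi_a Legendre_eq_0_iff[of "resid a s" "int p"]
  by (cases "resid a s = 0") auto

lemma inj_resid: "inj_on (resid a) {0..n}"
proof (rule inj_onI)
  fix s t assume st: "s \<in> {0..n}" "t \<in> {0..n}" "resid a s = resid a t"
  from st(3) have "[a * (int s)\<^sup>2 = a * (int t)\<^sup>2] (mod int p)"
    by (simp only: resid_def unique_euclidean_semiring_class.cong_def)
  then have "int p dvd a * ((int s - int t) * (int s + int t))"
    by (simp add: cong_iff_dvd_diff algebra_simps power2_eq_square)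
  then have "int p dvd int s - int t \<or> int p dvd int s + int t"
    using a prime_int_p by (simp add: prime_dvd_mult_iff)
  then show "s = t"
  proof
    assume "int p dvd int s - int t"
    moreover have "\<bar>int s - int t\<bar> < int p" using st p_eq by auto
    ultimately show ?thesis using not_dvd_small[of "int s - int t"] by auto
  next
    assume "int p dvd int s + int t"
    moreover have "\<bar>int s + int t\<bar> < int p" using st p_eq by auto
    ultimately have "\<not> 0 < \<bar>int s + int t\<bar>" using not_dvd_small[of "int s + int t"] by blast
    then show ?thesis by simp
  qed
qed

lemma image_resid: "resid a ` {1..n} = chi_class a"
proof (intro equalityI subsetI)
  fix x assume "x \<in> resid a ` {1..n}"
  then show "x \<in> chi_class a"
    using chi_resid resid_pos resid_bounds by (auto simp: chi_class_def)
next
  fix x assume x: "x \<in> chi_class a"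
  \<comment> \<open>Dividing \<open>x\<close> by \<open>a\<close> gives a quadratic residue; its
    root is folded into \<open>0..n\<close> by the sign change from \<open>z\<close> to
    \<open>p - z\<close>.\<close>
  have "coprime a (int p)" using a prime_int_p by (metis coprime_commute prime_imp_coprime)
  then obtain a' where a': "[a * a' = 1] (mod int p)" by (meson cong_solve_coprime_int)
  have "chi (x * a') = chi a * chi a'" using x by (simp add: chi_mult chi_class_def)
  also have "\<dots> = 1" using Legendre_cong[OF a'] Legendre_one[of "int p"] p_gt_2 by (simp add: chi_mult)
  finally have "QuadRes (int p) (x * a')" by (simp add: Legendre_def split: if_splits)
  then obtain y where y: "[y\<^sup>2 = x * a'] (mod int p)" by (auto simp: QuadRes_def)
  define z where "z = y mod int p"
  define s where "s = (if z \<le> int n then nat z else nat (int p - z))"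
  have z: "0 \<le> z" "z < int p" "[z = y] (mod int p)" using p_gt_2 by (auto simp: z_def)
  have s: "s \<le> n" using z p_eq by (auto simp: s_def)
  have "[(int s)\<^sup>2 = z\<^sup>2] (mod int p)"
  proof (cases "z \<le> int n")
    case False
    then have eq: "int s = int p - z" using z by (simp add: s_def)
    have "(int s)\<^sup>2 - z\<^sup>2 = int p * (int p - 2 * z)"
      unfolding eq by (simp add: power2_eq_square algebra_simps)
    then show ?thesis by (simp add: cong_iff_dvd_diff)
  qed (use z s_def in auto)
  also have "[z\<^sup>2 = y\<^sup>2] (mod int p)" using z(3) by (rule cong_pow)
  also note y
  finally have "[a * (int s)\<^sup>2 = a * (x * a')] (mod int p)" by (rule cong_scalar_left)
  also have "a * (x * a') = x * (a * a')" by simp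
  also have "[x * (a * a') = x * 1] (mod int p)" by (rule cong_scalar_left[OF a'])
  finally have rs: "resid a s = x"
    using x by (simp add: resid_def unique_euclidean_semiring_class.cong_def chi_class_def)
  moreover have "s \<noteq> 0"
    using rs x by (intro notI) (auto simp: chi_class_def)
  ultimately show "x \<in> resid a ` {1..n}" using s by (intro image_eqI[of _ _ s]) auto
qed

lemma card_chi_class_pairs_parity:
  "(- 1 :: int) ^ card {(u, v). u \<in> chi_class a \<and> v \<in> chi_class a \<and> v < u \<and> chi (u - v) = chi a} =
    (if chi 2 = 1 then (- 1) ^ card {x \<in> chi_class a. x \<le> int n} else 1)"
proof -
  let ?W = "{(u, v). u \<in> chi_class a \<and> v \<in> chi_class a \<and> u + v \<in> chi_class a}"
  \<comment> \<open>Taking the difference as a new variable makes the conditions symmetric, so that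
    swapping becomes available.\<close>
  have "bij_betw (\<lambda>(u, v). (u - v, v))
      {(u, v). u \<in> chi_class a \<and> v \<in> chi_class a \<and> v < u \<and> chi (u - v) = chi a} ?W"
    by (rule bij_betwI[of _ _ _ "\<lambda>(u, v). (u + v, v)"]) (auto simp: chi_class_def)
  then have "card {(u, v). u \<in> chi_class a \<and> v \<in> chi_class a \<and> v < u \<and> chi (u - v) = chi a} = card ?W"
    by (rule bij_betw_same_card)
  moreover have "finite ?W"
    by (rule finite_subset[of _ "chi_class a \<times> chi_class a"]) (auto simp: finite_chi_class)
  then have "(- 1 :: int) ^ card ?W = (- 1) ^ card {x. (x, x) \<in> ?W}"
    by (rule even_card_swap_invariant) (auto simp: add.commute)
  moreover have "{x. (x, x) \<in> ?W} = (if chi 2 = 1 then {x \<in> chi_class a. x \<le> int n} else {})"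
  proof -
    have "2 * x < int p \<longleftrightarrow> x \<le> int n" for x using p_eq by auto
    then show ?thesis using chi_a chi_mult[of 2] by (auto simp: chi_class_def mult_2[symmetric])
  qed
  ultimately show ?thesis by (simp del: mem_Collect_eq)
qed

text \<open>The product of \<open>chi a * chi (a * t^2 - a * s^2)\<close> over all pairs is
  \<open>?N\<close>, one factor -1 per pair. Sorted, it is the inversion sign times
  \<open>?N\<close> times the sign that counts pairs of values whose difference lies in the class of
  \<open>a\<close>. Hence \<open>?N\<close> cancels without being evaluated.\<close>

lemma prod_resid_order:
  "(\<Prod>s=1..n. \<Prod>t=1..<s. if resid a s > resid a t then - 1 else 1 :: int) =
    (if chi 2 = 1 then (- 1) ^ card {x \<in> chi_class a. x \<le> int n} else 1)"
proof -
  let ?R = "{(u, v). u \<in> chi_class a \<and> v \<in> chi_class a \<and> v < u}"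
  let ?g = "\<lambda>x. chi a * chi x"
  let ?N = "\<Prod>s=1..n. \<Prod>t=1..<s. - 1 :: int"
  have finR: "finite ?R"
    by (rule finite_subset[of _ "chi_class a \<times> chi_class a"]) (auto simp: finite_chi_class)
  have inj: "inj_on (resid a) {1..n}" using inj_resid by (rule inj_on_subset) auto
  have R: "{(u, v). u \<in> resid a ` {1..n} \<and> v \<in> resid a ` {1..n} \<and> v < u} = ?R"
    unfolding image_resid ..
  have sgn: "chi a * chi (u - v) = - (if chi (u - v) = chi a then - 1 else 1)" if "(u, v) \<in> ?R" for u v
  proof -
    have "\<not> int p dvd u - v" using that by (intro not_dvd_small) (auto simp: chi_class_def)
    then show ?thesis using chi_cases[of "u - v"] chi_cases[OF a] by auto
  qed
  have "(\<Prod>s=1..n. \<Prod>t=1..<s. ?g (resid a t - resid a s)) =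
    (\<Prod>s=1..n. \<Prod>t=1..<s. - 1 * chi ((int s)\<^sup>2 - (int t)\<^sup>2))"
  proof (intro prod.cong refl)
    fix s t
    have "[resid a t - resid a s = - (a * ((int s)\<^sup>2 - (int t)\<^sup>2))] (mod int p)"
      using cong_diff[OF resid_cong[of a t] resid_cong[of a s]] by (simp add: algebra_simps)
    then have "chi (resid a t - resid a s) = - (chi a * chi ((int s)\<^sup>2 - (int t)\<^sup>2))"
      by (simp only: Legendre_cong chi_minus chi_mult)
    then show "?g (resid a t - resid a s) = - 1 * chi ((int s)\<^sup>2 - (int t)\<^sup>2)"
      using chi_a by (simp add: mult.assoc[symmetric])
  qed
  also have "\<dots> = ?N" by (simp only: prod.distrib prod_chi_square_diff mult_1_right)
  finally have 1: "?N = (\<Prod>s=1..n. \<Prod>t=1..<s. if resid a s > resid a t then - 1 else 1) *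
      (\<Prod>(u, v)\<in>?R. ?g (u - v))"
    using prod_pairs_sort[of ?g "resid a" n] inj unfolding R by (simp add: chi_minus)
  have N: "?N = (\<Prod>(u, v)\<in>?R. - 1)"
    using prod_pairs_abs_diff[OF inj, of "\<lambda>_. - 1"] unfolding R .
  have "(\<Prod>(u, v)\<in>?R. ?g (u - v)) =
      (\<Prod>w\<in>?R. - 1 * (if chi (fst w - snd w) = chi a then - 1 else 1))"
    using sgn by (intro prod.cong refl) (auto simp: case_prod_unfold)
  also have "\<dots> = ?N * (\<Prod>w\<in>?R. if chi (fst w - snd w) = chi a then - 1 else 1)"
    unfolding N by (simp only: prod.distrib case_prod_unfold)
  also have "(\<Prod>w\<in>?R. if chi (fst w - snd w) = chi a then - 1 else 1 :: int) =
      (- 1) ^ card {w \<in> ?R. chi (fst w - snd w) = chi a}"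
    using finR by (rule neg_one_power_card_eq_prod[symmetric])
  also have "{w \<in> ?R. chi (fst w - snd w) = chi a} =
      {(u, v). u \<in> chi_class a \<and> v \<in> chi_class a \<and> v < u \<and> chi (u - v) = chi a}" by auto
  finally have 2: "?N = (\<Prod>s=1..n. \<Prod>t=1..<s. if resid a s > resid a t then - 1 else 1) *
      (?N * (if chi 2 = 1 then (- 1) ^ card {x \<in> chi_class a. x \<le> int n} else 1))"
    using 1 unfolding card_chi_class_pairs_parity by simp
  have NN: "?N * ?N = 1" by (simp add: prod.distrib[symmetric])
  let ?T = "\<Prod>s=1..n. \<Prod>t=1..<s. if resid a s > resid a t then - 1 else 1 :: int"
  let ?E = "if chi 2 = 1 then (- 1) ^ card {x \<in> chi_class a. x \<le> int n} else 1 :: int"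
  have "?E * ?E = 1" by (simp add: power_add[symmetric] mult_2[symmetric])
  with 2 NN show ?thesis by (rule sign_cancel)
qed

text \<open>Subtracting \<open>b\<close> lets exactly the residues below \<open>b\<close> wrap
  around to the top, so the order of two residues is reversed iff exactly one of them is below
  \<open>b\<close>.\<close>

lemma shifted_residue_order:
  fixes x y b q :: int
  assumes u: "u = x mod q" and v: "v = y mod q" and b: "0 < b" "b < q" and ne: "u \<noteq> v"
  shows "(if (x - b) mod q > (y - b) mod q then - 1 else 1 :: int) =
    (if u > v then - 1 else 1) * ((if u < b then - 1 else 1) * (if v < b then - 1 else 1))"
proof -
  have shift: "(x - b) mod q = (if x mod q < b then x mod q - b + q else x mod q - b)" for x :: int
  proof -
    have q: "0 \<le> x mod q" "x mod q < q" using b by auto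
    have "(x - b) mod q = (x mod q - b) mod q" by (simp add: mod_diff_left_eq)
    also have "\<dots> = (if x mod q < b then x mod q - b + q else x mod q - b)"
    proof (cases "x mod q < b")
      case True
      then have "(x mod q - b + q) mod q = x mod q - b + q" using q b by (intro mod_pos_pos_trivial; linarith)
      then show ?thesis using True by simp
    next
      case False
      then have "(x mod q - b) mod q = x mod q - b" using q b by (intro mod_pos_pos_trivial; linarith)
      then show ?thesis using False by simp
    qed
    finally show ?thesis .
  qed
  have bd: "0 \<le> u" "u < q" "0 \<le> v" "v < q" using b unfolding u v by auto
  show ?thesis unfolding shift u[symmetric] v[symmetric] using bd b ne by auto
qed

lemma order_parity_shift:
  assumes b: "0 < b" "b < int p"
  shows "(- 1 :: int) ^ card {(s :: int, t :: int). 0 \<le> t \<and> t < s \<and> s \<le> int n \<and>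
        (a * s\<^sup>2 - b) mod int p > (a * t\<^sup>2 - b) mod int p} *
      (- 1) ^ card {r :: int. 0 < r \<and> r < b \<and> chi r = chi a} =
    (if chi 2 = 1 then (- 1) ^ card {x \<in> chi_class a. x \<le> int n} else 1)"
proof -
  define e :: "nat \<Rightarrow> int" where "e s = (if resid a s < b then - 1 else 1)" for s
  define T :: "nat \<Rightarrow> nat \<Rightarrow> int" where "T s t = (if resid a s > resid a t then - 1 else 1)" for s t
  have "(- 1 :: int) ^ card {(s :: int, t :: int). 0 \<le> t \<and> t < s \<and> s \<le> int n \<and>
        (a * s\<^sup>2 - b) mod int p > (a * t\<^sup>2 - b) mod int p} =
      (\<Prod>s\<le>n. \<Prod>t<s. if (a * (int s)\<^sup>2 - b) mod int p > (a * (int t)\<^sup>2 - b) mod int p then - 1 else 1)"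
    by (rule neg_one_power_card_pairs)
  also have "\<dots> = (\<Prod>s\<le>n. \<Prod>t<s. T s t * (e s * e t))"
    unfolding T_def e_def
  proof (intro prod.cong refl)
    fix s t assume "s \<in> {..n}" "t \<in> {..<s}"
    then have "resid a s \<noteq> resid a t" using inj_resid by (auto dest: inj_onD)
    then show "(if (a * (int s)\<^sup>2 - b) mod int p > (a * (int t)\<^sup>2 - b) mod int p then - 1 else 1 :: int) =
        (if resid a s > resid a t then - 1 else 1) *
        ((if resid a s < b then - 1 else 1) * (if resid a t < b then - 1 else 1))"
      using b shifted_residue_order[OF resid_def resid_def, of b a s a t] by blast
  qed
  also have "\<dots> = (\<Prod>s\<le>n. \<Prod>t<s. T s t) * (\<Prod>s\<le>n. e s) ^ n"
    by (simp only: prod_pairs_mult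
        prod.distrib[where h = "\<lambda>t. e s * e t" for s] prod.distrib[where h = "\<lambda>s. \<Prod>t<s. e s * e t"])
  also have "(\<Prod>s\<le>n. \<Prod>t<s. T s t) = (\<Prod>s=1..n. T s 0 * (\<Prod>t=1..<s. T s t))"
  proof -
    have "(\<Prod>t<s. T s t) = T s 0 * (\<Prod>t=1..<s. T s t)" if "s \<ge> 1" for s
      using that by (simp add: lessThan_atLeast0 prod.atLeast_Suc_lessThan)
    moreover have "{..n} = insert 0 {1..n}" by auto
    ultimately show ?thesis by simp
  qed
  \<comment> \<open>Index 0 has the least residue, 0, so all \<open>n\<close> pairs
    \<open>(s, 0)\<close> are inversions and contribute -1 in total. Since \<open>e 0 = - 1\<close>
    also occurs to the odd power \<open>n\<close>, the two signs cancel in the end.\<close>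
  also have "\<dots> = (\<Prod>s=1..n. - 1 * (\<Prod>t=1..<s. T s t))"
    by (intro prod.cong refl arg_cong2[where f = "(*)"]) (auto simp: T_def intro: resid_pos)
  also have "\<dots> = - 1 * (\<Prod>s=1..n. \<Prod>t=1..<s. T s t)"
    unfolding prod.distrib using odd_n by simp
  also have "(\<Prod>s=1..n. \<Prod>t=1..<s. T s t) = (if chi 2 = 1 then (- 1) ^ card {x \<in> chi_class a. x \<le> int n} else 1)"
    unfolding T_def by (rule prod_resid_order)
  also have "(\<Prod>s\<le>n. e s) = - 1 * (\<Prod>s=1..n. e s)"
  proof -
    have "{..n} = insert 0 {1..n}" by auto
    then show ?thesis using b by (simp add: e_def)
  qed
  also have "(\<Prod>s=1..n. e s) = (\<Prod>x\<in>chi_class a. if x < b then - 1 else 1)"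
    unfolding image_resid[symmetric] e_def
    using inj_on_subset[OF inj_resid, of "{1..n}"] by (subst prod.reindex) auto
  also have "\<dots> = (- 1) ^ card {x \<in> chi_class a. x < b}"
    using finite_chi_class by (rule neg_one_power_card_eq_prod[symmetric])
  also have "{x \<in> chi_class a. x < b} = {r :: int. 0 < r \<and> r < b \<and> chi r = chi a}"
    using b by (auto simp: chi_class_def)
  finally show ?thesis
    using odd_n by (simp add: power_mult_distrib power_mult[symmetric] power_add[symmetric] mult.assoc[symmetric])
qed

end

lemma sum_chi_half:
  assumes "\<not> int p dvd a" 
  shows "(\<Sum>r=1..int n. chi r) = chi a * (2 * int (card {x \<in> chi_class a. x \<le> int n}) - int n)"
proof -
  have "(\<Sum>r=1..int n. chi r) = (\<Sum>r=1..int n. chi a * (2 * (if chi r = chi a then 1 else 0) - 1))"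
  proof (intro sum.cong refl)
    fix r assume "r \<in> {1..int n}"
    then have "\<not> int p dvd r" using p_eq by (intro not_dvd_small) auto
    then show "chi r = chi a * (2 * (if chi r = chi a then 1 else 0) - 1)"
      using chi_cases[of r] chi_cases[OF assms] by auto
  qed
  also have "\<dots> = chi a * (2 * (\<Sum>r=1..int n. if chi r = chi a then 1 else 0) - int n)"
    by (simp add: sum_distrib_left[symmetric] sum_subtractf)
  also have "(\<Sum>r=1..int n. if chi r = chi a then 1 else 0 :: int) = int (card {r \<in> {1..int n}. chi r = chi a})"
    by (simp add: sum.If_cases Int_def)
  also have "{r \<in> {1..int n}. chi r = chi a} = {x \<in> chi_class a. x \<le> int n}"
  proof -
    have "x < int p" if "x \<le> int n" for x using that p_eq by simp
    then show ?thesis by (auto simp: chi_class_def)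
  qed
  finally show ?thesis .
qed

text \<open>With \<open>c\<close> the count, the half sum is \<open>chi a * (2 * c - n)\<close>, and
  \<open>n\<close> is 3 modulo 4. If \<open>chi a = 1\<close>, half of the sum minus 1 is
  \<open>c - (n + 1) / 2\<close> with \<open>(n + 1) / 2\<close> even; if
  \<open>chi a = - 1\<close>, it is \<open>(n - 1) / 2 - c\<close> with \<open>(n - 1) / 2\<close>
  odd. The discrepancy is the factor \<open>chi a\<close>.\<close>

lemma neg_one_power_card_chi_half:
  assumes "\<not> int p dvd a" "p mod 8 = 7"
  shows "(- 1 :: int) ^ card {x \<in> chi_class a. x \<le> int n} =
    (- 1) ^ nat \<bar>((\<Sum>r=1..int n. chi r) - 1) div 2\<bar> * chi a"
proof -
  define c where "c = int (card {x \<in> chi_class a. x \<le> int n})"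
  have n: "int n mod 4 = 3" using assms(2) p_eq by presburger
  have ev: "(- 1 :: int) ^ nat \<bar>z\<bar> = (if even z then 1 else - 1)" for z :: int
    by (auto simp: even_nat_iff)
  have "(- 1 :: int) ^ card {x \<in> chi_class a. x \<le> int n} = (if even c then 1 else - 1)"
    by (auto simp: c_def)
  moreover have S: "(\<Sum>r=1..int n. chi r) = chi a * (2 * c - int n)"
    unfolding c_def by (rule sum_chi_half[OF assms(1)])
  ultimately show ?thesis
    using chi_cases[OF assms(1)] unfolding S ev
  proof (elim disjE, goal_cases)
    case 1
    have "even ((2 * c - int n - 1) div 2) \<longleftrightarrow> even c" using n by presburger
    then show ?case using 1 by simp
  next
    case 2
    have "even ((- (2 * c - int n) - 1) div 2) \<longleftrightarrow> odd c" using n by presburger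
    then show ?case using 2 by simp
  qed
qed

lemma chi_2_eq_1_iff: "chi 2 = 1 \<longleftrightarrow> p mod 8 \<noteq> 3"
proof -
  obtain m where m: "n = 2 * m + 1" using odd_n by (rule oddE)
  have "n - n div 2 = m + 1" using m by simp
  moreover have "p = 4 * m + 3" using p_eq m by simp
  then have "odd m \<longleftrightarrow> p mod 8 \<noteq> 3" by presburger
  ultimately have "even (n - n div 2) \<longleftrightarrow> p mod 8 \<noteq> 3" by simp
  moreover have "(- 1 :: int) ^ k = 1 \<longleftrightarrow> even k" for k :: nat by (cases "even k") auto
  ultimately show ?thesis unfolding Legendre_two[OF prime_p p_eq] by blast
qed

end

section \<open>Theta series of binary quadratic forms\<close>

text \<open>The mean value theorem is applied to the second difference of \<open>g\<close>, then to
  the first difference of \<open>g'\<close>, then to \<open>g''\<close>. Each application moves the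
  point by less than 1, whence the window of length 3.\<close>

lemma third_difference_eq_derivative:
  fixes g g' g'' g''' :: "real \<Rightarrow> real"
  assumes "\<And>x. (g has_real_derivative g' x) (at x)" "\<And>x. (g' has_real_derivative g'' x) (at x)"
    "\<And>x. (g'' has_real_derivative g''' x) (at x)"
  shows "\<exists>\<xi>>x. \<xi> < x + 3 \<and> g (x + 3) - 3 * g (x + 2) + 3 * g (x + 1) - g x = g''' \<xi>"
proof -
  have shift: "((\<lambda>x. f (x + c)) has_real_derivative f' (x + c)) (at x)"
    if "\<And>x. (f has_real_derivative f' x) (at x)" for f f' :: "real \<Rightarrow> real" and c x
    using DERIV_shift[of f "f' (x + c)" x c] that by blast
  have step: "\<exists>\<xi>>x. \<xi> < x + 1 \<and> f (x + 1) - f x = f' \<xi>"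
    if "\<And>x. (f has_real_derivative f' x) (at x)" for f f' :: "real \<Rightarrow> real" and x
    using MVT2[of x "x + 1" f f'] that by force
  have d2: "((\<lambda>x. g (x + 2) - 2 * g (x + 1) + g x) has_real_derivative
      g' (x + 2) - 2 * g' (x + 1) + g' x) (at x)" for x
    by (auto intro!: derivative_eq_intros shift assms)
  have d1: "((\<lambda>x. g' (x + 1) - g' x) has_real_derivative g'' (x + 1) - g'' x) (at x)" for x
    by (auto intro!: derivative_eq_intros shift assms)
  obtain y where y: "x < y" "y < x + 1"
    "(g (x + 1 + 2) - 2 * g (x + 1 + 1) + g (x + 1)) - (g (x + 2) - 2 * g (x + 1) + g x) =
      g' (y + 2) - 2 * g' (y + 1) + g' y"
    using step[OF d2, of x] by blast
  obtain z where z: "y < z" "z < y + 1"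
    "(g' (y + 1 + 1) - g' (y + 1)) - (g' (y + 1) - g' y) = g'' (z + 1) - g'' z"
    using step[OF d1, of y] by blast
  obtain w where w: "z < w" "w < z + 1" "g'' (z + 1) - g'' z = g''' w"
    using step[OF assms(3), of z] by blast
  have "g (x + 3) - 3 * g (x + 2) + 3 * g (x + 1) - g x = g''' w"
    using y(3) z(3) w(3) by (simp add: algebra_simps)
  then show ?thesis using y z w by (intro exI[of _ w]) auto
qed

text \<open>A majorant for lattice sums: the geometric series over the nonnegative integers plus the
  one over the negative integers.\<close>

lemma has_sum_power_abs:
  fixes r :: real
  assumes "0 \<le> r" "r < 1"
  shows "((\<lambda>x :: int. r ^ nat \<bar>x\<bar>) has_sum ((1 + r) / (1 - r))) UNIV"
proof -
  have "((\<lambda>n. r ^ n) has_sum (1 / (1 - r))) UNIV"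
    using geometric_sums[of r] assms by (intro sums_nonneg_imp_has_sum) auto
  then have "((\<lambda>x. r ^ nat \<bar>x\<bar>) has_sum (1 / (1 - r))) (range int)"
    by (subst has_sum_reindex) (auto simp: o_def)
  moreover have "((\<lambda>n. r ^ n) has_sum (r / (1 - r))) {1..}"
    using has_sum_geometric_from_1[of r] assms by simp
  then have "((\<lambda>x. r ^ nat \<bar>x\<bar>) has_sum (r / (1 - r))) ((\<lambda>n. - int n) ` {1..})"
    by (subst has_sum_reindex) (auto simp: o_def inj_on_def)
  moreover have "range int \<inter> (\<lambda>n. - int n) ` {1..} = {}" by auto
  ultimately have "((\<lambda>x. r ^ nat \<bar>x\<bar>) has_sum (1 / (1 - r) + r / (1 - r))) (range int \<union> (\<lambda>n. - int n) ` {1..})"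
    by (rule has_sum_Un_disjoint)
  moreover have "range int \<union> (\<lambda>n. - int n) ` {1..} = UNIV"
  proof -
    have "x \<in> range int \<union> (\<lambda>n. - int n) ` {1..}" for x :: int
      by (cases x rule: int_cases2) force+
    then show ?thesis by auto
  qed
  ultimately show ?thesis by (simp add: add_divide_distrib)
qed

lemma has_sum_power_abs2:
  fixes r :: real
  assumes "0 \<le> r" "r < 1"
  shows "((\<lambda>(x :: int, y :: int). r ^ nat \<bar>x\<bar> * r ^ nat \<bar>y\<bar>) has_sum ((1 + r) / (1 - r))\<^sup>2) UNIV"
proof -
  note h = has_sum_power_abs[OF assms]
  have 1: "((\<lambda>y. case (x, y) of (x, y) \<Rightarrow> r ^ nat \<bar>x\<bar> * r ^ nat \<bar>y\<bar>) has_sum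
      r ^ nat \<bar>x\<bar> * ((1 + r) / (1 - r))) UNIV" for x :: int
    using has_sum_cmult_right[OF h] by simp
  have 2: "((\<lambda>x :: int. r ^ nat \<bar>x\<bar> * ((1 + r) / (1 - r))) has_sum ((1 + r) / (1 - r))\<^sup>2) UNIV"
    unfolding power2_eq_square by (rule has_sum_cmult_left[OF h])
  have "(\<lambda>(x :: int, y :: int). r ^ nat \<bar>x\<bar> * r ^ nat \<bar>y\<bar>) summable_on UNIV \<times> UNIV"
    by (rule summable_on_SigmaI[OF 1 has_sum_imp_summable[OF 2]]) (use assms in auto)
  from has_sum_SigmaI[OF 1 2 this] show ?thesis by simp
qed

text \<open>Expanding \<open>(s * \<bar>x\<bar> - 1)^2 \<ge> 0\<close> trades the Gaussian for a
  geometric term, whose lattice sum has a closed form.\<close>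

lemma exp_neg_square_le:
  fixes s x :: real
  shows "exp (- (s * x)\<^sup>2) \<le> exp 1 * exp (- 2 * s * \<bar>x\<bar>)"
proof -
  have "(s * x)\<^sup>2 = (s * \<bar>x\<bar>)\<^sup>2" by (simp add: power_mult_distrib)
  moreover have "0 \<le> (s * \<bar>x\<bar> - 1)\<^sup>2" by simp
  ultimately have "- (s * x)\<^sup>2 \<le> 1 + - 2 * s * \<bar>x\<bar>" by (simp add: power2_eq_square algebra_simps)
  then have "exp (- (s * x)\<^sup>2) \<le> exp (1 + - 2 * s * \<bar>x\<bar>)" by simp
  then show ?thesis unfolding exp_add .
qed

text \<open>Uses \<open>1 + 2 * s \<le> exp (2 * s)\<close>. For \<open>s\<close> proportional to
  \<open>sqrt t\<close>, the square of this bound is of order \<open>1 / t\<close>, the effective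
  number of lattice points.\<close>

lemma one_plus_exp_over_one_minus_exp_le:
  fixes s S :: real
  assumes "0 < s" "s \<le> S"
  shows "(1 + exp (- 2 * s)) / (1 - exp (- 2 * s)) \<le> (1 + 2 * S) / s"
proof -
  have "1 + 2 * s \<le> exp (2 * s)" by (rule exp_ge_add_one_self)
  then have "inverse (exp (2 * s)) \<le> inverse (1 + 2 * s)" using assms by (intro le_imp_inverse_le) auto
  then have "exp (- 2 * s) \<le> 1 / (1 + 2 * s)" by (simp add: exp_minus inverse_eq_divide)
  then have "1 - exp (- 2 * s) \<ge> 1 - 1 / (1 + 2 * s)" by simp
  also have "1 - 1 / (1 + 2 * s) = 2 * s / (1 + 2 * s)" using assms by (simp add: field_simps)
  finally have 1: "2 * s / (1 + 2 * s) \<le> 1 - exp (- 2 * s)" .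
  have "(1 + exp (- 2 * s)) / (1 - exp (- 2 * s)) \<le> 2 / (2 * s / (1 + 2 * s))"
    using assms by (intro frac_le 1) auto
  also have "\<dots> = (1 + 2 * s) / s" using assms by (simp add: field_simps)
  also have "\<dots> \<le> (1 + 2 * S) / s" using assms by (intro divide_right_mono) auto
  finally show ?thesis .
qed

definition qform :: "real \<Rightarrow> real \<Rightarrow> real \<Rightarrow> real \<Rightarrow> real \<Rightarrow> real" where
  "qform a b c x y = a * x\<^sup>2 + b * x * y + c * y\<^sup>2"

definition int_sign :: "int \<Rightarrow> real" where "int_sign x = (if even x then 1 else - 1)"

section \<open>Decay of the exponential of a positive definite form\<close>

locale posdef_form =
  fixes a b c :: real
  assumes a_pos: "a > 0" and disc: "4 * a * c - b\<^sup>2 > 0"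
begin

lemma c_pos: "c > 0"
proof -
  have "0 < 4 * a * c" using disc by (smt (verit) zero_le_power2)
  then show ?thesis using a_pos by (simp add: zero_less_mult_iff)
qed

text \<open>Determinant over trace of the Gram matrix with diagonal \<open>a\<close>,
  \<open>c\<close> and off-diagonal \<open>b / 2\<close>, a lower bound for its least
  eigenvalue.\<close>

definition coercivity :: real where "coercivity = (4 * a * c - b\<^sup>2) / (4 * (a + c))"

lemma coercivity_pos: "coercivity > 0"
  using disc a_pos c_pos by (simp add: coercivity_def)

lemma qform_ge: "coercivity * (x\<^sup>2 + y\<^sup>2) \<le> qform a b c x y"
proof -
  have d: "4 * coercivity * (a + c) = 4 * a * c - b\<^sup>2"
    using a_pos c_pos nonzero_eq_divide_eq[of "4 * (a + c)" coercivity "4 * a * c - b\<^sup>2"]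
    by (simp add: coercivity_def algebra_simps)
  have "a * (a + c) - coercivity * (a + c) = a\<^sup>2 + (b / 2)\<^sup>2"
    using d by (simp add: algebra_simps power2_eq_square)
  then have "(a - coercivity) * (a + c) > 0" using a_pos by (simp add: algebra_simps add_pos_nonneg)
  then have ad: "a - coercivity > 0" using a_pos c_pos by (simp add: zero_less_mult_iff)
  have "4 * (a - coercivity) * (qform a b c x y - coercivity * (x\<^sup>2 + y\<^sup>2)) =
      (2 * (a - coercivity) * x + b * y)\<^sup>2 + (4 * (a - coercivity) * (c - coercivity) - b\<^sup>2) * y\<^sup>2"
    by (simp add: qform_def power2_eq_square algebra_simps)
  \<comment> \<open>For determinant over trace the terms of degree 0 and 1 in
    \<open>coercivity\<close> cancel, leaving a square.\<close>
  also have "4 * (a - coercivity) * (c - coercivity) - b\<^sup>2 = 4 * coercivity\<^sup>2"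
    using d by (simp add: power2_eq_square algebra_simps)
  also have "(2 * (a - coercivity) * x + b * y)\<^sup>2 + 4 * coercivity\<^sup>2 * y\<^sup>2 \<ge> 0" by simp
  finally show ?thesis using ad by (simp add: zero_le_mult_iff)
qed

text \<open>\<open>2 * a * x + b * y\<close> is the derivative of the form in \<open>x\<close>. Its
  control by the form lets the exponential absorb the polynomial factors that differentiation
  creates.\<close>

lemma linear_square_le: "(2 * a * x + b * y)\<^sup>2 \<le> 4 * a * qform a b c x y"
proof -
  have "4 * a * qform a b c x y = (2 * a * x + b * y)\<^sup>2 + (4 * a * c - b\<^sup>2) * y\<^sup>2"
    by (simp add: qform_def power2_eq_square algebra_simps)
  moreover have "(4 * a * c - b\<^sup>2) * y\<^sup>2 \<ge> 0" using disc by simp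
  ultimately show ?thesis by simp
qed

lemma exp_qform_le:
  assumes "s > 0" "s\<^sup>2 = t * coercivity"
  shows "exp (- t * qform a b c x y) \<le> exp 2 * (exp (- 2 * s * \<bar>x\<bar>) * exp (- 2 * s * \<bar>y\<bar>))"
proof -
  have "t > 0" using assms coercivity_pos by (metis zero_less_mult_pos2 zero_less_power)
  then have "t * (coercivity * (x\<^sup>2 + y\<^sup>2)) \<le> t * qform a b c x y" using qform_ge by simp
  moreover have "t * (coercivity * (x\<^sup>2 + y\<^sup>2)) = (s * x)\<^sup>2 + (s * y)\<^sup>2"
    using assms(2) by (simp add: power_mult_distrib algebra_simps)
  ultimately have "exp (- t * qform a b c x y) \<le> exp (- (s * x)\<^sup>2 + - (s * y)\<^sup>2)" by simp
  also have "\<dots> = exp (- (s * x)\<^sup>2) * exp (- (s * y)\<^sup>2)" by (rule exp_add)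
  also have "\<dots> \<le> (exp 1 * exp (- 2 * s * \<bar>x\<bar>)) * (exp 1 * exp (- 2 * s * \<bar>y\<bar>))"
    by (intro mult_mono exp_neg_square_le) auto
  also have "\<dots> = exp (1 + 1) * (exp (- 2 * s * \<bar>x\<bar>) * exp (- 2 * s * \<bar>y\<bar>))"
    unfolding exp_add by (simp add: ac_simps)
  finally show ?thesis by simp
qed

lemma exp_abs_int: "exp (- 2 * s * \<bar>real_of_int x\<bar>) = exp (- 2 * s) ^ nat \<bar>x\<bar>"
  by (simp add: exp_of_nat_mult[symmetric] mult.commute)

lemma exp_qform_int_le:
  assumes "s > 0" "s\<^sup>2 = t * coercivity"
  shows "exp (- t * qform a b c (real_of_int x) (real_of_int y)) \<le>
    exp 2 * (exp (- 2 * s) ^ nat \<bar>x\<bar> * exp (- 2 * s) ^ nat \<bar>y\<bar>)"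
  using exp_qform_le[OF assms, of "real_of_int x" "real_of_int y"] unfolding exp_abs_int .

lemma summable_exp_qform:
  assumes "t > 0"
  shows "(\<lambda>(x :: int, y :: int). exp (- t * qform a b c x y)) summable_on UNIV"
proof -
  define s where "s = sqrt (t * coercivity)"
  have s: "s > 0" "s\<^sup>2 = t * coercivity" using assms coercivity_pos by (auto simp: s_def)
  have "(\<lambda>(x :: int, y :: int). exp (- 2 * s) ^ nat \<bar>x\<bar> * exp (- 2 * s) ^ nat \<bar>y\<bar>) summable_on UNIV"
    by (rule has_sum_imp_summable[OF has_sum_power_abs2]) (use s in auto)
  then have "(\<lambda>w. exp 2 * (case w of (x :: int, y :: int) \<Rightarrow> exp (- 2 * s) ^ nat \<bar>x\<bar> * exp (- 2 * s) ^ nat \<bar>y\<bar>)) summable_on UNIV"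
    by (rule summable_on_cmult_right)
  then show ?thesis
    by (rule summable_on_comparison_test)
      (use exp_qform_int_le[OF s] in auto)
qed

text \<open>The third derivative in \<open>x\<close> of
  \<open>exp (- t * qform a b c x y)\<close>.\<close>

definition third_deriv :: "real \<Rightarrow> real \<Rightarrow> real \<Rightarrow> real" where
  "third_deriv t y x = (- (t ^ 3) * (2 * a * x + b * y) ^ 3 + 6 * a * t\<^sup>2 * (2 * a * x + b * y)) *
    exp (- t * qform a b c x y)"

lemma third_difference_exp_qform:
  "\<exists>\<xi>>x. \<xi> < x + 3 \<and>
    exp (- t * qform a b c (x + 3) y) - 3 * exp (- t * qform a b c (x + 2) y)
      + 3 * exp (- t * qform a b c (x + 1) y) - exp (- t * qform a b c x y) = third_deriv t y \<xi>"
proof (rule third_difference_eq_derivative)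
  let ?L = "\<lambda>x. 2 * a * x + b * y" and ?g = "\<lambda>x. exp (- t * qform a b c x y)"
  have q: "((\<lambda>x. qform a b c x y) has_real_derivative ?L x) (at x)" for x
    unfolding qform_def by (auto intro!: derivative_eq_intros)
  show g: "(?g has_real_derivative - t * ?L x * ?g x) (at x)" for x
    by (auto intro!: derivative_eq_intros q)
  show g': "((\<lambda>x. - t * ?L x * ?g x) has_real_derivative (t\<^sup>2 * (?L x)\<^sup>2 - 2 * a * t) * ?g x) (at x)" for x
    by (auto intro!: derivative_eq_intros q simp: algebra_simps power2_eq_square)
  show "((\<lambda>x. (t\<^sup>2 * (?L x)\<^sup>2 - 2 * a * t) * ?g x) has_real_derivative third_deriv t y x) (at x)" for x
    unfolding third_deriv_def
    by (auto intro!: derivative_eq_intros q simp: algebra_simps power2_eq_square power3_eq_cube)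
qed

text \<open>Collected for \<open>u = w^2 / (8 * a)\<close>: the bounds
  \<open>w^3 \<le> 1 + w^4 = 1 + 64 * a^2 * u^2\<close> and \<open>u^2 \<le> 4 * exp u\<close> give
  \<open>1 + 256 * a^2\<close>, and \<open>w \<le> 1 + w^2 = 1 + 8 * a * u\<close> gives the
  rest.\<close>

definition deriv_const :: real where "deriv_const = 1 + 256 * a\<^sup>2 + 6 * a * (1 + 8 * a)"

lemma deriv_const_pos: "deriv_const > 0"
  using a_pos by (simp add: deriv_const_def add_pos_pos)

lemma cubic_exp_bound:
  assumes "w \<ge> 0"
  shows "(w ^ 3 + 6 * a * w) * exp (- (w\<^sup>2 / (8 * a))) \<le> deriv_const"
proof -
  define u where "u = w\<^sup>2 / (8 * a)"
  have u: "u \<ge> 0" "w\<^sup>2 = 8 * a * u" using a_pos by (auto simp: u_def)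
  have e1: "1 + u \<le> exp u" by (rule exp_ge_add_one_self)
  have e0: "u \<le> exp u" using e1 by linarith
  \<comment> \<open>The factor 4 in \<open>u^2 \<le> 4 * exp u\<close> comes from squaring this
    inequality.\<close>
  have "1 + u / 2 \<le> exp (u / 2)" by (rule exp_ge_add_one_self)
  then have "(1 + u / 2)\<^sup>2 \<le> (exp (u / 2))\<^sup>2" using u by (intro power_mono) auto
  also have "(exp (u / 2))\<^sup>2 = exp u" by (simp add: power2_eq_square exp_add[symmetric])
  finally have e2: "u\<^sup>2 \<le> 4 * exp u" using u by (simp add: power2_eq_square algebra_simps)
  have "w ^ 3 \<le> 1 + w ^ 4"
  proof (cases "w \<le> 1")
    case True
    then have "w ^ 3 \<le> 1" using assms by (simp add: power_le_one)
    then show ?thesis by (smt (verit) zero_le_even_power even_numeral)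
  next
    case False
    then have "w ^ 3 \<le> w ^ 4" by (intro power_increasing) auto
    then show ?thesis by simp
  qed
  also have "w ^ 4 = (w\<^sup>2)\<^sup>2" by (simp add: power_mult[symmetric])
  also have "\<dots> = 64 * a\<^sup>2 * u\<^sup>2" unfolding u(2) by (simp add: power_mult_distrib)
  also have "\<dots> \<le> 64 * a\<^sup>2 * (4 * exp u)" using e2 by (intro mult_left_mono) auto
  finally have w3: "w ^ 3 \<le> (1 + 256 * a\<^sup>2) * exp u" using u by (simp add: algebra_simps)
      (smt (verit) one_le_exp_iff)
  have "w \<le> 1 + w\<^sup>2"
    using zero_le_power2[of "w - 1"] assms by (simp add: power2_eq_square algebra_simps)
  also have "\<dots> = 1 + 8 * a * u" by (simp add: u)
  also have "\<dots> \<le> exp u + 8 * a * exp u"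
    using e1 e0 u a_pos by (intro add_mono mult_left_mono) auto
  finally have "6 * a * w \<le> 6 * a * ((1 + 8 * a) * exp u)"
    using a_pos by (intro mult_left_mono) (auto simp: algebra_simps)
  with w3 have "w ^ 3 + 6 * a * w \<le> deriv_const * exp u"
    by (simp add: deriv_const_def algebra_simps)
  then have "(w ^ 3 + 6 * a * w) * exp (- u) \<le> deriv_const * exp u * exp (- u)"
    by (intro mult_right_mono) auto
  also have "\<dots> = deriv_const" by (simp add: mult.assoc exp_add[symmetric])
  finally show ?thesis by (simp add: u_def)
qed

text \<open>In terms of \<open>w = sqrt t * \<bar>L\<bar>\<close> both summands of the derivative
  carry \<open>sqrt t ^ 3\<close>. Half of the exponent absorbs the cubic in \<open>w\<close>,
  because \<open>w^2 / (8 * a)\<close> is at most \<open>t / 2\<close> times the form; the other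
  half is kept for summation over the lattice.\<close>

lemma third_deriv_bound:
  assumes "t > 0"
  shows "\<bar>third_deriv t y x\<bar> \<le> deriv_const * sqrt t ^ 3 * exp (- (t / 2) * qform a b c x y)"
proof -
  define L where "L = 2 * a * x + b * y"
  define w where "w = sqrt t * \<bar>L\<bar>"
  have w2: "w\<^sup>2 = t * L\<^sup>2" using assms by (simp add: w_def power_mult_distrib)
  have w: "w \<ge> 0" using assms by (simp add: w_def)
  have tt: "t = sqrt t * sqrt t" using assms by simp
  have "\<bar>- (t ^ 3) * L ^ 3 + 6 * a * t\<^sup>2 * L\<bar> \<le> \<bar>- (t ^ 3) * L ^ 3\<bar> + \<bar>6 * a * t\<^sup>2 * L\<bar>"
    by (rule abs_triangle_ineq)
  also have "\<dots> = t ^ 3 * \<bar>L\<bar> ^ 3 + 6 * a * t\<^sup>2 * \<bar>L\<bar>"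
    using assms a_pos by (simp add: abs_mult power_abs)
  also have "\<dots> = sqrt t ^ 3 * (w ^ 3 + 6 * a * w)"
  proof -
    have "t ^ 3 = sqrt t ^ 3 * sqrt t ^ 3" using assms by (simp add: power_mult_distrib[symmetric])
    moreover have "t\<^sup>2 = sqrt t ^ 3 * sqrt t"
      using assms by (simp add: power2_eq_square power3_eq_cube)
    ultimately show ?thesis by (simp add: w_def power_mult_distrib algebra_simps)
  qed
  finally have 1: "\<bar>- (t ^ 3) * L ^ 3 + 6 * a * t\<^sup>2 * L\<bar> \<le> sqrt t ^ 3 * (w ^ 3 + 6 * a * w)" .
  have "t * L\<^sup>2 \<le> t * (4 * a * qform a b c x y)"
    using linear_square_le[of x y] assms unfolding L_def by (intro mult_left_mono) auto
  then have "w\<^sup>2 / (8 * a) \<le> t / 2 * qform a b c x y"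
    using a_pos by (simp add: w2 divide_le_eq algebra_simps)
  then have 2: "exp (- t * qform a b c x y) \<le> exp (- (w\<^sup>2 / (8 * a))) * exp (- (t / 2) * qform a b c x y)"
    unfolding exp_add[symmetric] by simp
  have "\<bar>third_deriv t y x\<bar> = \<bar>- (t ^ 3) * L ^ 3 + 6 * a * t\<^sup>2 * L\<bar> * exp (- t * qform a b c x y)"
    by (simp add: third_deriv_def L_def abs_mult)
  also have "\<dots> \<le> sqrt t ^ 3 * (w ^ 3 + 6 * a * w) *
      (exp (- (w\<^sup>2 / (8 * a))) * exp (- (t / 2) * qform a b c x y))"
    using 1 2 w assms a_pos by (intro mult_mono) auto
  also have "\<dots> = ((w ^ 3 + 6 * a * w) * exp (- (w\<^sup>2 / (8 * a)))) *
      (sqrt t ^ 3 * exp (- (t / 2) * qform a b c x y))" by simp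
  also have "\<dots> \<le> deriv_const * (sqrt t ^ 3 * exp (- (t / 2) * qform a b c x y))"
    using assms by (intro mult_right_mono cubic_exp_bound w) auto
  finally show ?thesis by simp
qed

lemma third_difference_bound:
  assumes t: "0 < t" "t \<le> 1" and s: "s > 0" "s\<^sup>2 = t / 2 * coercivity"
  shows "\<bar>exp (- t * qform a b c (real_of_int x + 3) y) - 3 * exp (- t * qform a b c (real_of_int x + 2) y)
      + 3 * exp (- t * qform a b c (real_of_int x + 1) y) - exp (- t * qform a b c (real_of_int x) y)\<bar>
    \<le> deriv_const * sqrt t ^ 3 * (exp (2 + 6 * s) * (exp (- 2 * s * \<bar>real_of_int x\<bar>) * exp (- 2 * s * \<bar>y\<bar>)))"
proof -
  obtain \<xi> where \<xi>: "real_of_int x < \<xi>" "\<xi> < real_of_int x + 3" and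
    eq: "exp (- t * qform a b c (real_of_int x + 3) y) - 3 * exp (- t * qform a b c (real_of_int x + 2) y)
      + 3 * exp (- t * qform a b c (real_of_int x + 1) y) - exp (- t * qform a b c (real_of_int x) y)
      = third_deriv t y \<xi>"
    using third_difference_exp_qform by blast
  have "\<bar>third_deriv t y \<xi>\<bar> \<le> deriv_const * sqrt t ^ 3 * exp (- (t / 2) * qform a b c \<xi> y)"
    by (rule third_deriv_bound[OF t(1)])
  also have "\<dots> \<le> deriv_const * sqrt t ^ 3 * (exp 2 * (exp (- 2 * s * \<bar>\<xi>\<bar>) * exp (- 2 * s * \<bar>y\<bar>)))"
    using deriv_const_pos t exp_qform_le[OF s, of \<xi> y] by (intro mult_left_mono) auto
  \<comment> \<open>The intermediate point lies within 3 of \<open>x\<close>, which costs the factor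
    \<open>exp (6 * s)\<close>.\<close>
  also have "exp (- 2 * s * \<bar>\<xi>\<bar>) \<le> exp (6 * s) * exp (- 2 * s * \<bar>real_of_int x\<bar>)"
  proof -
    have "\<bar>real_of_int x\<bar> - 3 \<le> \<bar>\<xi>\<bar>" using \<xi> by auto
    then have "s * (\<bar>real_of_int x\<bar> - 3) \<le> s * \<bar>\<xi>\<bar>" using s by (intro mult_left_mono) auto
    then show ?thesis unfolding exp_add[symmetric] by (simp add: algebra_simps)
  qed
  finally show ?thesis using deriv_const_pos t unfolding eq
    by (simp add: exp_add mult.assoc mult_left_mono mult_right_mono)
qed

text \<open>
  Three summations by parts replace the exponential by its third difference, which is small enough
  (\<open>t\<^bsup>3/2\<^esup>\<close> on about \<open>1/t\<close> lattice points) for the alternating sum to vanish in the limit.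
\<close>

definition alt_theta :: "real \<Rightarrow> real" where
  "alt_theta t = (\<Sum>\<^sub>\<infinity>(x, y)\<in>UNIV. int_sign x * exp (- t * qform a b c (real_of_int x) (real_of_int y)))"

lemma has_sum_alt_theta:
  assumes "t > 0"
  shows "((\<lambda>(x, y). int_sign x * exp (- t * qform a b c (real_of_int x) (real_of_int y)))
    has_sum alt_theta t) UNIV"
proof -
  have "(\<lambda>w. norm (case w of (x, y) \<Rightarrow> int_sign x * exp (- t * qform a b c (real_of_int x) (real_of_int y)))) summable_on UNIV"
    by (rule summable_on_comparison_test[OF summable_exp_qform[OF assms]])
      (auto simp: int_sign_def)
  then show ?thesis unfolding alt_theta_def
    by (intro has_sum_infsum) (rule abs_summable_summable)
qed

text \<open>Translating the lattice by \<open>j\<close> multiplies the alternating sign by that of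
  \<open>j\<close>.\<close>

lemma has_sum_alt_theta_shift:
  assumes "t > 0"
  shows "((\<lambda>(x, y). int_sign x * exp (- t * qform a b c (real_of_int (x + j)) (real_of_int y)))
    has_sum (int_sign j * alt_theta t)) UNIV"
proof -
  have "((\<lambda>(x, y). int_sign x * exp (- t * qform a b c (real_of_int (x + j)) (real_of_int y)))
      has_sum (int_sign j * alt_theta t)) UNIV \<longleftrightarrow>
    ((\<lambda>w. int_sign j * (case w of (x, y) \<Rightarrow>
        int_sign x * exp (- t * qform a b c (real_of_int x) (real_of_int y))))
      has_sum (int_sign j * alt_theta t)) UNIV"
    by (rule has_sum_reindex_bij_witness[of _ "\<lambda>(x, y). (x - j, y)" "\<lambda>(x, y). (x + j, y)"])
      (auto simp: int_sign_def)
  then show ?thesis using has_sum_cmult_right[OF has_sum_alt_theta[OF assms]] by blast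
qed

text \<open>The shifts by 3, 2, 1, 0 bring the signs -1, 1, -1, 1. Against the coefficients 1, -3,
  3, -1 everything adds up, to -(1 + 3 + 3 + 1) = -8.\<close>

lemma has_sum_alt_theta_third_difference:
  assumes "t > 0"
  shows "((\<lambda>(x, y). int_sign x * (exp (- t * qform a b c (real_of_int x + 3) (real_of_int y))
      - 3 * exp (- t * qform a b c (real_of_int x + 2) (real_of_int y))
      + 3 * exp (- t * qform a b c (real_of_int x + 1) (real_of_int y))
      - exp (- t * qform a b c (real_of_int x) (real_of_int y)))) has_sum (- 8 * alt_theta t)) UNIV"
proof -
  note h = has_sum_alt_theta_shift[OF assms]
  have "((\<lambda>w. (case w of (x, y) \<Rightarrow> int_sign x * exp (- t * qform a b c (real_of_int (x + 3)) (real_of_int y)))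
      + (- 3) * (case w of (x, y) \<Rightarrow> int_sign x * exp (- t * qform a b c (real_of_int (x + 2)) (real_of_int y)))
      + 3 * (case w of (x, y) \<Rightarrow> int_sign x * exp (- t * qform a b c (real_of_int (x + 1)) (real_of_int y)))
      + (- 1) * (case w of (x, y) \<Rightarrow> int_sign x * exp (- t * qform a b c (real_of_int (x + 0)) (real_of_int y))))
    has_sum (int_sign 3 * alt_theta t + (- 3) * (int_sign 2 * alt_theta t)
      + 3 * (int_sign 1 * alt_theta t) + (- 1) * (int_sign 0 * alt_theta t))) UNIV"
    by (intro has_sum_add has_sum_cmult_right h)
  then show ?thesis
    by (rule has_sum_cong[THEN iffD1, rotated, THEN back_subst[of "\<lambda>v. (_ has_sum v) _"]])
      (auto simp: int_sign_def algebra_simps)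
qed

lemma alt_theta_bound:
  assumes t: "0 < t" "t \<le> 1"
  shows "\<bar>alt_theta t\<bar> \<le>
    deriv_const * exp (2 + 6 * sqrt (coercivity / 2)) * (1 + 2 * sqrt (coercivity / 2))\<^sup>2 * 2 / coercivity * sqrt t"
proof -
  \<comment> \<open>\<open>S\<close> bounds the width \<open>s\<close> for all
    \<open>t \<le> 1\<close>, which makes the constant uniform in \<open>t\<close>; the 2 under the
    root comes from the halved exponent.\<close>
  define S where "S = sqrt (coercivity / 2)"
  define s where "s = sqrt t * S"
  have S: "S > 0" using coercivity_pos by (simp add: S_def)
  have s: "s > 0" "s\<^sup>2 = t / 2 * coercivity" "s \<le> S"
    using t coercivity_pos S by (auto simp: s_def S_def power_mult_distrib mult_left_le_one_le)
  define r where "r = exp (- 2 * s)"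
  have r: "0 \<le> r" "r < 1" using s by (auto simp: r_def)
  define B where "B = deriv_const * sqrt t ^ 3 * exp (2 + 6 * S)"
  have B: "B \<ge> 0" using deriv_const_pos t by (simp add: B_def)
  have bnd: "((\<lambda>w. B * (case w of (x :: int, y :: int) \<Rightarrow> r ^ nat \<bar>x\<bar> * r ^ nat \<bar>y\<bar>)) has_sum
      B * ((1 + r) / (1 - r))\<^sup>2) UNIV"
    by (intro has_sum_cmult_right has_sum_power_abs2 r)
  have "norm (- 8 * alt_theta t) \<le> B * ((1 + r) / (1 - r))\<^sup>2"
  proof (rule norm_infsum_le[OF has_sum_alt_theta_third_difference[OF t(1)] bnd], clarify)
    fix x y :: int
    let ?d = "exp (- t * qform a b c (real_of_int x + 3) (real_of_int y))
      - 3 * exp (- t * qform a b c (real_of_int x + 2) (real_of_int y))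
      + 3 * exp (- t * qform a b c (real_of_int x + 1) (real_of_int y))
      - exp (- t * qform a b c (real_of_int x) (real_of_int y))"
    have "norm (int_sign x * ?d) = \<bar>?d\<bar>" by (simp add: int_sign_def abs_mult del: abs_minus_commute)
    also have "\<dots> \<le> deriv_const * sqrt t ^ 3 * (exp (2 + 6 * s) *
        (exp (- 2 * s * \<bar>real_of_int x\<bar>) * exp (- 2 * s * \<bar>real_of_int y\<bar>)))"
      by (rule third_difference_bound[OF t s(1,2)])
    also have "\<dots> \<le> deriv_const * sqrt t ^ 3 * (exp (2 + 6 * S) *
        (exp (- 2 * s * \<bar>real_of_int x\<bar>) * exp (- 2 * s * \<bar>real_of_int y\<bar>)))"
      using deriv_const_pos t s by (intro mult_left_mono mult_right_mono) auto
    also have "\<dots> = B * (r ^ nat \<bar>x\<bar> * r ^ nat \<bar>y\<bar>)"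
      unfolding exp_abs_int r_def B_def by (simp only: mult.assoc)
    finally show "norm (int_sign x * ?d) \<le> B * (r ^ nat \<bar>x\<bar> * r ^ nat \<bar>y\<bar>)" .
  qed
  also have "\<dots> \<le> B * ((1 + 2 * S) / s)\<^sup>2"
    using one_plus_exp_over_one_minus_exp_le[OF s(1,3)] r B unfolding r_def[symmetric]
    by (intro mult_left_mono power_mono) auto
  also have "\<dots> = B * (1 + 2 * S)\<^sup>2 / (t / 2 * coercivity)"
    by (simp only: power_divide s(2)) simp
  also have "\<dots> = deriv_const * exp (2 + 6 * S) * (1 + 2 * S)\<^sup>2 * 2 / coercivity * (sqrt t ^ 3 / t)"
    using t coercivity_pos by (simp add: B_def mult.commute[of t])
  also have "sqrt t ^ 3 / t = sqrt t"
    using t by (simp add: power3_eq_cube)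
  finally have "8 * \<bar>alt_theta t\<bar> \<le> deriv_const * exp (2 + 6 * S) * (1 + 2 * S)\<^sup>2 * 2 / coercivity * sqrt t" by simp
  then show ?thesis unfolding S_def[symmetric] by linarith
qed

lemma alt_theta_tendsto: "(alt_theta \<longlongrightarrow> 0) (at_right 0)"
proof (rule Lim_null_comparison)
  let ?C = "deriv_const * exp (2 + 6 * sqrt (coercivity / 2)) * (1 + 2 * sqrt (coercivity / 2))\<^sup>2 * 2 / coercivity"
  have "\<forall>\<^sub>F t in at_right 0. t \<in> {0<..<1 :: real}"
    by (rule eventually_at_right_real) simp
  then show "\<forall>\<^sub>F t in at_right 0. norm (alt_theta t) \<le> ?C * sqrt t"
    by eventually_elim (use alt_theta_bound in auto)
  have "((\<lambda>t. ?C * sqrt t) \<longlongrightarrow> ?C * sqrt 0) (at_right 0)"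
    by (intro tendsto_intros)
  then show "((\<lambda>t. ?C * sqrt t) \<longlongrightarrow> 0) (at_right 0)" by simp
qed

end

definition theta :: "real \<Rightarrow> real \<Rightarrow> real \<Rightarrow> real \<Rightarrow> real" where
  "theta a b c t = (\<Sum>\<^sub>\<infinity>(x, y)\<in>UNIV. exp (- t * qform a b c (real_of_int x) (real_of_int y)))"

context posdef_form
begin

lemma has_sum_theta:
  assumes "t > 0"
  shows "((\<lambda>(x, y). exp (- t * qform a b c (real_of_int x) (real_of_int y))) has_sum theta a b c t) UNIV"
  unfolding theta_def using summable_exp_qform[OF assms] by (rule has_sum_infsum)

text \<open>
  The sum of the characters of \<open>(\<int>/2)\<^sup>2\<close> is four times the indicator of the trivial class.
\<close>

lemma theta_minus_scaled:
  assumes "t > 0"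
  shows "theta a b c t - 4 * theta a b c (4 * t) =
    - (alt_theta t + posdef_form.alt_theta c b a t + posdef_form.alt_theta a (b - 2 * a) (a - b + c) t)"
proof -
  interpret swap: posdef_form c b a using c_pos disc by unfold_locales (auto simp: ac_simps)
  \<comment> \<open>Taking \<open>x + y\<close> as the first coordinate turns the parity of
    \<open>x + y\<close> into that of a single coordinate and the form into this equivalent
    one.\<close>
  interpret shear: posdef_form a "b - 2 * a" "a - b + c"
    using a_pos disc by unfold_locales (auto simp: algebra_simps power2_eq_square)
  let ?G = "\<lambda>x y. exp (- t * qform a b c (real_of_int x) (real_of_int y))"
  have h1: "((\<lambda>(x, y). int_sign x * ?G x y) has_sum alt_theta t) UNIV"
    by (rule has_sum_alt_theta[OF assms])
  have "((\<lambda>(x, y). int_sign y * ?G x y) has_sum swap.alt_theta t) UNIV \<longleftrightarrow>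
    ((\<lambda>(x, y). int_sign x * exp (- t * qform c b a (real_of_int x) (real_of_int y)))
      has_sum swap.alt_theta t) UNIV"
    by (rule has_sum_reindex_bij_witness[of _ prod.swap prod.swap]) (auto simp: qform_def algebra_simps)
  with swap.has_sum_alt_theta[OF assms]
  have h2: "((\<lambda>(x, y). int_sign y * ?G x y) has_sum swap.alt_theta t) UNIV" by blast
  have "((\<lambda>(x, y). int_sign (x + y) * ?G x y) has_sum shear.alt_theta t) UNIV \<longleftrightarrow>
    ((\<lambda>(x, y). int_sign x * exp (- t * qform a (b - 2 * a) (a - b + c) (real_of_int x) (real_of_int y)))
      has_sum shear.alt_theta t) UNIV"
    by (rule has_sum_reindex_bij_witness[of _ "\<lambda>(x, y). (x - y, y)" "\<lambda>(x, y). (x + y, y)"])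
      (auto simp: qform_def algebra_simps power2_eq_square)
  with shear.has_sum_alt_theta[OF assms]
  have h3: "((\<lambda>(x, y). int_sign (x + y) * ?G x y) has_sum shear.alt_theta t) UNIV" by blast
  have h0: "((\<lambda>(x, y). ?G x y) has_sum theta a b c t) UNIV" by (rule has_sum_theta[OF assms])
  have "((\<lambda>w. (case w of (x, y) \<Rightarrow> ?G x y) + (case w of (x, y) \<Rightarrow> int_sign x * ?G x y) +
      (case w of (x, y) \<Rightarrow> int_sign y * ?G x y) + (case w of (x, y) \<Rightarrow> int_sign (x + y) * ?G x y))
    has_sum (theta a b c t + alt_theta t + swap.alt_theta t + shear.alt_theta t)) UNIV"
    by (intro has_sum_add h0 h1 h2 h3)
  moreover have "((\<lambda>w. 4 * (case w of (x, y) \<Rightarrow>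
      exp (- (4 * t) * qform a b c (real_of_int x) (real_of_int y)))) has_sum 4 * theta a b c (4 * t)) UNIV"
    using assms by (intro has_sum_cmult_right has_sum_theta) simp
  \<comment> \<open>Only points with both coordinates even survive the character sum, and there the
    form is 4 times its value at the halved point.\<close>
  then have "((\<lambda>(x, y). 4 * ?G x y) has_sum 4 * theta a b c (4 * t)) ((\<lambda>(x, y). (2 * x, 2 * y)) ` UNIV)"
    by (subst has_sum_reindex) (auto simp: inj_on_def o_def case_prod_unfold qform_def algebra_simps power2_eq_square)
  then have "((\<lambda>w. (case w of (x, y) \<Rightarrow> ?G x y) + (case w of (x, y) \<Rightarrow> int_sign x * ?G x y) +
      (case w of (x, y) \<Rightarrow> int_sign y * ?G x y) + (case w of (x, y) \<Rightarrow> int_sign (x + y) * ?G x y))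
    has_sum 4 * theta a b c (4 * t)) UNIV"
    by (rule has_sum_cong_neutral[THEN iffD1, rotated -1])
      (auto simp: int_sign_def image_iff elim!: evenE split: if_splits)
  ultimately have "theta a b c t + alt_theta t + swap.alt_theta t + shear.alt_theta t = 4 * theta a b c (4 * t)"
    by (rule has_sum_unique)
  then show ?thesis by simp
qed

lemma theta_minus_scaled_tendsto:
  "((\<lambda>t. theta a b c t - 4 * theta a b c (4 * t)) \<longlongrightarrow> 0) (at_right 0)"
proof -
  interpret swap: posdef_form c b a using c_pos disc by unfold_locales (auto simp: ac_simps)
  interpret shear: posdef_form a "b - 2 * a" "a - b + c"
    using a_pos disc by unfold_locales (auto simp: algebra_simps power2_eq_square)
  have "((\<lambda>t. - (alt_theta t + swap.alt_theta t + shear.alt_theta t)) \<longlongrightarrow> - (0 + 0 + 0)) (at_right 0)"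
    by (intro tendsto_intros alt_theta_tendsto swap.alt_theta_tendsto shear.alt_theta_tendsto)
  moreover have "\<forall>\<^sub>F t in at_right 0. t > (0 :: real)" by (rule eventually_at_right_less)
  then have "\<forall>\<^sub>F t in at_right 0. - (alt_theta t + swap.alt_theta t + shear.alt_theta t) =
      theta a b c t - 4 * theta a b c (4 * t)"
    by eventually_elim (simp add: theta_minus_scaled)
  ultimately show ?thesis by (simp add: filterlim_cong[OF refl refl] tendsto_cong)
qed

end

section \<open>Lambert series\<close>

lemma sum_by_parts:
  fixes f g :: "nat \<Rightarrow> real"
  shows "(\<Sum>d<N. f d * g d) = (\<Sum>d<N. f d) * g N + (\<Sum>d<N. (\<Sum>k<Suc d. f k) * (g d - g (Suc d)))"
  by (induction N) (simp_all add: algebra_simps)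

text \<open>The quantitative form of Dirichlet's test: bounded partial sums against decreasing
  weights telescope, and the boundary term \<open>M * g N\<close> recombines with
  \<open>M * (g 0 - g N)\<close>.\<close>

lemma abs_sum_by_parts_le:
  fixes f g :: "nat \<Rightarrow> real"
  assumes "\<And>N. \<bar>\<Sum>d<N. f d\<bar> \<le> M" "\<And>d. g (Suc d) \<le> g d" "\<And>d. 0 \<le> g d"
  shows "\<bar>\<Sum>d<N. f d * g d\<bar> \<le> M * g 0"
proof -
  have M: "0 \<le> M" using assms(1)[of 0] by simp
  have "\<bar>\<Sum>d<N. f d * g d\<bar> \<le>
      \<bar>(\<Sum>d<N. f d) * g N\<bar> + \<bar>\<Sum>d<N. (\<Sum>k<Suc d. f k) * (g d - g (Suc d))\<bar>"
    by (subst sum_by_parts) (rule abs_triangle_ineq)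
  also have "\<bar>\<Sum>d<N. (\<Sum>k<Suc d. f k) * (g d - g (Suc d))\<bar> \<le>
      (\<Sum>d<N. \<bar>(\<Sum>k<Suc d. f k) * (g d - g (Suc d))\<bar>)"
    by (rule sum_abs)
  also have "\<dots> \<le> (\<Sum>d<N. M * (g d - g (Suc d)))"
  proof (rule sum_mono)
    fix d
    show "\<bar>(\<Sum>k<Suc d. f k) * (g d - g (Suc d))\<bar> \<le> M * (g d - g (Suc d))"
      unfolding abs_mult using assms(1)[of "Suc d"] assms(2)[of d] by (intro mult_mono) auto
  qed
  also have "\<bar>(\<Sum>d<N. f d) * g N\<bar> \<le> M * g N"
    unfolding abs_mult using assms(1)[of N] assms(3)[of N] by (intro mult_mono) auto
  also have "(\<Sum>d<N. M * (g d - g (Suc d))) = M * (g 0 - g N)"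
    by (simp only: sum_distrib_left[symmetric] sum_lessThan_telescope')
  finally show ?thesis by (simp add: algebra_simps)
qed

lemma periodic_partial_sums:
  fixes f :: "nat \<Rightarrow> 'a :: comm_ring_1"
  assumes "\<And>d. f (d + p) = f d" "(\<Sum>d<p. f d) = 0"
  shows "(\<Sum>d<N + p. f d) = (\<Sum>d<N. f d)"
  by (induction N) (use assms in simp_all)

lemma periodic_bounded:
  fixes f :: "nat \<Rightarrow> real"
  assumes "\<And>d. f (d + p) = f d" "p > 0"
  shows "\<exists>M. \<forall>d. \<bar>f d\<bar> \<le> M"
proof (intro exI allI)
  fix d
  have "f (k + m * p) = f k" for k m
  proof (induction m)
    case (Suc m)
    have "k + Suc m * p = (k + m * p) + p" by simp
    then show ?case using Suc assms(1)[of "k + m * p"] by (simp only:)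
  qed simp
  from this[of "d mod p" "d div p"] have "f d = f (d mod p)" by simp
  moreover have "\<bar>f (d mod p)\<bar> \<le> (\<Sum>k<p. \<bar>f k\<bar>)"
    using assms(2) by (intro member_le_sum[of "d mod p" "{..<p}" "\<lambda>k. \<bar>f k\<bar>"]) auto
  ultimately show "\<bar>f d\<bar> \<le> (\<Sum>k<p. \<bar>f k\<bar>)" by simp
qed

text \<open>The Fermi-Dirac function. It is the bounded remainder after the pole of
  \<open>1 / (X - 1)\<close> is removed by doubling,
  \<open>1 / (X - 1) - 2 / (X^2 - 1) = 1 / (X + 1)\<close> with
  \<open>X = exp (t * d)\<close>.\<close>

definition fermi :: "real \<Rightarrow> nat \<Rightarrow> real" where "fermi t d = 1 / (exp (t * real d) + 1)"

text \<open>Cancelling \<open>X = exp (t * d)\<close> puts the dependence on \<open>d\<close> into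
  \<open>exp t * X + 1 / X\<close>, which increases for \<open>X \<ge> 1\<close>; convexity can be
  read off.\<close>

lemma fermi_difference:
  assumes "t > 0"
  shows "fermi t d - fermi t (Suc d) =
    (exp t - 1) / (exp t * exp (t * real d) + 1 / exp (t * real d) + exp t + 1)"
proof -
  define Q X where "Q = exp t" and "X = exp (t * real d)"
  have QX: "exp (t * real (Suc d)) = Q * X"
    by (simp add: Q_def X_def exp_add[symmetric] algebra_simps)
  have pos: "Q > 0" "X > 0" by (auto simp: Q_def X_def)
  have "fermi t d - fermi t (Suc d) = 1 / (X + 1) - 1 / (Q * X + 1)"
    unfolding fermi_def QX X_def ..
  also have "\<dots> = (Q - 1) * X / ((X + 1) * (Q * X + 1))"
  proof -
    have "X + 1 \<noteq> 0" "Q * X + 1 \<noteq> 0" using pos by (auto simp: add_pos_pos less_imp_neq[symmetric])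
    then show ?thesis by (simp add: diff_frac_eq algebra_simps)
  qed
  also have "(X + 1) * (Q * X + 1) = X * (Q * X + 1 / X + Q + 1)"
    using pos by (simp add: field_simps)
  also have "(Q - 1) * X / (X * (Q * X + 1 / X + Q + 1)) = (Q - 1) / (Q * X + 1 / X + Q + 1)"
    using pos by simp
  finally show ?thesis by (simp add: Q_def X_def)
qed

text \<open>A second summation by parts, against the differences of \<open>fermi t\<close>, requires
  these to be nonnegative and decreasing.\<close>

lemma fermi_convex:
  assumes "t > 0"
  shows "fermi t (Suc d) - fermi t (Suc (Suc d)) \<le> fermi t d - fermi t (Suc d)"
    and "0 \<le> fermi t d - fermi t (Suc d)"
proof -
  define Q X Y where "Q = exp t" and "X = exp (t * real d)" and "Y = exp (t * real (Suc d))"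
  have XY: "1 \<le> X" "X \<le> Y" "1 \<le> Q" using assms by (auto simp: Q_def X_def Y_def)
  have "(Y - X) * (Q - 1 / (X * Y)) \<ge> 0"
  proof -
    have "1 * 1 \<le> X * Y" using XY by (intro mult_mono) auto
    then have "1 / (X * Y) \<le> 1" by (simp add: divide_le_eq_1)
    then have "1 / (X * Y) \<le> Q" using XY by linarith
    then show ?thesis using XY by (intro mult_nonneg_nonneg) auto
  qed
  moreover have "(Y - X) * (Q - 1 / (X * Y)) = (Q * Y + 1 / Y) - (Q * X + 1 / X)"
    using XY by (simp add: field_simps)
  ultimately have "Q * X + 1 / X \<le> Q * Y + 1 / Y" by simp
  then have "(Q - 1) / (Q * Y + 1 / Y + Q + 1) \<le> (Q - 1) / (Q * X + 1 / X + Q + 1)"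
    using XY by (intro divide_left_mono mult_pos_pos add_pos_pos) auto
  then show "fermi t (Suc d) - fermi t (Suc (Suc d)) \<le> fermi t d - fermi t (Suc d)"
    unfolding fermi_difference[OF assms] Q_def X_def Y_def .
  show "0 \<le> fermi t d - fermi t (Suc d)"
    unfolding fermi_difference[OF assms] using assms by (intro divide_nonneg_nonneg add_nonneg_nonneg) auto
qed

lemma fermi_nonneg: "0 \<le> fermi t d"
  by (simp add: fermi_def add_nonneg_nonneg)

lemma fermi_le_power: "fermi t d \<le> exp (- t) ^ d"
proof -
  have "1 / (exp (t * real d) + 1) \<le> 1 / exp (t * real d)" by (intro divide_left_mono) (auto simp: add_pos_pos)
  also have "1 / exp (t * real d) = exp (- t) ^ d"
    by (simp add: exp_of_nat_mult[symmetric] exp_minus inverse_eq_divide power_divide mult.commute)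
  finally show ?thesis by (simp add: fermi_def)
qed

lemma fermi_tendsto_0:
  assumes "t > 0"
  shows "fermi t \<longlonglongrightarrow> 0"
proof (rule Lim_null_comparison)
  show "\<forall>\<^sub>F d in sequentially. norm (fermi t d) \<le> exp (- t) ^ d"
    using fermi_nonneg fermi_le_power by simp
  show "(\<lambda>d. exp (- t) ^ d) \<longlonglongrightarrow> 0" using assms by (intro LIMSEQ_power_zero) simp
qed

section \<open>Lambert series of a periodic function with vanishing sum over a period\<close>

locale periodic_zero_sum =
  fixes \<epsilon> :: "nat \<Rightarrow> int" and p :: nat
  assumes p_pos: "p > 0" and periodic: "\<And>d. \<epsilon> (d + p) = \<epsilon> d" and sum_zero: "(\<Sum>d<p. \<epsilon> d) = 0"
    and at_0: "\<epsilon> 0 = 0"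
begin

definition psum :: "nat \<Rightarrow> real" where "psum d = (\<Sum>k<Suc d. real_of_int (\<epsilon> k))"

text \<open>The Cesaro value of the divergent series of \<open>\<epsilon>\<close>; for a nontrivial
  Dirichlet character \<chi> this is L(0, \<chi>).\<close>

definition psum_mean :: real where "psum_mean = (\<Sum>d<p. psum d) / real p"

lemma partial_sums_periodic: "(\<Sum>k<N + p. real_of_int (\<epsilon> k)) = (\<Sum>k<N. real_of_int (\<epsilon> k))"
proof (rule periodic_partial_sums)
  show "(\<Sum>d<p. real_of_int (\<epsilon> d)) = 0" using sum_zero by (simp flip: of_int_sum)
qed (simp add: periodic)

lemma psum_periodic: "psum (d + p) = psum d"
  unfolding psum_def using partial_sums_periodic[of "Suc d"] by simp

text \<open>Summation by parts twice. The first replaces \<open>\<epsilon>\<close> by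
  \<open>psum\<close>, whose mean contributes \<open>psum_mean * fermi t 0 = psum_mean / 2\<close>
  by telescoping. The centred remainder has bounded partial sums, so the second bounds it by
  \<open>M\<close> times the first difference of \<open>fermi t\<close>, which vanishes with
  \<open>t\<close>; \<open>M\<close> itself does not depend on \<open>t\<close>.\<close>

lemma sums_fermi_near:
  obtains M where "\<And>t s. t > 0 \<Longrightarrow> (\<lambda>d. real_of_int (\<epsilon> d) * fermi t d) sums s \<Longrightarrow>
    \<bar>s - psum_mean / 2\<bar> \<le> M * (1 / 2 - 1 / (exp t + 1))"
proof -
  define f where "f d = psum d - psum_mean" for d
  have f_per: "f (d + p) = f d" for d by (simp add: f_def psum_periodic)
  have f_zero: "(\<Sum>d<p. f d) = 0"
    using p_pos by (simp add: f_def sum_subtractf psum_mean_def)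
  obtain M where M: "\<And>N. \<bar>\<Sum>d<N. f d\<bar> \<le> M"
    using periodic_bounded[of "\<lambda>N. \<Sum>d<N. f d" p] periodic_partial_sums[of f p] f_per f_zero p_pos by blast
  obtain M' where M': "\<And>N. \<bar>\<Sum>k<N. real_of_int (\<epsilon> k)\<bar> \<le> M'"
    using periodic_bounded[of "\<lambda>N. \<Sum>k<N. real_of_int (\<epsilon> k)" p] partial_sums_periodic p_pos by blast
  have "\<bar>s - psum_mean / 2\<bar> \<le> M * (1 / 2 - 1 / (exp t + 1))"
    if t: "t > 0" and s: "(\<lambda>d. real_of_int (\<epsilon> d) * fermi t d) sums s" for t s
  proof -
    define w where "w d = fermi t d - fermi t (Suc d)" for d
    have "fermi t 0 = 1 / 2" by (simp add: fermi_def)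
    have eq: "(\<Sum>d<N. real_of_int (\<epsilon> d) * fermi t d) - psum_mean * (1 / 2 - fermi t N)
        - (\<Sum>k<N. real_of_int (\<epsilon> k)) * fermi t N = (\<Sum>d<N. f d * w d)" for N
    proof -
      have "(\<Sum>d<N. real_of_int (\<epsilon> d) * fermi t d) =
        (\<Sum>k<N. real_of_int (\<epsilon> k)) * fermi t N + (\<Sum>d<N. psum d * w d)"
        unfolding psum_def w_def by (rule sum_by_parts)
      moreover have "(\<Sum>d<N. psum d * w d) = (\<Sum>d<N. f d * w d) + psum_mean * (\<Sum>d<N. w d)"
        by (simp add: f_def sum_distrib_left algebra_simps sum_subtractf)
      moreover have "(\<Sum>d<N. w d) = 1 / 2 - fermi t N"
        unfolding w_def sum_lessThan_telescope' by (simp add: fermi_def)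
      ultimately show ?thesis by simp
    qed
    have bound: "\<bar>\<Sum>d<N. f d * w d\<bar> \<le> M * w 0" for N
      by (rule abs_sum_by_parts_le[OF M]) (use fermi_convex[OF t] in \<open>simp_all add: w_def\<close>)
    have "(\<lambda>N. (\<Sum>k<N. real_of_int (\<epsilon> k)) * fermi t N) \<longlonglongrightarrow> 0"
    proof (rule Lim_null_comparison)
      show "\<forall>\<^sub>F N in sequentially. norm ((\<Sum>k<N. real_of_int (\<epsilon> k)) * fermi t N) \<le> M' * norm (fermi t N)"
        using M' by (intro always_eventually allI) (simp add: abs_mult mult_right_mono)
      show "(\<lambda>N. M' * norm (fermi t N)) \<longlonglongrightarrow> 0"
        using tendsto_mult_right_zero[OF tendsto_norm_zero[OF fermi_tendsto_0[OF t]]] .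
    qed
    then have "(\<lambda>N. (\<Sum>d<N. real_of_int (\<epsilon> d) * fermi t d) - psum_mean * (1 / 2 - fermi t N)
        - (\<Sum>k<N. real_of_int (\<epsilon> k)) * fermi t N) \<longlonglongrightarrow> s - psum_mean * (1 / 2 - 0) - 0"
      using s unfolding sums_def by (intro tendsto_diff tendsto_mult tendsto_const fermi_tendsto_0[OF t])
    then have "(\<lambda>N. \<Sum>d<N. f d * w d) \<longlonglongrightarrow> s - psum_mean / 2" unfolding eq by simp
    then have "(\<lambda>N. \<bar>\<Sum>d<N. f d * w d\<bar>) \<longlonglongrightarrow> \<bar>s - psum_mean / 2\<bar>" by (rule tendsto_rabs)
    then have "\<bar>s - psum_mean / 2\<bar> \<le> M * w 0"
      by (rule tendsto_upperbound) (use bound in auto)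
    then show ?thesis by (simp add: w_def fermi_def)
  qed
  then show ?thesis by (rule that)
qed

lemma fermi_series_tendsto:
  assumes "\<And>t. t > 0 \<Longrightarrow> (\<lambda>d. real_of_int (\<epsilon> d) * fermi t d) sums L t"
  shows "(L \<longlongrightarrow> psum_mean / 2) (at_right 0)"
proof -
  obtain M where M: "\<And>t s. t > 0 \<Longrightarrow> (\<lambda>d. real_of_int (\<epsilon> d) * fermi t d) sums s \<Longrightarrow>
    \<bar>s - psum_mean / 2\<bar> \<le> M * (1 / 2 - 1 / (exp t + 1))" using sums_fermi_near by blast
  have "((\<lambda>t. L t - psum_mean / 2) \<longlongrightarrow> 0) (at_right 0)"
  proof (rule Lim_null_comparison)
    have "\<forall>\<^sub>F t in at_right 0. t > (0 :: real)" by (rule eventually_at_right_less)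
    then show "\<forall>\<^sub>F t in at_right 0. norm (L t - psum_mean / 2) \<le> M * (1 / 2 - 1 / (exp t + 1))"
      by eventually_elim (use M assms in auto)
    have "((\<lambda>t. M * (1 / 2 - 1 / (exp t + 1))) \<longlongrightarrow> M * (1 / 2 - 1 / (exp 0 + 1))) (at_right (0 :: real))"
      by (intro tendsto_intros) auto
    then show "((\<lambda>t. M * (1 / 2 - 1 / (exp t + 1))) \<longlongrightarrow> 0) (at_right (0 :: real))" by simp
  qed
  then show ?thesis by (simp add: LIM_zero_iff)
qed

lemma bounded_eps: "\<exists>B. \<forall>d. \<bar>real_of_int (\<epsilon> d)\<bar> \<le> B"
  using periodic_bounded[of "\<lambda>d. real_of_int (\<epsilon> d)" p] periodic p_pos by simp

lemma abs_summable_lambert: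
  assumes "t > 0"
  shows "(\<lambda>(d, k). real_of_int (\<epsilon> d) * exp (- t * real (d * k))) summable_on ({1..} \<times> {1..})"
proof -
  obtain B where B: "\<And>d. \<bar>real_of_int (\<epsilon> d)\<bar> \<le> B" using bounded_eps by blast
  define q where "q = exp (- t)"
  have q: "norm q < 1" "0 < q" using assms by (auto simp: q_def)
  note g = has_sum_geometric_from_1[OF q(1)]
  have "((\<lambda>k. case (d, k) of (d, k) \<Rightarrow> q ^ d * q ^ k) has_sum (q ^ d * (q / (1 - q)))) {1..}" for d :: nat
    using has_sum_cmult_right[OF g] by simp
  moreover have "(\<lambda>d. q ^ d * (q / (1 - q))) summable_on {1..}"
    using has_sum_cmult_left[OF g] by (rule has_sum_imp_summable)
  ultimately have "(\<lambda>(d, k). q ^ d * q ^ k) summable_on ({1..} \<times> {1..})"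
    by (rule summable_on_SigmaI) (use q in auto)
  then have "(\<lambda>w. (B * exp t) * (case w of (d, k) \<Rightarrow> q ^ d * q ^ k)) summable_on ({1..} \<times> {1..})"
    by (rule summable_on_cmult_right)
  then have "(\<lambda>w. norm (case w of (d, k) \<Rightarrow> real_of_int (\<epsilon> d) * exp (- t * real (d * k)))) summable_on ({1..} \<times> {1..})"
  proof (rule summable_on_comparison_test, clarify)
    fix d k :: nat assume dk: "d \<ge> 1" "k \<ge> 1"
    \<comment> \<open>By \<open>d * k \<ge> d + k - 1\<close> the double series is dominated by a
      product of two geometric series; the factor \<open>exp t\<close> pays for the -1.\<close>
    have "(real d - 1) * (real k - 1) \<ge> 0" using dk by simp
    then have "real d + real k - 1 \<le> real (d * k)" by (simp add: algebra_simps)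
    then have "t * (real d + real k - 1) \<le> t * real (d * k)" using assms by (intro mult_left_mono) auto
    then have "exp (- t * real (d * k)) \<le> exp (t + (real d * (- t) + real k * (- t)))" by (simp add: algebra_simps)
    also have "\<dots> = exp t * (q ^ d * q ^ k)" by (simp only: exp_add exp_of_nat_mult q_def)
    finally have "\<bar>real_of_int (\<epsilon> d)\<bar> * exp (- t * real (d * k)) \<le> B * (exp t * (q ^ d * q ^ k))"
      using B[of d] by (intro mult_mono) auto
    then show "norm (real_of_int (\<epsilon> d) * exp (- t * real (d * k))) \<le> B * exp t * (q ^ d * q ^ k)"
      by (simp add: abs_mult mult.assoc)
  qed auto
  then show ?thesis by (rule abs_summable_summable)
qed

definition lambert :: "real \<Rightarrow> real" where
  "lambert t = (\<Sum>\<^sub>\<infinity>(d, k)\<in>{1..} \<times> {1..}. real_of_int (\<epsilon> d) * exp (- t * real (d * k)))"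

lemma has_sum_lambert_pairs:
  assumes "t > 0"
  shows "((\<lambda>(d, k). real_of_int (\<epsilon> d) * exp (- t * real (d * k))) has_sum lambert t) ({1..} \<times> {1..})"
  unfolding lambert_def using abs_summable_lambert[OF assms] by (rule has_sum_infsum)

lemma has_sum_lambert:
  assumes t: "t > 0"
  shows "((\<lambda>d. real_of_int (\<epsilon> d) / (exp (t * real d) - 1)) has_sum lambert t) {1..}"
proof (rule has_sum_SigmaD[OF has_sum_lambert_pairs[OF t]])
  fix d :: nat assume "d \<in> {1..}"
  then have d: "d \<ge> 1" by simp
  define q where "q = exp (- (t * real d))"
  have q: "norm q < 1" using t d by (simp add: q_def)
  have "q / (1 - q) = 1 / (exp (t * real d) - 1)"
    using t d by (simp add: q_def exp_minus field_simps)
  then have "((\<lambda>k. real_of_int (\<epsilon> d) * q ^ k) has_sum (real_of_int (\<epsilon> d) / (exp (t * real d) - 1))) {1..}"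
    using has_sum_cmult_right[OF has_sum_geometric_from_1[OF q], of "real_of_int (\<epsilon> d)"] by simp
  moreover have "q ^ k = exp (- t * real (d * k))" for k
    by (simp add: q_def exp_of_nat_mult[symmetric] algebra_simps)
  ultimately show "((\<lambda>k. case (d, k) of (d, k) \<Rightarrow> real_of_int (\<epsilon> d) * exp (- t * real (d * k))) has_sum
      (real_of_int (\<epsilon> d) / (exp (t * real d) - 1))) {1..}" by simp
qed

text \<open>The same double series, grouped by the product \<open>m = d * k\<close> instead of by
  \<open>d\<close>.\<close>

lemma has_sum_lambert_divisors:
  assumes t: "t > 0"
  shows "((\<lambda>m. real_of_int (\<Sum>d | d dvd m. \<epsilon> d) * exp (- t * real m)) has_sum lambert t) {1..}"
proof -
  have "((\<lambda>(d, k). real_of_int (\<epsilon> d) * exp (- t * real (d * k))) has_sum lambert t) ({1..} \<times> {1..}) \<longleftrightarrow>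
    ((\<lambda>(m, d). real_of_int (\<epsilon> d) * exp (- t * real m)) has_sum lambert t) (SIGMA m:{1..}. {d. d dvd m})"
    by (rule has_sum_reindex_bij_witness[of _ "\<lambda>(m, d). (d, m div d)" "\<lambda>(d, k). (d * k, d)"])
      (auto elim!: dvdE)
  with has_sum_lambert_pairs[OF t]
  have h: "((\<lambda>(m, d). real_of_int (\<epsilon> d) * exp (- t * real m)) has_sum lambert t) (SIGMA m:{1..}. {d. d dvd m})"
    by blast
  show ?thesis
  proof (rule has_sum_SigmaD[OF h])
    fix m :: nat assume "m \<in> {1..}"
    then have "finite {d. d dvd m}" by simp
    then show "((\<lambda>d. case (m, d) of (m, d) \<Rightarrow> real_of_int (\<epsilon> d) * exp (- t * real m)) has_sum
        (real_of_int (\<Sum>d | d dvd m. \<epsilon> d) * exp (- t * real m))) {d. d dvd m}"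
      by (intro has_sum_finiteI) (auto simp: sum_distrib_right)
  qed
qed

lemma lambert_minus_scaled:
  assumes t: "t > 0"
  shows "(\<lambda>d. real_of_int (\<epsilon> d) * (fermi t d + 2 * fermi (2 * t) d)) sums (lambert t - 4 * lambert (4 * t))"
proof -
  have "((\<lambda>d. real_of_int (\<epsilon> d) / (exp (t * real d) - 1) + (- 4) * (real_of_int (\<epsilon> d) / (exp (4 * t * real d) - 1)))
      has_sum (lambert t + (- 4) * lambert (4 * t))) {1..}"
    using t by (intro has_sum_add has_sum_cmult_right has_sum_lambert) auto
  then have "((\<lambda>d. real_of_int (\<epsilon> d) * (fermi t d + 2 * fermi (2 * t) d)) has_sum (lambert t - 4 * lambert (4 * t))) UNIV"
  proof (subst (asm) has_sum_cong_neutral)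
    fix d :: nat assume "d \<in> {1..} \<inter> UNIV"
    then have d: "d \<ge> 1" by simp
    define X where "X = exp (t * real d)"
    have X: "X > 1" using t d by (simp add: X_def)
    have X2: "exp (2 * t * real d) = X\<^sup>2" and X4: "exp (4 * t * real d) = (X\<^sup>2)\<^sup>2"
      by (simp_all add: X_def power2_eq_square exp_add[symmetric])
    have "X\<^sup>2 > 1" using X by (simp add: one_less_power)
    \<comment> \<open>With \<open>X^4 - 1 = (X - 1) * (X + 1) * (X^2 + 1)\<close>, the pole at
      \<open>X = 1\<close> cancels because of the coefficient 4.\<close>
    have "1 / (X - 1) - 4 / ((X\<^sup>2)\<^sup>2 - 1) = 1 / (X + 1) + 2 / (X\<^sup>2 + 1)"
    proof -
      have ne: "X - 1 \<noteq> 0" "X + 1 \<noteq> 0" "X\<^sup>2 + 1 \<noteq> 0" using X \<open>X\<^sup>2 > 1\<close> by linarith+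
      have f: "(X\<^sup>2)\<^sup>2 - 1 = (X - 1) * (X + 1) * (X\<^sup>2 + 1)"
        by (simp add: power2_eq_square algebra_simps)
      show ?thesis unfolding f using ne
        by (simp add: divide_simps) (simp add: power2_eq_square algebra_simps)
    qed
    then have "real_of_int (\<epsilon> d) * (1 / (X - 1) - 4 / ((X\<^sup>2)\<^sup>2 - 1)) =
        real_of_int (\<epsilon> d) * (1 / (X + 1) + 2 * (1 / (X\<^sup>2 + 1)))" by simp
    then show "real_of_int (\<epsilon> d) / (exp (t * real d) - 1) + (- 4) * (real_of_int (\<epsilon> d) / (exp (4 * t * real d) - 1))
        = real_of_int (\<epsilon> d) * (fermi t d + 2 * fermi (2 * t) d)"
      unfolding fermi_def X2 X4 X_def[symmetric] by (simp add: right_diff_distrib mult.commute)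
  qed (auto simp: at_0 Suc_le_eq)
  then show ?thesis by (rule has_sum_imp_sums)
qed

text \<open>The Fermi series at \<open>t\<close> and at \<open>2 * t\<close> both tend to
  \<open>psum_mean / 2\<close> and enter with weights 1 and 2.\<close>

lemma lambert_minus_scaled_tendsto:
  "((\<lambda>t. lambert t - 4 * lambert (4 * t)) \<longlongrightarrow> 3 / 2 * psum_mean) (at_right 0)"
proof -
  obtain B where B: "\<And>d. \<bar>real_of_int (\<epsilon> d)\<bar> \<le> B" using bounded_eps by blast
  define L where "L t = (\<Sum>d. real_of_int (\<epsilon> d) * fermi t d)" for t
  have L: "(\<lambda>d. real_of_int (\<epsilon> d) * fermi t d) sums L t" if t: "t > 0" for t
    unfolding L_def
  proof (rule summable_sums, rule summable_comparison_test')
    show "summable (\<lambda>d. B * exp (- t) ^ d)"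
      using t by (intro summable_mult summable_geometric) auto
    fix d :: nat
    show "norm (real_of_int (\<epsilon> d) * fermi t d) \<le> B * exp (- t) ^ d"
      unfolding real_norm_def abs_mult using B[of d] fermi_nonneg[of t d] fermi_le_power[of t d]
      by (intro mult_mono) auto
  qed
  have lim: "(L \<longlongrightarrow> psum_mean / 2) (at_right 0)" using L by (rule fermi_series_tendsto)
  have "filterlim (\<lambda>t :: real. 2 * t) (at_right 0) (at_right 0)"
    by (rule filterlim_times_pos[where p = 0, simplified]) (auto intro: filterlim_ident)
  then have lim2: "((\<lambda>t. L (2 * t)) \<longlongrightarrow> psum_mean / 2) (at_right 0)"
    by (rule filterlim_compose[OF lim])
  have "((\<lambda>t. L t + 2 * L (2 * t)) \<longlongrightarrow> psum_mean / 2 + 2 * (psum_mean / 2)) (at_right 0)"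
    by (intro tendsto_add tendsto_mult tendsto_const lim lim2)
  moreover have "\<forall>\<^sub>F t in at_right 0. t > (0 :: real)" by (rule eventually_at_right_less)
  then have "\<forall>\<^sub>F t in at_right 0. L t + 2 * L (2 * t) = lambert t - 4 * lambert (4 * t)"
  proof eventually_elim
    case (elim t)
    have "(\<lambda>d. real_of_int (\<epsilon> d) * fermi t d + 2 * (real_of_int (\<epsilon> d) * fermi (2 * t) d)) sums (L t + 2 * L (2 * t))"
      using elim by (intro sums_add sums_mult L) auto
    then show ?case using lambert_minus_scaled[OF elim] sums_unique2 by (fastforce simp: algebra_simps)
  qed
  ultimately show ?thesis by (simp add: tendsto_cong)
qed

end

section \<open>Theta series as generating functions of representation numbers\<close>

lemma (in posdef_form) finite_level_set:
  "finite {(x :: int, y :: int). qform a b c (real_of_int x) (real_of_int y) = v}"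
proof (rule finite_subset)
  define N where "N = \<lceil>v / coercivity\<rceil>"
  show "{(x :: int, y :: int). qform a b c (real_of_int x) (real_of_int y) = v} \<subseteq> {- N..N} \<times> {- N..N}"
  proof (rule subrelI)
    fix x y :: int
    assume "(x, y) \<in> {(x, y). qform a b c (real_of_int x) (real_of_int y) = v}"
    then have v: "v = qform a b c (real_of_int x) (real_of_int y)" by simp
    have "(real_of_int x)\<^sup>2 + (real_of_int y)\<^sup>2 \<le> v / coercivity"
      using qform_ge[of "real_of_int x" "real_of_int y"] coercivity_pos
      by (simp add: v le_divide_eq mult.commute)
    also have "v / coercivity \<le> real_of_int N" by (simp add: N_def)
    finally have N: "x\<^sup>2 + y\<^sup>2 \<le> N" by (simp flip: of_int_power of_int_add)
    have "\<bar>z\<bar> \<le> z\<^sup>2" for z :: int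
      using self_le_power[of "\<bar>z\<bar>" 2] by (cases "z = 0") auto
    from this[of x] this[of y] N have "\<bar>x\<bar> \<le> N" "\<bar>y\<bar> \<le> N"
      using zero_le_power2[of x] zero_le_power2[of y] by linarith+
    then show "(x, y) \<in> {- N..N} \<times> {- N..N}" by auto
  qed
qed simp

definition rep_count :: "int \<Rightarrow> int \<Rightarrow> int \<Rightarrow> int \<Rightarrow> nat" where
  "rep_count a b c m = card {(x :: int, y :: int). a * x\<^sup>2 + b * x * y + c * y\<^sup>2 = m}"

lemma qform_of_int:
  "qform (real_of_int a) (real_of_int b) (real_of_int c) (real_of_int x) (real_of_int y) =
    real_of_int (a * x\<^sup>2 + b * x * y + c * y\<^sup>2)"
  by (simp add: qform_def)

text \<open>The subtracted 1 is the term of the origin, the only point at which the form is not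
  positive.\<close>

lemma has_sum_rep_count:
  fixes a b c :: int
  assumes "posdef_form (real_of_int a) (real_of_int b) (real_of_int c)" and t: "t > 0"
  shows "((\<lambda>m. real (rep_count a b c (int m)) * exp (- t * real m)) has_sum
    (theta (real_of_int a) (real_of_int b) (real_of_int c) t - 1)) {1..}"
proof -
  interpret posdef_form "real_of_int a" "real_of_int b" "real_of_int c" by fact
  let ?f = "\<lambda>x y :: int. a * x\<^sup>2 + b * x * y + c * y\<^sup>2"
  let ?B = "\<lambda>m :: nat. {(x, y). ?f x y = int m}"
  have fin: "finite (?B m)" for m
  proof -
    have "real_of_int z = real m \<longleftrightarrow> z = int m" for z :: int
      using of_int_eq_iff[of z "int m", where 'a = real] by simp
    then have "?B m = {(x, y). qform a b c (real_of_int x) (real_of_int y) = real m}"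
      unfolding qform_of_int by blast
    then show ?thesis using finite_level_set[of "real m"] by simp
  qed
  have pos: "?f x y > 0" if "(x, y) \<noteq> (0, 0)" for x y
  proof -
    have "(real_of_int x)\<^sup>2 + (real_of_int y)\<^sup>2 > 0"
      using that by (simp add: sum_power2_gt_zero_iff)
    then have "qform a b c (real_of_int x) (real_of_int y) > 0"
      using qform_ge[of x y] coercivity_pos by (smt (verit) mult_pos_pos)
    then show ?thesis unfolding qform_of_int of_int_0_less_iff .
  qed
  have "((\<lambda>(x, y). exp (- t * qform a b c (real_of_int x) (real_of_int y))) has_sum
      (theta a b c t - 1)) (UNIV - {(0, 0)})"
  proof -
    have "((\<lambda>(x, y). exp (- t * qform a b c (real_of_int x) (real_of_int y))) has_sum
      (theta a b c t - sum (\<lambda>(x, y). exp (- t * qform a b c (real_of_int x) (real_of_int y))) {(0, 0)}))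
      (UNIV - {(0, 0)})"
      by (rule has_sum_Diff[OF has_sum_theta[OF t] has_sum_finite]) auto
    then show ?thesis by (simp add: qform_def)
  qed
  moreover have "((\<lambda>(x, y). exp (- t * qform a b c (real_of_int x) (real_of_int y))) has_sum
      (theta a b c t - 1)) (UNIV - {(0, 0)}) \<longleftrightarrow>
    ((\<lambda>(m, w). exp (- t * real m)) has_sum (theta a b c t - 1)) (SIGMA m:{1..}. ?B m)"
  proof (rule has_sum_reindex_bij_witness[of _ "snd" "\<lambda>w. (nat (?f (fst w) (snd w)), w)"], goal_cases)
    case (2 w)
    then show ?case using pos[of "fst w" "snd w"] by (cases w) (auto simp: int_one_le_iff_zero_less nat_le_eq_zle Suc_le_eq)
  next
    case (4 w)
    have "?f 0 0 = 0" by simp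
    with 4 show ?case by auto
  next
    case (5 w)
    then show ?case using pos[of "fst w" "snd w"] by (cases w) (simp add: qform_of_int)
  qed auto
  ultimately have h: "((\<lambda>(m, w). exp (- t * real m)) has_sum (theta a b c t - 1)) (SIGMA m:{1..}. ?B m)"
    by blast
  show ?thesis
  proof (rule has_sum_SigmaD[OF h])
    fix m :: nat
    show "((\<lambda>w. case (m, w) of (m, w) \<Rightarrow> exp (- t * real m)) has_sum
        (real (rep_count a b c (int m)) * exp (- t * real m))) (?B m)"
      by (intro has_sum_finiteI fin) (simp add: rep_count_def)
  qed
qed

lemma has_sum_sum:
  fixes f :: "'i \<Rightarrow> 'a \<Rightarrow> 'b :: topological_comm_monoid_add"
  assumes "\<And>i. i \<in> F \<Longrightarrow> (f i has_sum s i) A"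
  shows "((\<lambda>x. \<Sum>i\<in>F. f i x) has_sum (\<Sum>i\<in>F. s i)) A"
  using assms by (induction F rule: infinite_finite_induct) (auto intro: has_sum_add)

text \<open>
  The sum of the theta functions equals the Lambert series up to the constant \<open>card F\<close>. Subtracting four times
  the value at \<open>4 t\<close> removes the (unknown) pole at \<open>t = 0\<close> on both sides, so that the limit
  \<open>t \<rightarrow> 0\<close> compares the constant terms.
\<close>

theorem (in periodic_zero_sum) card_forms_eq_psum_mean:
  fixes a b c :: "'i \<Rightarrow> int"
  assumes "finite F"
    and forms: "\<And>i. i \<in> F \<Longrightarrow> posdef_form (real_of_int (a i)) (real_of_int (b i)) (real_of_int (c i))"
    and count: "\<And>m :: nat. m \<ge> 1 \<Longrightarrow>
      int (\<Sum>i\<in>F. rep_count (a i) (b i) (c i) (int m)) = 2 * (\<Sum>d | d dvd m. \<epsilon> d)"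
  shows "real (card F) = psum_mean"
proof -
  define \<theta> where "\<theta> i = theta (real_of_int (a i)) (real_of_int (b i)) (real_of_int (c i))" for i
  have theta_sum: "(\<Sum>i\<in>F. \<theta> i t) = real (card F) + 2 * lambert t" if t: "t > 0" for t
  proof -
    have "((\<lambda>m. \<Sum>i\<in>F. real (rep_count (a i) (b i) (c i) (int m)) * exp (- t * real m)) has_sum
        (\<Sum>i\<in>F. \<theta> i t - 1)) {1..}"
      unfolding \<theta>_def using forms t by (intro has_sum_sum has_sum_rep_count) auto
    moreover have "((\<lambda>m. 2 * (real_of_int (\<Sum>d | d dvd m. \<epsilon> d) * exp (- t * real m))) has_sum 2 * lambert t) {1..}"
      by (intro has_sum_cmult_right has_sum_lambert_divisors t)
    moreover have "(\<Sum>i\<in>F. real (rep_count (a i) (b i) (c i) (int m)) * exp (- t * real m)) =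
        2 * (real_of_int (\<Sum>d | d dvd m. \<epsilon> d) * exp (- t * real m))" if "m \<in> {1..}" for m
    proof -
      have "real_of_int (int (\<Sum>i\<in>F. rep_count (a i) (b i) (c i) (int m))) = real_of_int (2 * (\<Sum>d | d dvd m. \<epsilon> d))"
        using count[of m] that by simp
      then have "(\<Sum>i\<in>F. real (rep_count (a i) (b i) (c i) (int m))) = 2 * real_of_int (\<Sum>d | d dvd m. \<epsilon> d)"
        by simp
      then show ?thesis by (simp add: sum_distrib_right[symmetric])
    qed
    ultimately have "(\<Sum>i\<in>F. \<theta> i t - 1) = 2 * lambert t"
      by (metis (no_types, lifting) has_sum_cong has_sum_unique)
    then show ?thesis by (simp add: sum_subtractf)
  qed
  have "((\<lambda>t. \<Sum>i\<in>F. \<theta> i t - 4 * \<theta> i (4 * t)) \<longlongrightarrow> (\<Sum>i\<in>F. 0)) (at_right 0)"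
    unfolding \<theta>_def by (intro tendsto_sum posdef_form.theta_minus_scaled_tendsto forms)
  moreover have "\<forall>\<^sub>F t in at_right 0. t > (0 :: real)" by (rule eventually_at_right_less)
  then have "\<forall>\<^sub>F t in at_right 0. (\<Sum>i\<in>F. \<theta> i t - 4 * \<theta> i (4 * t)) =
      2 * (lambert t - 4 * lambert (4 * t)) - 3 * real (card F)"
  proof eventually_elim
    case (elim t)
    then show ?case using theta_sum[of t] theta_sum[of "4 * t"]
      by (simp add: sum_subtractf sum_distrib_left[symmetric])
  qed
  ultimately have "((\<lambda>t. 2 * (lambert t - 4 * lambert (4 * t)) - 3 * real (card F)) \<longlongrightarrow> 0) (at_right 0)"
    by (simp add: tendsto_cong)
  moreover have "((\<lambda>t. 2 * (lambert t - 4 * lambert (4 * t)) - 3 * real (card F)) \<longlongrightarrow>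
      2 * (3 / 2 * psum_mean) - 3 * real (card F)) (at_right 0)"
    by (intro tendsto_intros lambert_minus_scaled_tendsto)
  ultimately have "0 = 2 * (3 / 2 * psum_mean) - 3 * real (card F)"
    by (rule tendsto_unique[rotated]) simp
  then show ?thesis by simp
qed

section \<open>Ideals of the imaginary quadratic field\<close>

lemma complex_of_rat: "(of_rat x :: complex) = of_real (of_rat x)"
  by (cases x) (simp add: of_rat_rat)

text \<open>Every power of the reduced denominator \<open>b\<close> divides \<open>c\<close>; for
  \<open>b \<ge> 2\<close> already the power with exponent \<open>c\<close> would exceed
  \<open>c\<close>.\<close>

lemma rat_power_bounded_denominator_imp_Ints:
  fixes r :: rat and c :: int
  assumes "c > 0" "\<And>k. of_int c * r ^ k \<in> \<int>"
  shows "r \<in> \<int>"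
proof -
  obtain a b where ab: "quotient_of r = (a, b)" by (cases "quotient_of r")
  have b: "b > 0" "coprime a b" and r: "r = of_int a / of_int b"
    using ab quotient_of_denom_pos quotient_of_coprime quotient_of_div by auto
  have "b ^ k dvd c" for k
  proof -
    obtain m where m: "of_int c * r ^ k = of_int m" using assms(2)[of k] by (elim Ints_cases)
    then have "of_int (c * a ^ k) = (of_int (m * b ^ k) :: rat)"
      using b by (simp add: r power_divide field_simps)
    then have "c * a ^ k = m * b ^ k" by (simp only: of_int_eq_iff)
    then have "b ^ k dvd c * a ^ k" by simp
    moreover have "coprime (b ^ k) (a ^ k)" using b by (simp add: coprime_commute)
    ultimately show ?thesis by (simp add: coprime_dvd_mult_left_iff)
  qed
  then have "b ^ nat c \<le> c" using assms(1) zdvd_imp_le by blast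
  have "b = 1"
  proof (rule ccontr)
    assume "b \<noteq> 1"
    then have "2 ^ nat c \<le> b ^ nat c" using b by (intro power_mono) auto
    moreover have "nat c < 2 ^ nat c" by (rule less_exp)
    then have "int (nat c) < 2 ^ nat c" by (metis of_nat_less_iff of_nat_numeral of_nat_power)
    ultimately show False using \<open>b ^ nat c \<le> c\<close> assms(1) by simp
  qed
  then show ?thesis by (simp add: r)
qed

text \<open>The square of the reduced denominator divides \<open>p\<close>, which is
  squarefree.\<close>

lemma rat_prime_mult_square_imp_Ints:
  fixes r :: rat and p :: nat
  assumes "prime p" "of_nat p * r\<^sup>2 \<in> \<int>"
  shows "r \<in> \<int>"
proof -
  obtain a b where ab: "quotient_of r = (a, b)" by (cases "quotient_of r")
  have b: "b > 0" "coprime a b" and r: "r = of_int a / of_int b"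
    using ab quotient_of_denom_pos quotient_of_coprime quotient_of_div by auto
  obtain m where "of_nat p * r\<^sup>2 = of_int m" using assms(2) by (elim Ints_cases)
  then have "of_int (int p * a\<^sup>2) = (of_int (m * b\<^sup>2) :: rat)"
    using b by (simp add: r power_divide field_simps)
  then have "int p * a\<^sup>2 = m * b\<^sup>2" by (simp only: of_int_eq_iff)
  then have "b\<^sup>2 dvd int p * a\<^sup>2" by simp
  moreover have "coprime (b\<^sup>2) (a\<^sup>2)" using b by (simp add: coprime_commute)
  ultimately have "b * b dvd int p" by (simp add: coprime_dvd_mult_left_iff power2_eq_square)
  moreover have "squarefree (int p)" using assms(1) by (intro squarefree_prime_elem prime_imp_prime_elem) simp
  ultimately have "is_unit b" by (auto simp: power2_eq_square dest: squarefreeD)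
  then show ?thesis using b by (simp add: r)
qed

text \<open>The condition \<open>p > 3\<close> leaves 1 and -1 as the only units, which is where the
  factor 2 between representations and ideals comes from.\<close>

locale imag_quadratic =
  fixes p :: nat
  assumes prime_p: "prime p" and p_mod_4: "p mod 4 = 3" and p_gt_3: "p > 3"
begin

definition rt :: complex where "rt = \<i> * of_real (sqrt (real p))"

definition \<omega> :: complex where "\<omega> = (1 + rt) / 2"

text \<open>The norm of \<open>\<omega>\<close>, integral because \<open>p\<close> is 3 modulo
  4.\<close>

definition c0 :: int where "c0 = (int p + 1) div 4"

definition elt :: "int \<Rightarrow> int \<Rightarrow> complex" where "elt x y = of_int x + of_int y * \<omega>"

abbreviation K :: "complex set" where "K \<equiv> quadratic_field (- int p)"

abbreviation R :: "complex ring" where "R \<equiv> ring_of_integers K"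

lemma csqrt_eq: "csqrt (of_int (- int p)) = rt"
  by (simp add: rt_def csqrt_of_real_nonpos)

lemma rt_square: "rt * rt = - of_nat p"
proof -
  have "rt * rt = (\<i> * \<i>) * of_real (sqrt (real p) * sqrt (real p))"
    unfolding rt_def of_real_mult by (simp only: ac_simps)
  then show ?thesis by simp
qed

lemma c0: "4 * c0 = int p + 1"
  using p_mod_4 unfolding c0_def by presburger

lemma Re_rat_combination: "Re (of_rat x + of_rat y * rt) = of_rat x"
  and Im_rat_combination: "Im (of_rat x + of_rat y * rt) = of_rat y * sqrt (real p)"
  by (simp_all add: complex_of_rat rt_def)

lemma cmod_rat_combination:
  "(cmod (of_rat x + of_rat y * rt))\<^sup>2 = of_rat (x\<^sup>2 + of_nat p * y\<^sup>2)"
  unfolding cmod_power2 Re_rat_combination Im_rat_combination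
  by (simp add: of_rat_add of_rat_mult of_rat_power
      power_mult_distrib mult.commute)

text \<open>The order generated by \<open>rt\<close>, smaller than the ring of integers. It is the
  reference lattice against which denominators of powers are measured.\<close>

definition lat :: "complex set" where "lat = {of_int u + of_int v * rt | u v. True}"

lemma lat_0: "0 \<in> lat"
  unfolding lat_def by (intro CollectI exI[of _ 0]) simp

lemma lat_add: "x \<in> lat \<Longrightarrow> y \<in> lat \<Longrightarrow> x + y \<in> lat"
  unfolding lat_def
proof clarify
  fix u v u' v' :: int
  show "\<exists>u'' v''. of_int u + of_int v * rt + (of_int u' + of_int v' * rt) = of_int u'' + of_int v'' * rt \<and> True"
    by (intro exI[of _ "u + u'"] exI[of _ "v + v'"]) (simp add: algebra_simps)
qed

lemma lat_int_mult: "x \<in> lat \<Longrightarrow> of_int c * x \<in> lat"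
  unfolding lat_def
proof clarify
  fix u v :: int
  show "\<exists>u'' v''. of_int c * (of_int u + of_int v * rt) = of_int u'' + of_int v'' * rt \<and> True"
    by (intro exI[of _ "c * u"] exI[of _ "c * v"]) (simp add: algebra_simps)
qed

lemma lat_sum: "(\<And>i. i \<in> A \<Longrightarrow> f i \<in> lat) \<Longrightarrow> sum f A \<in> lat"
  by (induction A rule: infinite_finite_induct) (auto intro: lat_0 lat_add)

lemma power_rat_combination:
  "\<exists>u v. (of_rat x + of_rat y * rt) ^ k = of_rat u + of_rat v * rt"
proof (induction k)
  case 0
  show ?case by (intro exI[of _ 1] exI[of _ 0]) simp
next
  case (Suc k)
  then obtain u v where uv: "(of_rat x + of_rat y * rt) ^ k = of_rat u + of_rat v * rt" by blast
  have "(of_rat x + of_rat y * rt) ^ Suc k = (of_rat x + of_rat y * rt) * (of_rat u + of_rat v * rt)"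
    by (simp only: power_Suc uv)
  also have "\<dots> = of_rat x * of_rat u + of_rat y * of_rat v * (rt * rt) + (of_rat x * of_rat v + of_rat y * of_rat u) * rt"
    by (simp add: algebra_simps)
  also have "\<dots> = of_rat (x * u - of_nat p * y * v) + of_rat (x * v + y * u) * rt"
    unfolding rt_square by (simp add: of_rat_mult of_rat_add of_rat_diff)
  finally show ?case by blast
qed

lemma rat_combination_denominator:
  "\<exists>d > 0. of_int d * (of_rat x + of_rat y * rt) \<in> lat"
proof -
  obtain a b where x: "x = Fract a b" "b > 0" using Rat_cases by metis
  obtain a' b' where y: "y = Fract a' b'" "b' > 0" using Rat_cases by metis
  have "of_int (b * b') * (of_rat x + of_rat y * rt) = of_int (a * b') + of_int (a' * b) * rt"
    using x y by (simp add: of_rat_rat field_simps)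
  also have "\<dots> \<in> lat" unfolding lat_def by blast
  finally show ?thesis using x y by (intro exI[of _ "b * b'"]) auto
qed

text \<open>A common denominator of the first \<open>m\<close> powers serves all of them, since the
  monic integral equation expresses each higher power as an integral combination of lower
  ones.\<close>

lemma algebraic_int_powers_denominator:
  assumes z: "z = of_rat x + of_rat y * rt" and "algebraic_int z"
  shows "\<exists>d > 0. \<forall>k. of_int d * z ^ k \<in> lat"
proof -
  obtain P where P: "lead_coeff P = 1" "\<forall>i. coeff P i \<in> \<int>" "poly P z = 0"
    using assms(2) by (auto elim: algebraic_int.cases)
  define m where "m = degree P"
  have "\<forall>k. \<exists>d > 0. of_int d * z ^ k \<in> lat"
    using power_rat_combination[of x y] rat_combination_denominator unfolding z by metis
  then obtain d where d: "\<And>k. d k > 0" "\<And>k. of_int (d k) * z ^ k \<in> lat" by metis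
  define D where "D = (\<Prod>k<m. d k)"
  have "of_int D * z ^ k \<in> lat" for k
  proof (induction k rule: less_induct)
    case (less k)
    show ?case
    proof (cases "k < m")
      case True
      then have "D = (\<Prod>k\<in>{..<m} - {k}. d k) * d k" by (simp add: D_def prod.remove[of _ k] mult.commute)
      then show ?thesis
        using lat_int_mult[OF d(2)[of k], of "\<Prod>k\<in>{..<m} - {k}. d k"] by (simp add: mult.assoc)
    next
      case False
      have "0 = (\<Sum>i\<le>m. coeff P i * z ^ i)" using P(3) by (simp add: poly_altdef m_def)
      also have "\<dots> = (\<Sum>i<m. coeff P i * z ^ i) + z ^ m"
        using P(1) by (simp add: lessThan_Suc_atMost[symmetric] m_def)
      finally have "z ^ m = - (\<Sum>i<m. coeff P i * z ^ i)" by (simp add: eq_neg_iff_add_eq_0 add.commute)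
      then have "z ^ k = z ^ (k - m) * - (\<Sum>i<m. coeff P i * z ^ i)"
        using False by (metis le_add_diff_inverse2 not_less power_add)
      then have eq: "of_int D * z ^ k = (\<Sum>i<m. - coeff P i * (of_int D * z ^ (k - m + i)))"
        by (simp add: sum_distrib_left sum_negf power_add ac_simps)
      show ?thesis unfolding eq
      proof (rule lat_sum)
        fix i assume i: "i \<in> {..<m}"
        obtain c where c: "- coeff P i = of_int c" using P(2) by (metis Ints_cases Ints_minus)
        have "k - m + i < k" using i False by auto
        then show "- coeff P i * (of_int D * z ^ (k - m + i)) \<in> lat"
          unfolding c by (intro lat_int_mult less.IH)
      qed
    qed
  qed
  moreover have "D > 0" using d by (simp add: D_def prod_pos)
  ultimately show ?thesis by blast
qed

text \<open>The squared modulus is multiplicative and integral on \<open>lat\<close>, so all powers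
  of the norm have a denominator dividing \<open>d^2\<close>.\<close>

lemma norm_Ints_of_powers:
  assumes "d > 0" "\<And>k. of_int d * (of_rat x + of_rat y * rt) ^ k \<in> lat"
  shows "x\<^sup>2 + of_nat p * y\<^sup>2 \<in> \<int>"
proof (rule rat_power_bounded_denominator_imp_Ints[of "d\<^sup>2"])
  fix k
  define z where "z = of_rat x + of_rat y * rt"
  obtain u v where uv: "of_int d * z ^ k = of_int u + of_int v * rt"
    using assms(2)[of k] by (auto simp: lat_def z_def)
  have "of_rat (of_int (d\<^sup>2) * (x\<^sup>2 + of_nat p * y\<^sup>2) ^ k) = (cmod (of_int d * z ^ k))\<^sup>2"
  proof -
    have "of_rat (x\<^sup>2 + of_nat p * y\<^sup>2) = (cmod z)\<^sup>2" by (simp only: z_def cmod_rat_combination)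
    then have "of_rat (of_int (d\<^sup>2) * (x\<^sup>2 + of_nat p * y\<^sup>2) ^ k) = of_int (d\<^sup>2) * ((cmod z)\<^sup>2) ^ k"
      by (simp only: of_rat_mult of_rat_power of_rat_of_int_eq)
    then show ?thesis
      by (simp add: norm_mult norm_power power_mult_distrib power_mult[symmetric] mult.commute[of 2])
  qed
  also have "\<dots> = of_rat (of_int (u\<^sup>2 + int p * v\<^sup>2))"
    unfolding uv using cmod_rat_combination[of "of_int u" "of_int v"] by simp
  finally have "of_int (d\<^sup>2) * (x\<^sup>2 + of_nat p * y\<^sup>2) ^ k = of_int (u\<^sup>2 + int p * v\<^sup>2)"
    by (simp only: of_rat_eq_iff)
  then show "of_int (d\<^sup>2) * (x\<^sup>2 + of_nat p * y\<^sup>2) ^ k \<in> \<int>" by simp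
qed (use assms in simp)

text \<open>The trace \<open>2 * x\<close> is recovered from the norms of \<open>z\<close> and
  \<open>z + 1\<close>, whose powers share a denominator by the binomial theorem. With
  \<open>T = 2 * x\<close> and \<open>S = 2 * y\<close> integral, divisibility of
  \<open>T^2 + p * S^2\<close> by 4 forces \<open>T\<close> and \<open>S\<close> to have the same
  parity.\<close>

lemma algebraic_int_imp_elt:
  assumes "z \<in> K" "algebraic_int z"
  shows "\<exists>u v. z = elt u v"
proof -
  obtain x y where z: "z = of_rat x + of_rat y * rt"
    using assms(1) unfolding quadratic_field_def csqrt_eq by blast
  obtain d where d: "d > 0" "\<And>k. of_int d * z ^ k \<in> lat"
    using algebraic_int_powers_denominator[OF z assms(2)] by blast
  have N: "x\<^sup>2 + of_nat p * y\<^sup>2 \<in> \<int>"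
    using norm_Ints_of_powers[of d x y] d z by simp
  have "of_int d * (z + 1) ^ k \<in> lat" for k
  proof -
    have "of_int d * (z + 1) ^ k = (\<Sum>i\<le>k. of_int (int (k choose i)) * (of_int d * z ^ i))"
      unfolding binomial_ring[of z 1 k] by (simp add: sum_distrib_left ac_simps)
    then show ?thesis by (auto intro!: lat_sum lat_int_mult d simp del: of_int_of_nat_eq)
  qed
  moreover have "z + 1 = of_rat (x + 1) + of_rat y * rt" by (simp add: z of_rat_add)
  ultimately have N1: "(x + 1)\<^sup>2 + of_nat p * y\<^sup>2 \<in> \<int>"
    using norm_Ints_of_powers[of d "x + 1" y] d(1) by simp
  have "2 * x = ((x + 1)\<^sup>2 + of_nat p * y\<^sup>2) - (x\<^sup>2 + of_nat p * y\<^sup>2) - 1"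
    by (simp add: power2_eq_square algebra_simps)
  then have "2 * x \<in> \<int>" using N N1 by (metis Ints_1 Ints_diff)
  then obtain T where T: "2 * x = of_int T" by (elim Ints_cases)
  obtain m where m: "x\<^sup>2 + of_nat p * y\<^sup>2 = of_int m" using N by (elim Ints_cases)
  have "of_nat p * (2 * y)\<^sup>2 = 4 * (x\<^sup>2 + of_nat p * y\<^sup>2) - (2 * x)\<^sup>2"
    by (simp add: power2_eq_square algebra_simps)
  moreover have "4 * (x\<^sup>2 + of_nat p * y\<^sup>2) - (2 * x)\<^sup>2 = of_int (4 * m - T\<^sup>2)"
    unfolding m T by simp
  ultimately have "of_nat p * (2 * y)\<^sup>2 = of_int (4 * m - T\<^sup>2)" by (rule trans)
  then have "of_nat p * (2 * y)\<^sup>2 \<in> \<int>" by (simp only: Ints_of_int)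
  then have "2 * y \<in> \<int>" by (rule rat_prime_mult_square_imp_Ints[OF prime_p])
  then obtain S where S: "2 * y = of_int S" by (elim Ints_cases)
  have "of_int (T\<^sup>2 + int p * S\<^sup>2) = (of_int (4 * m) :: rat)"
  proof -
    have "of_int (T\<^sup>2 + int p * S\<^sup>2) = (2 * x)\<^sup>2 + of_nat p * (2 * y)\<^sup>2" unfolding T S by simp
    also have "\<dots> = 4 * (x\<^sup>2 + of_nat p * y\<^sup>2)" by (simp add: power2_eq_square algebra_simps)
    finally show ?thesis unfolding m by simp
  qed
  then have "T\<^sup>2 + int p * S\<^sup>2 = 4 * m" by (simp only: of_int_eq_iff)
  then have "even (T - S)"
  proof -
    have "odd (int p)" using p_mod_4 by presburger
    moreover have "even (T\<^sup>2 + int p * S\<^sup>2)" using \<open>T\<^sup>2 + int p * S\<^sup>2 = 4 * m\<close> by simp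
    ultimately show ?thesis by simp
  qed
  then obtain u where u: "T - S = 2 * u" by (elim evenE)
  have "z = elt u S"
  proof -
    have xT: "x = of_int T / 2" and yS: "y = of_int S / 2" using T S by (auto simp: field_simps)
    have "T = S + 2 * u" using u by simp
    then show ?thesis unfolding z elt_def \<omega>_def xT yS
      by (simp add: of_rat_divide of_rat_add of_rat_mult field_simps)
  qed
  then show ?thesis by blast
qed

section \<open>Arithmetic in the basis 1, \<open>\<omega>\<close>\<close>

lemma omega_square: "\<omega> * \<omega> = \<omega> - of_int c0"
proof -
  have "4 * (\<omega> * \<omega>) = 1 + 2 * rt + rt * rt" by (simp add: \<omega>_def algebra_simps)
  also have "\<dots> = 2 * (1 + rt) - of_int (4 * c0)" unfolding rt_square c0 by simp
  also have "\<dots> = 4 * (\<omega> - of_int c0)" by (simp add: \<omega>_def)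
  finally show ?thesis by (simp only: mult_cancel_left) simp
qed

lemma Re_omega: "Re \<omega> = 1 / 2" and Im_omega: "Im \<omega> = sqrt (real p) / 2"
  by (simp_all add: \<omega>_def rt_def)

lemma cnj_omega: "cnj \<omega> = 1 - \<omega>"
  by (simp add: complex_eq_iff Re_omega)

lemma sqrt_p_pos: "sqrt (real p) > 0"
  using p_gt_3 by simp

lemma elt_eq_iff [simp]: "elt x y = elt u v \<longleftrightarrow> x = u \<and> y = v"
proof
  assume "elt x y = elt u v"
  then have "Im (elt x y) = Im (elt u v)" "Re (elt x y) = Re (elt u v)" by simp_all
  then show "x = u \<and> y = v" using sqrt_p_pos by (simp add: elt_def Re_omega Im_omega)
qed simp

lemma elt_add: "elt x y + elt u v = elt (x + u) (y + v)"
  by (simp add: elt_def algebra_simps)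

lemma elt_minus: "- elt x y = elt (- x) (- y)"
  by (simp add: elt_def)

lemma elt_mult: "elt x y * elt u v = elt (x * u - c0 * (y * v)) (x * v + y * u + y * v)"
proof -
  have "elt x y * elt u v = of_int (x * u) + of_int (x * v + y * u) * \<omega> + of_int (y * v) * (\<omega> * \<omega>)"
    by (simp add: elt_def algebra_simps)
  then show ?thesis unfolding omega_square by (simp add: elt_def algebra_simps)
qed

lemma elt_0: "0 = elt 0 0" and elt_1: "1 = elt 1 0"
  and elt_of_int: "of_int x = elt x 0"
  by (simp_all add: elt_def)

lemma elt_eq_0_iff [simp]: "elt x y = 0 \<longleftrightarrow> x = 0 \<and> y = 0"
  unfolding elt_0 by simp

lemma cnj_elt: "cnj (elt x y) = elt (x + y) (- y)"
  by (simp add: elt_def cnj_omega algebra_simps)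

definition nrm :: "int \<Rightarrow> int \<Rightarrow> int" where "nrm x y = x\<^sup>2 + x * y + c0 * y\<^sup>2"

lemma elt_mult_cnj: "elt x y * cnj (elt x y) = of_int (nrm x y)"
  unfolding cnj_elt elt_mult by (simp add: elt_of_int nrm_def power2_eq_square algebra_simps)

lemma cmod_elt: "(cmod (elt x y))\<^sup>2 = of_int (nrm x y)"
proof -
  have "complex_of_real ((cmod (elt x y))\<^sup>2) = of_real (of_int (nrm x y))"
    using elt_mult_cnj[of x y] complex_norm_square[of "elt x y"] by simp
  then show ?thesis by (simp only: of_real_eq_iff)
qed

lemma carrier_R: "carrier R = {elt x y | x y. True}"
proof (intro equalityI subsetI)
  fix z assume "z \<in> {elt x y | x y. True}"
  then obtain x y where z: "z = elt x y" by blast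
  have "z = of_rat (of_int x + of_int y / 2) + of_rat (of_int y / 2) * csqrt (of_int (- int p))"
    unfolding z elt_def csqrt_eq \<omega>_def
    by (simp add: of_rat_add of_rat_divide of_rat_mult field_simps)
  then have "z \<in> K" unfolding quadratic_field_def by blast
  moreover have "algebraic_int z"
  proof (rule algebraic_int.intros)
    \<comment> \<open>The characteristic polynomial: \<open>2 * x + y\<close> is the trace of
      \<open>z\<close> and \<open>nrm x y\<close> its norm.\<close>
    let ?P = "[:of_int (nrm x y), - of_int (2 * x + y), 1:] :: complex poly"
    show "lead_coeff ?P = 1" by simp
    show "\<forall>i. poly.coeff ?P i \<in> \<int>"
      by (auto simp: coeff_pCons split: nat.splits)
    have "poly ?P z = of_int (nrm x y) - z * of_int (2 * x + y) + z * z" by (simp add: algebra_simps)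
    also have "\<dots> = 0" unfolding z elt_of_int elt_mult elt_add diff_conv_add_uminus elt_minus
      by (simp add: elt_mult elt_minus elt_add nrm_def power2_eq_square algebra_simps)
    finally show "poly ?P z = 0" .
  qed
  ultimately show "z \<in> carrier R" by (simp add: ring_of_integers_def)
next
  fix z assume "z \<in> carrier R"
  then show "z \<in> {elt x y | x y. True}"
    using algebraic_int_imp_elt[of z] by (auto simp: ring_of_integers_def)
qed

lemma elt_in_R [simp]: "elt x y \<in> carrier R"
  by (auto simp: carrier_R)

lemma R_simps [simp]: "x \<otimes>\<^bsub>R\<^esub> y = x * y" "\<one>\<^bsub>R\<^esub> = 1" "\<zero>\<^bsub>R\<^esub> = 0" "x \<oplus>\<^bsub>R\<^esub> y = x + y"
  by (simp_all add: ring_of_integers_def)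

lemma R_add: "x \<in> carrier R \<Longrightarrow> y \<in> carrier R \<Longrightarrow> x + y \<in> carrier R"
  by (auto simp: carrier_R elt_add)

lemma R_mult: "x \<in> carrier R \<Longrightarrow> y \<in> carrier R \<Longrightarrow> x * y \<in> carrier R"
  unfolding carrier_R using elt_mult by blast

lemma R_of_int: "of_int x \<in> carrier R"
  by (simp add: elt_of_int)

lemma R_cnj: "x \<in> carrier R \<Longrightarrow> cnj x \<in> carrier R"
  by (auto simp: carrier_R cnj_elt)

lemma domain_R: "domain R"
proof (rule domainI)
  show "cring R"
  proof (rule cringI)
    show "abelian_group R"
    proof (rule abelian_groupI)
      fix x assume x: "x \<in> carrier R"
      then have "- x \<in> carrier R" by (auto simp: carrier_R elt_minus)
      then show "\<exists>y\<in>carrier R. y \<oplus>\<^bsub>R\<^esub> x = \<zero>\<^bsub>R\<^esub>" by (intro bexI[of _ "- x"]) auto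
    qed (auto simp: R_add elt_0)
    show "comm_monoid R"
      by (rule comm_monoidI) (auto simp: R_mult elt_1)
  qed (simp add: algebra_simps)
qed auto

section \<open>Ideals in Hermite normal form\<close>

lemma ideal_R_iff:
  "ideal I R \<longleftrightarrow> I \<subseteq> carrier R \<and> 0 \<in> I \<and> (\<forall>x\<in>I. \<forall>y\<in>I. x + y \<in> I) \<and>
    (\<forall>x\<in>I. \<forall>y\<in>carrier R. y * x \<in> I)"
proof
  assume "ideal I R"
  then interpret ideal I R .
  show "I \<subseteq> carrier R \<and> 0 \<in> I \<and> (\<forall>x\<in>I. \<forall>y\<in>I. x + y \<in> I) \<and> (\<forall>x\<in>I. \<forall>y\<in>carrier R. y * x \<in> I)"
    using a_subset additive_subgroup.zero_closed[OF is_additive_subgroup]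
      additive_subgroup.a_closed[OF is_additive_subgroup] I_l_closed by auto
next
  assume I: "I \<subseteq> carrier R \<and> 0 \<in> I \<and> (\<forall>x\<in>I. \<forall>y\<in>I. x + y \<in> I) \<and> (\<forall>x\<in>I. \<forall>y\<in>carrier R. y * x \<in> I)"
  interpret domain R by (rule domain_R)
  show "ideal I R"
  proof (rule idealI)
    show "ring R" ..
    show "subgroup I (add_monoid R)"
    proof (rule add.subgroupI)
      fix x assume x: "x \<in> I"
      have "- 1 \<in> carrier R" by (simp add: elt_1 elt_minus)
      then have m: "- 1 * x \<in> I" using x I by blast
      have "\<ominus>\<^bsub>R\<^esub> x = - x"
        using x I m by (intro minus_equality) auto
      then show "\<ominus>\<^bsub>R\<^esub> x \<in> I" using m by simp
    qed (use I in auto)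
  qed (use I in \<open>auto simp: mult.commute\<close>)
qed

text \<open>The norm of \<open>k + \<omega>\<close>. Since
  \<open>\<omega> * (k + \<omega>) = (k + 1) * (k + \<omega>) - P k\<close>, the lattice spanned by
  \<open>a\<close> and \<open>k + \<omega>\<close> is an ideal precisely when \<open>a\<close>
  divides \<open>P k\<close>.\<close>

definition P :: "int \<Rightarrow> int" where "P k = k\<^sup>2 + k + c0"

lemma four_P: "4 * P k = (2 * k + 1)\<^sup>2 + int p"
  using c0 by (simp add: P_def power2_eq_square algebra_simps)

lemma P_pos: "P k > 0"
  using four_P[of k] zero_le_power2[of "2 * k + 1"] p_gt_3 by linarith

text \<open>The passage from ideals to quadratic forms: the form on the right has discriminant
  \<open>(2 * k + 1)^2 - 4 * a * c = - p\<close> by \<open>four_P\<close>.\<close>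

lemma nrm_ideal_basis: "a * c = P k \<Longrightarrow>
  nrm (a * x + k * y) y = a * (a * x\<^sup>2 + (2 * k + 1) * x * y + c * y\<^sup>2)"
proof -
  assume "a * c = P k"
  have "nrm (a * x + k * y) y = a * (a * x\<^sup>2 + (2 * k + 1) * x * y) + P k * y\<^sup>2"
    by (simp add: nrm_def P_def power2_eq_square algebra_simps)
  then show ?thesis by (simp add: \<open>a * c = P k\<close>[symmetric] algebra_simps)
qed

text \<open>
  The ideal \<open>g (\<int> a + \<int> (k + \<omega>))\<close>, whose norm is \<open>g\<^sup>2 a\<close>; every nonzero ideal has this form (Hermite normal form).
\<close>

definition idl :: "int \<Rightarrow> int \<Rightarrow> int \<Rightarrow> complex set" where
  "idl g a k = {elt (g * (a * x + k * y)) (g * y) | x y. True}"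

text \<open>Normalising \<open>k\<close> to a residue modulo \<open>a\<close> makes the triple
  unique for its ideal.\<close>

definition valid :: "int \<Rightarrow> int \<Rightarrow> int \<Rightarrow> bool" where
  "valid g a k \<longleftrightarrow> g > 0 \<and> a > 0 \<and> 0 \<le> k \<and> k < a \<and> a dvd P k"

lemma elt_in_idl_iff: "g > 0 \<Longrightarrow> elt u v \<in> idl g a k \<longleftrightarrow> g dvd v \<and> g * a dvd u - k * v"
proof
  assume "g > 0" and "g dvd v \<and> g * a dvd u - k * v"
  then obtain y x where "v = g * y" "u - k * v = g * a * x" by (auto elim!: dvdE)
  then have "v = g * y" "u = g * (a * x + k * y)" by (auto simp: algebra_simps)
  then show "elt u v \<in> idl g a k" by (auto simp: idl_def)
next
  assume "elt u v \<in> idl g a k"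
  then obtain x y where "u = g * (a * x + k * y)" "v = g * y" by (auto simp: idl_def)
  then show "g dvd v \<and> g * a dvd u - k * v" by (simp add: algebra_simps)
qed

lemma idl_subset: "idl g a k \<subseteq> carrier R"
  by (auto simp: idl_def)

lemma idl_ideal:
  assumes "g > 0" "a > 0" "a dvd P k"
  shows "idl g a k \<in> nonzero_ideals R"
proof -
  obtain c where c: "P k = a * c" using assms(3) by (elim dvdE)
  have "ideal (idl g a k) R"
    unfolding ideal_R_iff
  proof (intro conjI ballI idl_subset)
    show "0 \<in> idl g a k" using assms by (simp add: elt_0 elt_in_idl_iff del: elt_eq_0_iff)
    show "z + w \<in> idl g a k" if "z \<in> idl g a k" "w \<in> idl g a k" for z w
    proof -
      obtain x y x' y' where "z = elt (g * (a * x + k * y)) (g * y)" "w = elt (g * (a * x' + k * y')) (g * y')"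
        using \<open>z \<in> idl g a k\<close> \<open>w \<in> idl g a k\<close> unfolding idl_def by blast
      then have "z + w = elt (g * (a * (x + x') + k * (y + y'))) (g * (y + y'))"
        by (simp add: elt_add algebra_simps)
      then show ?thesis unfolding idl_def by blast
    qed
    show "w * z \<in> idl g a k" if "z \<in> idl g a k" "w \<in> carrier R" for z w
    proof -
      obtain x y u v where zw: "z = elt (g * (a * x + k * y)) (g * y)" "w = elt u v"
        using \<open>z \<in> idl g a k\<close> \<open>w \<in> carrier R\<close> unfolding idl_def carrier_R by blast
      \<comment> \<open>Coordinates of the product in the basis of the ideal, up to the factor
        \<open>g\<close>; they are integral once \<open>c0\<close> is written as
        \<open>a * c - k * k - k\<close>.\<close>
      define Y where "Y = u * y + v * (a * x + k * y) + v * y"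
      define X where "X = u * x - c * v * y - k * v * x"
      have c0: "c0 = a * c - k * k - k" using c by (simp add: P_def power2_eq_square)
      have "w * z = elt (g * (a * X + k * Y)) (g * Y)"
        unfolding zw elt_mult elt_eq_iff X_def Y_def c0 by (simp add: algebra_simps)
      then show ?thesis unfolding idl_def by blast
    qed
  qed
  have "elt (g * a) 0 \<in> idl g a k" using assms by (simp add: elt_in_idl_iff)
  moreover have "elt (g * a) 0 \<noteq> 0" using assms by simp
  ultimately have "idl g a k \<noteq> {0}" by blast
  with \<open>ideal (idl g a k) R\<close> show ?thesis by (simp add: nonzero_ideals_def)
qed

lemma int_subgroup_generator:
  fixes S :: "int set"
  assumes "x \<in> S" "x \<noteq> 0" and diff: "\<And>x y. x \<in> S \<Longrightarrow> y \<in> S \<Longrightarrow> x - y \<in> S"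
  obtains d where "d > 0" "d \<in> S" "\<And>x. x \<in> S \<Longrightarrow> d dvd x"
proof -
  have z: "0 \<in> S" using diff[OF assms(1,1)] by simp
  have neg: "- y \<in> S" if "y \<in> S" for y using diff[OF z that] by simp
  have ex: "\<exists>n. n > 0 \<and> int n \<in> S"
    using assms(1,2) neg[OF assms(1)] by (intro exI[of _ "nat \<bar>x\<bar>"]) (auto simp: abs_if)
  define n where "n = (LEAST n. n > 0 \<and> int n \<in> S)"
  have n: "n > 0" "int n \<in> S" using LeastI_ex[OF ex] by (auto simp: n_def)
  have least: "\<not> (m > 0 \<and> int m \<in> S)" if "m < n" for m using that not_less_Least unfolding n_def by blast
  have mult: "int n * q \<in> S" for q :: int
  proof -
    have "int n * int k \<in> S" for k
    proof (induction k)
      case (Suc k)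
      then show ?case using diff[OF Suc neg[OF n(2)]] by (simp add: algebra_simps)
    qed (use z in simp)
    then show ?thesis using neg[of "int n * int _"] by (cases q rule: int_cases2) (simp_all only: mult_minus_right)
  qed
  have "int n dvd y" if y: "y \<in> S" for y
  proof -
    have "y - int n * (y div int n) \<in> S" by (rule diff[OF y mult])
    then have "y mod int n \<in> S" by (simp add: minus_mult_div_eq_mod)
    then have "nat (y mod int n) > 0 \<longrightarrow> \<not> nat (y mod int n) < n" using least[of "nat (y mod int n)"] n by auto
    then have "y mod int n = 0" using n by (smt (verit) nat_less_iff of_nat_0_less_iff pos_mod_bound pos_mod_sign zero_less_nat_eq)
    then show ?thesis by auto
  qed
  then show ?thesis using that[of "int n"] n by simp
qed

text \<open>\<open>g\<close> generates the group of \<open>\<omega>\<close>-coordinates of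
  \<open>I\<close>, and \<open>A\<close> the integers in \<open>I\<close>. Closure under
  \<open>\<omega>\<close> forces \<open>g\<close> to divide \<open>A\<close> as well as the first
  coordinate of an element with \<open>\<omega>\<close>-coordinate \<open>g\<close>, so that
  \<open>g\<close> splits off.\<close>

lemma nonzero_ideal_eq_idl:
  assumes "I \<in> nonzero_ideals R"
  shows "\<exists>g a k. valid g a k \<and> I = idl g a k"
proof -
  have id: "I \<subseteq> carrier R" "0 \<in> I" "\<And>x y. x \<in> I \<Longrightarrow> y \<in> I \<Longrightarrow> x + y \<in> I"
    "\<And>x y. x \<in> I \<Longrightarrow> y \<in> carrier R \<Longrightarrow> y * x \<in> I" and "I \<noteq> {0}"
    using assms by (auto simp: nonzero_ideals_def ideal_R_iff)
  have diff: "x - y \<in> I" if "x \<in> I" "y \<in> I" for x y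
  proof -
    have "- 1 \<in> carrier R" by (simp add: elt_1 elt_minus)
    from id(3)[OF that(1) id(4)[OF that(2) this]] show ?thesis by simp
  qed
  obtain z where z: "z \<in> I" "z \<noteq> 0" using \<open>I \<noteq> {0}\<close> id(2) by blast
  obtain zx zy where zxy: "z = elt zx zy" using z(1) id(1) unfolding carrier_R by blast
  define M where "M = nrm zx zy"
  \<comment> \<open>The product with the conjugate puts a nonzero integer into \<open>I\<close>, so
    both coordinate groups are nontrivial.\<close>
  have "of_int M \<in> I"
    using id(4)[OF z(1) R_cnj[of z]] z(1) id(1) elt_mult_cnj[of zx zy]
    by (auto simp: M_def zxy mult.commute)
  then have M: "elt M 0 \<in> I" by (simp add: elt_of_int)
  have "of_int M = (cmod z)\<^sup>2" unfolding zxy M_def by (simp add: cmod_elt)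
  then have "M \<noteq> 0" using z(2) by auto
  have "elt 0 M \<in> I" using id(4)[OF M elt_in_R[of 0 1]] by (simp add: elt_mult)
  define Y where "Y = {y. \<exists>x. elt x y \<in> I}"
  define X where "X = {x. elt x 0 \<in> I}"
  have "M \<in> Y" using \<open>elt 0 M \<in> I\<close> by (auto simp: Y_def)
  moreover have "x - y \<in> Y" if "x \<in> Y" "y \<in> Y" for x y
  proof -
    obtain u v where "elt u x \<in> I" "elt v y \<in> I" using \<open>x \<in> Y\<close> \<open>y \<in> Y\<close> by (auto simp: Y_def)
    then have "elt u x - elt v y \<in> I" by (rule diff)
    then show ?thesis unfolding Y_def diff_conv_add_uminus elt_minus elt_add by auto
  qed
  ultimately obtain g where g: "g > 0" "g \<in> Y" "\<And>x. x \<in> Y \<Longrightarrow> g dvd x"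
    using int_subgroup_generator[of M Y] \<open>M \<noteq> 0\<close> by blast
  have "M \<in> X" using M by (simp add: X_def)
  moreover have "x - y \<in> X" if "x \<in> X" "y \<in> X" for x y
  proof -
    have "elt x 0 - elt y 0 \<in> I" using that unfolding X_def by (intro diff) auto
    then show ?thesis unfolding X_def diff_conv_add_uminus elt_minus elt_add by simp
  qed
  ultimately obtain A where A: "A > 0" "A \<in> X" "\<And>x. x \<in> X \<Longrightarrow> A dvd x"
    using int_subgroup_generator[of M X] \<open>M \<noteq> 0\<close> by blast
  obtain k0 where k0: "elt k0 g \<in> I" using g(2) by (auto simp: Y_def)
  have "elt 0 A \<in> I" using A(2) id(4)[of "elt A 0" "elt 0 1"] by (simp add: X_def elt_mult)
  then have "A \<in> Y" by (auto simp: Y_def)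
  then obtain a where a: "A = g * a" using g(3) by (auto elim: dvdE)
  have "elt 0 1 * elt k0 g \<in> I" using id(4)[OF k0] by simp
  then have "k0 + g \<in> Y" unfolding elt_mult by (auto simp: Y_def)
  then have "g dvd k0" using g(3)[of "k0 + g"] by simp
  then obtain k1 where k1: "k0 = g * k1" by (elim dvdE)
  have a_pos: "a > 0" using A(1) g(1) a by (simp add: zero_less_mult_iff)
  define k where "k = k1 mod a"
  have "I = idl g a k"
  proof (intro equalityI subsetI)
    fix w assume w: "w \<in> I"
    obtain u v where uv: "w = elt u v" using w id(1) unfolding carrier_R by blast
    then have "v \<in> Y" using w by (auto simp: Y_def)
    then obtain y where y: "v = g * y" using g(3) by (auto elim: dvdE)
    have "elt y 0 * elt k0 g \<in> I" using id(4)[OF k0] by simp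
    then have "w - elt y 0 * elt k0 g \<in> I" using w by (intro diff)
    then have "u - k0 * y \<in> X" unfolding X_def uv elt_mult diff_conv_add_uminus elt_minus elt_add y
      by (simp add: algebra_simps)
    then have "g * a dvd u - k0 * y" using A(3) a by blast
    moreover have "u - k * v = (u - k0 * y) + g * a * (k1 div a * y)"
    proof -
      have "k1 = a * (k1 div a) + k" by (simp add: k_def)
      then have "k0 = g * (a * (k1 div a) + k)" using k1 by simp
      then show ?thesis using y by (simp add: algebra_simps)
    qed
    ultimately have "g * a dvd u - k * v" by (simp only: dvd_add dvd_triv_left)
    then show "w \<in> idl g a k" using g(1) y by (simp add: uv elt_in_idl_iff)
  next
    fix w assume "w \<in> idl g a k"
    then obtain x y where w: "w = elt (g * (a * x + k * y)) (g * y)" by (auto simp: idl_def)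
    have "elt (x - (k1 div a) * y) 0 * elt A 0 + elt y 0 * elt k0 g \<in> I"
      using A(2) k0 by (intro id(3) id(4)) (auto simp: X_def)
    moreover have "k1 = a * (k1 div a) + k" by (simp add: k_def)
    then have "k0 = g * (a * (k1 div a) + k)" using k1 by simp
    then have "elt (x - (k1 div a) * y) 0 * elt A 0 + elt y 0 * elt k0 g = w"
      unfolding elt_mult elt_add w a by (simp add: algebra_simps)
    ultimately show "w \<in> I" by simp
  qed
  moreover have "valid g a k"
  proof -
    \<comment> \<open>The first factor is the conjugate of \<open>k + \<omega>\<close>, so the
      product is the integer \<open>g * P k\<close>.\<close>
    have "elt (k + 1) (- 1) * elt (g * k) g \<in> idl g a k"
    proof -
      have "elt (g * k) g \<in> idl g a k" using g(1) by (simp add: elt_in_idl_iff)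
      then show ?thesis using \<open>I = idl g a k\<close> id(4) by simp
    qed
    then have "elt (g * P k) 0 \<in> idl g a k"
      unfolding elt_mult by (simp add: P_def power2_eq_square algebra_simps)
    then have "a dvd P k" using g(1) by (simp add: elt_in_idl_iff)
    then show ?thesis using g(1) a_pos by (simp add: valid_def k_def)
  qed
  ultimately show ?thesis by blast
qed

lemma idl_inj:
  assumes v: "valid g a k" "valid g' a' k'" and eq: "idl g a k = idl g' a' k'"
  shows "g = g' \<and> a = a' \<and> k = k'"
proof -
  have pos: "g > 0" "g' > 0" "a > 0" "a' > 0" using v by (auto simp: valid_def)
  have "elt (g * k) g \<in> idl g a k" "elt (g' * k') g' \<in> idl g' a' k'" using pos by (auto simp: elt_in_idl_iff)
  then have "elt (g * k) g \<in> idl g' a' k'" "elt (g' * k') g' \<in> idl g a k" by (simp_all add: eq)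
  then have 1: "g' dvd g" "g dvd g'" "g' * a' dvd g * k - k' * g"
    using pos by (auto simp: elt_in_idl_iff)
  then have g: "g = g'" using pos by (simp add: zdvd_antisym_nonneg)
  have "elt (g * a) 0 \<in> idl g a k" "elt (g' * a') 0 \<in> idl g' a' k'" using pos by (auto simp: elt_in_idl_iff)
  then have "elt (g * a) 0 \<in> idl g' a' k'" "elt (g' * a') 0 \<in> idl g a k" by (simp_all add: eq)
  then have "g' * a' dvd g * a" "g * a dvd g' * a'" using pos by (auto simp: elt_in_idl_iff)
  then have a: "a = a'" using pos g by (simp add: zdvd_antisym_nonneg)
  have "g * a dvd g * (k - k')" using 1(3) g a by (simp add: algebra_simps)
  then have "a dvd k - k'" using pos by simp
  then have "k mod a = k' mod a" by (simp add: mod_eq_dvd_iff)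
  then have "k = k'" using v a by (simp add: valid_def)
  then show ?thesis using g a by simp
qed

section \<open>Covolumes, units and multipliers\<close>

definition latt :: "complex \<Rightarrow> complex \<Rightarrow> complex set" where
  "latt \<alpha> \<beta> = {of_int x * \<alpha> + of_int y * \<beta> | x y. True}"

lemma Im_of_real_mult: "Im (of_real r * z) = r * Im z"
  by simp

text \<open>The signed area of the parallelogram spanned by \<open>\<alpha>\<close> and
  \<open>\<beta>\<close>.\<close>

definition covol :: "complex \<Rightarrow> complex \<Rightarrow> real" where
  "covol \<alpha> \<beta> = Im (cnj \<alpha> * \<beta>)"

lemma covol_combination:
  "covol (of_int x * \<alpha> + of_int y * \<beta>) (of_int z * \<alpha> + of_int t * \<beta>) = of_int (x * t - y * z) * covol \<alpha> \<beta>"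
  by (simp add: covol_def algebra_simps)

text \<open>Either basis is an integral combination of the other, so the two nonzero areas are
  integral multiples of each other.\<close>

lemma abs_covol_eq:
  assumes "latt \<alpha> \<beta> = latt \<alpha>' \<beta>'" "covol \<alpha> \<beta> \<noteq> 0"
  shows "\<bar>covol \<alpha> \<beta>\<bar> = \<bar>covol \<alpha>' \<beta>'\<bar>"
proof -
  have mem: "\<alpha> \<in> latt \<alpha> \<beta>" "\<beta> \<in> latt \<alpha> \<beta>" for \<alpha> \<beta>
    unfolding latt_def by (rule CollectI, rule exI[of _ 1], rule exI[of _ 0], simp,
      rule CollectI, rule exI[of _ 0], rule exI[of _ 1], simp)
  have int: "\<exists>m :: int. covol \<gamma> \<delta> = of_int m * covol \<alpha> \<beta>" if "\<gamma> \<in> latt \<alpha> \<beta>" "\<delta> \<in> latt \<alpha> \<beta>" for \<alpha> \<beta> \<gamma> \<delta>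
    using that covol_combination unfolding latt_def by blast
  obtain m where m: "covol \<alpha>' \<beta>' = of_int m * covol \<alpha> \<beta>" using int mem assms(1) by metis
  obtain l where l: "covol \<alpha> \<beta> = of_int l * covol \<alpha>' \<beta>'" using int mem assms(1) by metis
  have "real_of_int (l * m) = 1" using m l assms(2) by (simp add: mult.commute)
  then have "l * m = 1" by (simp only: of_int_eq_1_iff)
  then have "\<bar>m\<bar> = 1" by (metis abs_1 zmult_eq_1_iff abs_minus_cancel)
  then have "\<bar>real_of_int m\<bar> = 1" by linarith
  then show ?thesis using m by (simp add: abs_mult)
qed

lemma idl_eq_latt: "idl g a k = latt (elt (g * a) 0) (elt (g * k) g)"
proof -
  have "of_int x * elt (g * a) 0 + of_int y * elt (g * k) g = elt (g * (a * x + k * y)) (g * y)" for x y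
    unfolding elt_of_int elt_mult elt_add by (simp add: algebra_simps)
  then show ?thesis by (auto simp: idl_def latt_def)
qed

lemma covol_idl: "covol (elt (g * a) 0) (elt (g * k) g) = of_int (g\<^sup>2 * a) * (sqrt (real p) / 2)"
  by (simp add: covol_def elt_def Im_omega power2_eq_square)

text \<open>Multiplication by \<open>\<mu>\<close> scales areas by its squared modulus, and the area
  of \<open>idl g a k\<close> is its norm times \<open>sqrt p / 2\<close>. This stands in for
  multiplicativity of the ideal norm.\<close>

lemma scaled_idl_norm:
  assumes "valid g a k" "b > 0" "idl g a k = (\<lambda>x. \<mu> * x) ` idl 1 b l" "\<mu> \<noteq> 0"
  shows "real_of_int (g\<^sup>2 * a) = (cmod \<mu>)\<^sup>2 * of_int b"
proof -
  let ?s = "sqrt (real p) / 2"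
  have s: "?s > 0" using sqrt_p_pos by simp
  have "(\<lambda>x. \<mu> * x) ` latt \<alpha> \<beta> = latt (\<mu> * \<alpha>) (\<mu> * \<beta>)" for \<alpha> \<beta>
  proof -
    have "\<mu> * (of_int x * \<alpha> + of_int y * \<beta>) = of_int x * (\<mu> * \<alpha>) + of_int y * (\<mu> * \<beta>)" for x y
      by (simp add: algebra_simps)
    then show ?thesis unfolding latt_def by (auto simp: image_iff) metis
  qed
  then have "latt (elt (g * a) 0) (elt (g * k) g) = latt (\<mu> * elt b 0) (\<mu> * elt l 1)"
    using assms(3) idl_eq_latt[of 1 b l] idl_eq_latt[of g a k] by simp
  moreover have "covol (elt (g * a) 0) (elt (g * k) g) \<noteq> 0"
    unfolding covol_idl using assms(1) s by (simp add: valid_def)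
  ultimately have "\<bar>covol (elt (g * a) 0) (elt (g * k) g)\<bar> = \<bar>covol (\<mu> * elt b 0) (\<mu> * elt l 1)\<bar>"
    by (rule abs_covol_eq)
  also have "covol (\<mu> * elt b 0) (\<mu> * elt l 1) = (cmod \<mu>)\<^sup>2 * covol (elt b 0) (elt l 1)"
  proof -
    have "cnj (\<mu> * elt b 0) * (\<mu> * elt l 1) = (\<mu> * cnj \<mu>) * (cnj (elt b 0) * elt l 1)"
      by (simp add: ac_simps)
    also have "\<mu> * cnj \<mu> = of_real ((cmod \<mu>)\<^sup>2)" by (simp only: complex_norm_square)
    finally show ?thesis
      unfolding covol_def by (simp only: Im_of_real_mult)
  qed
  also have "covol (elt b 0) (elt l 1) = of_int b * ?s"
    using covol_idl[of 1 b l] by simp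
  finally have "of_int (g\<^sup>2 * a) * ?s = ((cmod \<mu>)\<^sup>2 * of_int b) * ?s"
    unfolding covol_idl using assms(1,2) s by (simp add: valid_def abs_mult)
  then show ?thesis using s by simp
qed

text \<open>Four times the norm is \<open>(2 * x + y)^2 + p * y^2\<close>. It must equal 4 while
  \<open>p > 4\<close>, so \<open>y\<close> vanishes.\<close>

lemma unit_cases:
  assumes "z \<in> carrier R" "cmod z = 1"
  shows "z = 1 \<or> z = - 1"
proof -
  obtain x y where z: "z = elt x y" using assms(1) by (auto simp: carrier_R)
  have "real_of_int (nrm x y) = 1" using cmod_elt[of x y] assms(2) z by simp
  then have n: "nrm x y = 1" by simp
  have "4 * nrm x y = (2 * x + y)\<^sup>2 + int p * y\<^sup>2"
    using c0 by (simp add: nrm_def power2_eq_square algebra_simps)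
  then have eq: "(2 * x + y)\<^sup>2 + int p * y\<^sup>2 = 4" using n by simp
  have "y = 0"
  proof (rule ccontr)
    assume "y \<noteq> 0"
    then have "y\<^sup>2 \<ge> 1" by (simp add: int_one_le_iff_zero_less)
    then have "int p * 1 \<le> int p * y\<^sup>2" by (intro mult_left_mono) auto
    moreover have "p \<noteq> 4" using p_mod_4 by auto
    ultimately show False using eq p_gt_3 zero_le_power2[of "2 * x + y"] by linarith
  qed
  then have "x\<^sup>2 = 1" using n by (simp add: nrm_def)
  then show ?thesis using \<open>y = 0\<close> z by (auto simp: power2_eq_1_iff elt_def)
qed

text \<open>One half of the fact that the inverse of \<open>idl 1 a k\<close> is its conjugate
  divided by \<open>a\<close>; the other half is \<open>R_quotient_imp_idl\<close>.\<close>

lemma idl_mult_cnj: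
  assumes "a > 0" "a dvd P k" "w \<in> idl 1 a k" "w' \<in> idl 1 a k"
  shows "cnj w * w' / of_int a \<in> carrier R"
proof -
  obtain c where c: "P k = a * c" using assms(2) by (elim dvdE)
  have c0: "c0 = a * c - k * k - k" using c by (simp add: P_def power2_eq_square)
  obtain x y x' y' where w: "w = elt (a * x + k * y) y" "w' = elt (a * x' + k * y') y'"
    using assms(3,4) unfolding idl_def by auto
  define X where "X = a * x * x' + k * x * y' + (k + 1) * x' * y + c * y * y'"
  define Y where "Y = x * y' - x' * y"
  have "cnj w * w' = elt (a * X) (a * Y)"
    unfolding w cnj_elt elt_mult elt_eq_iff X_def Y_def c0 by (simp add: algebra_simps)
  also have "\<dots> = of_int a * elt X Y" by (simp add: elt_def algebra_simps)
  finally show ?thesis using assms(1) by simp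
qed

text \<open>The form with coefficients \<open>a\<close>, \<open>2 * k + 1\<close>, \<open>c\<close>
  is primitive, because the square of their gcd divides
  \<open>4 * a * c - (2 * k + 1)^2 = p\<close>. The products of \<open>\<mu>\<close> with the three
  coefficients are integral by stability and \<open>idl_mult_cnj\<close>, and an integral
  combination of them is \<open>\<mu>\<close>.\<close>

lemma multiplier_in_R:
  assumes "a > 0" "a dvd P k" and stable: "(\<lambda>x. \<mu> * x) ` idl 1 a k \<subseteq> idl 1 a k"
  shows "\<mu> \<in> carrier R"
proof -
  obtain c where c: "P k = a * c" using assms(2) by (elim dvdE)
  define d where "d = gcd a (gcd (2 * k + 1) c)"
  have "d dvd a" "d dvd 2 * k + 1" "d dvd c" 
    unfolding d_def by (meson dvd_trans gcd_dvd1 gcd_dvd2)+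
  then have "d\<^sup>2 dvd 4 * (a * c) - (2 * k + 1)\<^sup>2"
    by (simp add: power2_eq_square mult_dvd_mono dvd_diff)
  also have "4 * (a * c) - (2 * k + 1)\<^sup>2 = int p" using four_P[of k] c by simp
  finally have "d\<^sup>2 dvd int p" .
  moreover have "squarefree (int p)" using prime_p by (intro squarefree_prime_elem prime_imp_prime_elem) simp
  ultimately have "is_unit d" by (auto dest: squarefreeD)
  then have "d = 1" by (simp add: d_def)
  obtain u v where uv: "u * a + v * gcd (2 * k + 1) c = d" using bezout_int unfolding d_def by blast
  obtain v' w' where vw: "v' * (2 * k + 1) + w' * c = gcd (2 * k + 1) c" using bezout_int by blast
  have one: "1 = u * a + v * v' * (2 * k + 1) + v * w' * c"
    using uv \<open>d = 1\<close> unfolding vw[symmetric] by (simp add: algebra_simps)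
  have in1: "elt a 0 \<in> idl 1 a k" and in2: "elt k 1 \<in> idl 1 a k" by (simp_all add: elt_in_idl_iff)
  have s: "\<mu> * w \<in> idl 1 a k" if "w \<in> idl 1 a k" for w using stable that by blast
  have 1: "\<mu> * elt a 0 \<in> carrier R" "\<mu> * elt k 1 \<in> carrier R"
    using s[OF in1] s[OF in2] idl_subset by blast+
  have 2: "\<mu> * cnj (elt k 1) \<in> carrier R"
    using idl_mult_cnj[OF assms(1,2) in2 s[OF in1]] assms(1) by (simp add: elt_def ac_simps)
  have 3: "\<mu> * of_int c \<in> carrier R"
  proof -
    have "cnj (elt k 1) * (\<mu> * elt k 1) / of_int a = \<mu> * (elt k 1 * cnj (elt k 1)) / of_int a" by (simp add: ac_simps)
    also have "\<dots> = \<mu> * of_int c"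
      unfolding elt_mult_cnj using nrm_ideal_basis[OF c[symmetric], of 0 1] assms(1) by simp
    finally show ?thesis using idl_mult_cnj[OF assms(1,2) in2 s[OF in2]] by simp
  qed
  have "elt k 1 + cnj (elt k 1) = of_int (2 * k + 1)"
    unfolding cnj_elt elt_add elt_of_int by simp
  then have 4: "\<mu> * of_int (2 * k + 1) \<in> carrier R"
    using R_add[OF 1(2) 2] by (simp only: distrib_left[symmetric])
  have "\<mu> = \<mu> * of_int (u * a + v * v' * (2 * k + 1) + v * w' * c)" using one by simp
  also have "\<dots> = of_int u * (\<mu> * elt a 0) + of_int (v * v') * (\<mu> * of_int (2 * k + 1)) + of_int (v * w') * (\<mu> * of_int c)"
    by (simp add: elt_def algebra_simps)
  also have "\<dots> \<in> carrier R" by (intro R_add R_mult R_of_int 1 3 4)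
  finally show ?thesis .
qed

end

section \<open>Ideal classes and forms\<close>

lemma card_eq_2_mult_of_fibers:
  assumes "finite B" "f ` A = B" "\<And>b. b \<in> B \<Longrightarrow> card {a \<in> A. f a = b} = 2"
  shows "card A = 2 * card B"
proof -
  have "A = (\<Union>b\<in>B. {a \<in> A. f a = b})" using assms(2) by auto
  also have "card \<dots> = (\<Sum>b\<in>B. card {a \<in> A. f a = b})"
  proof (rule card_UN_disjoint)
    show "\<forall>b\<in>B. finite {a \<in> A. f a = b}" using assms(3) by (metis card.infinite zero_neq_numeral)
  qed (use assms(1) in auto)
  also have "\<dots> = 2 * card B" using assms(3) by simp
  finally show ?thesis .
qed

section \<open>Counting ideals of given norm in a class\<close>

context imag_quadratic
begin

definition ideals_norm :: "int \<Rightarrow> complex set set" where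
  "ideals_norm m = {idl g a k | g a k. valid g a k \<and> g\<^sup>2 * a = m}"

definition norm_triples :: "int \<Rightarrow> (int \<times> int \<times> int) set" where
  "norm_triples m = {(g, a, k). valid g a k \<and> g\<^sup>2 * a = m}"

lemma finite_norm_triples: "finite (norm_triples m)"
proof (rule finite_subset)
  show "norm_triples m \<subseteq> {0..m} \<times> {0..m} \<times> {0..m}"
  proof
    fix t assume "t \<in> norm_triples m"
    then obtain g a k where t: "t = (g, a, k)" and v: "g > 0" "a > 0" "0 \<le> k" "k < a" and m: "g\<^sup>2 * a = m"
      by (auto simp: norm_triples_def valid_def)
    have "g \<le> g\<^sup>2 * a" using v mult_mono[of 1 "g * a" g g] mult_mono[of 1 g 1 a]
      by (simp add: power2_eq_square ac_simps)
    moreover have "a \<le> g\<^sup>2 * a" using v by (simp add: mult_le_cancel_right1)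
    ultimately show "t \<in> {0..m} \<times> {0..m} \<times> {0..m}" using t v m by auto
  qed
qed simp

lemma ideals_norm_eq_image: "ideals_norm m = (\<lambda>(g, a, k). idl g a k) ` norm_triples m"
  by (auto simp: ideals_norm_def norm_triples_def image_iff)

lemma card_ideals_norm: "card (ideals_norm m) = card (norm_triples m)"
  unfolding ideals_norm_eq_image
  by (rule card_image) (auto simp: inj_on_def norm_triples_def dest: idl_inj)

lemma finite_ideals_norm: "finite (ideals_norm m)"
  unfolding ideals_norm_eq_image using finite_norm_triples by simp

lemma ideal_class_rel_R_iff:
  "(I, J) \<in> ideal_class_rel R \<longleftrightarrow> I \<in> nonzero_ideals R \<and> J \<in> nonzero_ideals R \<and>
    (\<exists>\<alpha>\<in>carrier R - {0}. \<exists>\<beta>\<in>carrier R - {0}. (\<lambda>x. \<alpha> * x) ` I = (\<lambda>x. \<beta> * x) ` J)"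
  by (simp add: ideal_class_rel_def)

lemma image_mult_div:
  assumes "(\<lambda>x. \<alpha> * x) ` I = (\<lambda>x. \<beta> * x) ` J" "\<beta> \<noteq> (0 :: complex)"
  shows "J = (\<lambda>x. \<alpha> / \<beta> * x) ` I"
proof -
  have "J = (\<lambda>x. 1 / \<beta> * x) ` (\<lambda>x. \<beta> * x) ` J" using assms(2) by (simp add: image_image)
  then show ?thesis unfolding assms(1)[symmetric] by (simp add: image_image)
qed

lemma scaled_idl_in_nonzero_ideals:
  assumes "J \<in> nonzero_ideals R" "\<mu> \<noteq> 0" "\<And>w. w \<in> J \<Longrightarrow> \<mu> * w \<in> carrier R"
  shows "(\<lambda>x. \<mu> * x) ` J \<in> nonzero_ideals R"
proof -
  have id: "J \<subseteq> carrier R" "0 \<in> J" "\<And>x y. x \<in> J \<Longrightarrow> y \<in> J \<Longrightarrow> x + y \<in> J"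
    "\<And>x y. x \<in> J \<Longrightarrow> y \<in> carrier R \<Longrightarrow> y * x \<in> J" and "J \<noteq> {0}"
    using assms(1) by (auto simp: nonzero_ideals_def ideal_R_iff)
  have "ideal ((\<lambda>x. \<mu> * x) ` J) R"
    unfolding ideal_R_iff
  proof (intro conjI ballI)
    show "(\<lambda>x. \<mu> * x) ` J \<subseteq> carrier R" using assms(3) by auto
    show "0 \<in> (\<lambda>x. \<mu> * x) ` J" using id(2) by (intro image_eqI[of _ _ 0]) auto
    fix x assume "x \<in> (\<lambda>x. \<mu> * x) ` J"
    then obtain w where w: "w \<in> J" "x = \<mu> * w" by auto
    show "x + y \<in> (\<lambda>x. \<mu> * x) ` J" if y: "y \<in> (\<lambda>x. \<mu> * x) ` J" for y
    proof -
      obtain v where "v \<in> J" "y = \<mu> * v" using y by auto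
      then show ?thesis using w id(3) by (intro image_eqI[of _ _ "w + v"]) (auto simp: algebra_simps)
    qed
    show "y * x \<in> (\<lambda>x. \<mu> * x) ` J" if "y \<in> carrier R" for y
      using w id(4) that by (intro image_eqI[of _ _ "y * w"]) auto
  qed
  moreover have "(\<lambda>x. \<mu> * x) ` J \<noteq> {0}"
  proof
    assume eq: "(\<lambda>x. \<mu> * x) ` J = {0}"
    obtain w where "w \<in> J" "w \<noteq> 0" using id(2) \<open>J \<noteq> {0}\<close> by blast
    then show False using eq assms(2) by (metis image_eqI mult_eq_0_iff singletonD)
  qed
  ultimately show ?thesis by (simp add: nonzero_ideals_def)
qed

text \<open>One coordinate of the integral quotient is exactly the divisibility by \<open>a\<close>
  that defines membership in \<open>idl 1 a k\<close>.\<close>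

lemma R_quotient_imp_idl:
  assumes "a > 0" "a dvd P k" "u \<in> carrier R" "u * elt k 1 / of_int a \<in> carrier R"
  shows "cnj u \<in> idl 1 a k"
proof -
  obtain r s where rs: "cnj u = elt r s" using R_cnj[OF assms(3)] by (auto simp: carrier_R)
  then have u: "u = elt (r + s) (- s)" by (metis cnj_elt complex_cnj_cnj)
  obtain X Y where XY: "u * elt k 1 / of_int a = elt X Y" using assms(4) by (auto simp: carrier_R)
  have "u * elt k 1 = of_int a * (u * elt k 1 / of_int a)" using assms(1) by simp
  then have "u * elt k 1 = of_int a * elt X Y" unfolding XY .
  then have "elt ((r + s) * k - c0 * (- s * 1)) ((r + s) * 1 + - s * k + - s * 1) = elt (a * X) (a * Y)"
    unfolding u elt_mult elt_of_int by simp
  then have "r - k * s = a * Y" by (simp add: algebra_simps)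
  then show ?thesis unfolding rs by (simp add: elt_in_idl_iff)
qed

text \<open>The quotient of the two factors stabilises the ideal and has modulus 1, so it is an
  integral unit, hence 1 or -1.\<close>

lemma idl_same_multiple:
  assumes a: "a > 0" "a dvd P k" and ne: "w \<noteq> 0" "w' \<noteq> 0" and n: "cmod w = cmod w'"
    and eq: "(\<lambda>x. cnj w / of_int a * x) ` idl 1 a k = (\<lambda>x. cnj w' / of_int a * x) ` idl 1 a k"
  shows "w = w' \<or> w = - w'"
proof -
  have "idl 1 a k = (\<lambda>x. (cnj w' / of_int a) / (cnj w / of_int a) * x) ` idl 1 a k"
    using a ne by (intro image_mult_div[OF eq[symmetric]]) auto
  then have "(\<lambda>x. (cnj w' / cnj w) * x) ` idl 1 a k \<subseteq> idl 1 a k" using a by simp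
  then have "cnj w' / cnj w \<in> carrier R" by (rule multiplier_in_R[OF a])
  moreover have "cmod (cnj w' / cnj w) = 1" using n ne by (simp add: norm_divide)
  ultimately have "cnj w' / cnj w = 1 \<or> cnj w' / cnj w = - 1" by (rule unit_cases)
  then have "cnj w' = cnj w \<or> cnj w' = - cnj w" using ne by (auto simp: divide_eq_eq)
  then show ?thesis by (metis complex_cnj_cnj complex_cnj_minus minus_minus)
qed

text \<open>
  Every ideal equivalent to \<open>J = idl 1 a k\<close> is \<open>(cnj w / a) J\<close> for some \<open>w \<in> J\<close>, unique up to sign,
  and its norm is \<open>N(w) / a\<close>, the value of the quadratic form attached to \<open>J\<close>.
\<close>

lemma card_representations_eq_ideals:
  assumes v: "valid 1 a k" and c: "a * c = P k" and m: "m > 0"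
  shows "card {(x, y). a * x\<^sup>2 + (2 * k + 1) * x * y + c * y\<^sup>2 = m} =
    2 * card {I \<in> ideals_norm m. (idl 1 a k, I) \<in> ideal_class_rel R}"
proof (rule card_eq_2_mult_of_fibers)
  let ?J = "idl 1 a k"
  let ?A = "{(x, y). a * x\<^sup>2 + (2 * k + 1) * x * y + c * y\<^sup>2 = m}"
  let ?B = "{I \<in> ideals_norm m. (?J, I) \<in> ideal_class_rel R}"
  define W where "W = (\<lambda>(x, y). elt (a * x + k * y) y)"
  define \<psi> where "\<psi> v = (\<lambda>z. cnj (W v) / of_int a * z) ` ?J" for v
  have a: "a > 0" "a dvd P k" using v by (auto simp: valid_def)
  have J: "?J \<in> nonzero_ideals R" using a by (intro idl_ideal) auto
  have W_norm: "(cmod (W (x, y)))\<^sup>2 = of_int (a * (a * x\<^sup>2 + (2 * k + 1) * x * y + c * y\<^sup>2))" for x y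
    unfolding W_def using nrm_ideal_basis[OF c, of x y] by (simp add: cmod_elt del: of_int_mult of_int_add)
  have W_J: "W v \<in> ?J" for v
    by (cases v) (auto simp: W_def elt_in_idl_iff)
  have W_norm_A: "(cmod (W v))\<^sup>2 = of_int (a * m)" if "v \<in> ?A" for v
    using that W_norm by (cases v) auto
  have W_A: "W v \<noteq> 0" if "v \<in> ?A" for v
    using W_norm_A[OF that] a m by auto
  have W_inj: "W v = W v' \<longleftrightarrow> v = v'" for v v' using a by (cases v; cases v') (auto simp: W_def)
  have W_minus: "W (- x, - y) = - W (x, y)" for x y by (simp add: W_def elt_minus algebra_simps)
  have psi_B: "\<psi> v \<in> ?B" if vA: "v \<in> ?A" for v
  proof -
    have nz: "cnj (W v) / of_int a \<noteq> 0" using W_A[OF vA] a by simp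
    have id: "\<psi> v \<in> nonzero_ideals R" unfolding \<psi>_def
    proof (rule scaled_idl_in_nonzero_ideals[OF J nz])
      fix w assume "w \<in> ?J"
      then show "cnj (W v) / of_int a * w \<in> carrier R"
        using idl_mult_cnj[OF a W_J, of w v] by simp
    qed
    then obtain g a' k' where g: "valid g a' k'" "\<psi> v = idl g a' k'" using nonzero_ideal_eq_idl by blast
    have "real_of_int (g\<^sup>2 * a') = (cmod (cnj (W v) / of_int a))\<^sup>2 * of_int a"
      using g(2) nz unfolding \<psi>_def by (intro scaled_idl_norm[OF g(1) a(1)]) auto
    also have "\<dots> = (cmod (W v))\<^sup>2 / of_int a"
      using a by (simp add: norm_divide power_divide power2_eq_square)
    also have "\<dots> = of_int m" using W_norm_A[OF vA] a by simp
    finally have "g\<^sup>2 * a' = m" by (simp only: of_int_eq_iff)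
    then have "\<psi> v \<in> ideals_norm m" using g by (auto simp: ideals_norm_def)
    moreover have "(?J, \<psi> v) \<in> ideal_class_rel R"
      unfolding ideal_class_rel_R_iff
    proof (intro conjI J id bexI)
      show "(\<lambda>x. cnj (W v) * x) ` ?J = (\<lambda>x. of_int a * x) ` \<psi> v"
        unfolding \<psi>_def image_image using a by (intro image_cong) auto
      show "cnj (W v) \<in> carrier R - {0}" "of_int a \<in> carrier R - {0}"
        using W_A[OF vA] R_cnj[of "W v"] subsetD[OF idl_subset W_J[of v]] a R_of_int by auto
    qed
    ultimately show ?thesis by simp
  qed
  show "finite ?B" using finite_ideals_norm by simp
  show "\<psi> ` ?A = ?B"
  proof (intro equalityI subsetI)
    fix I assume I: "I \<in> ?B"
    obtain g a' k' where g: "valid g a' k'" "g\<^sup>2 * a' = m" "I = idl g a' k'" using I by (auto simp: ideals_norm_def)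
    obtain \<alpha> \<beta> where ab: "\<alpha> \<noteq> 0" "\<beta> \<noteq> 0" "(\<lambda>x. \<alpha> * x) ` ?J = (\<lambda>x. \<beta> * x) ` I"
      using I unfolding mem_Collect_eq ideal_class_rel_R_iff by auto
    define \<mu> where "\<mu> = \<alpha> / \<beta>"
    have \<mu>: "\<mu> \<noteq> 0" "I = (\<lambda>x. \<mu> * x) ` ?J"
      using ab image_mult_div[OF ab(3,2)] by (auto simp: \<mu>_def)
    have IR: "I \<subseteq> carrier R" using g(3) idl_subset by simp
    \<comment> \<open>Obtained by solving \<open>cnj w / a = \<mu>\<close>. Membership of
      \<open>w\<close> in the ideal holds because \<open>\<mu>\<close> carries both generators
      \<open>a\<close> and \<open>k + \<omega>\<close> into \<open>carrier R\<close>.\<close>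
    define w where "w = cnj (\<mu> * of_int a)"
    have 1: "\<mu> * of_int a \<in> carrier R"
    proof -
      have "elt a 0 \<in> ?J" by (simp add: elt_in_idl_iff)
      then have "\<mu> * elt a 0 \<in> I" using \<mu> by blast
      then show ?thesis using IR by (auto simp: elt_of_int)
    qed
    have "elt k 1 \<in> ?J" by (simp add: elt_in_idl_iff)
    then have "\<mu> * elt k 1 \<in> carrier R" using \<mu> IR by blast
    then have "\<mu> * of_int a * elt k 1 / of_int a \<in> carrier R" using a by simp
    with 1 have "w \<in> ?J" unfolding w_def by (rule R_quotient_imp_idl[OF a])
    then obtain x y where xy: "w = W (x, y)" by (auto simp: idl_def W_def)
    have cw: "cnj w / of_int a = \<mu>" using a by (simp add: w_def)
    have "real_of_int (g\<^sup>2 * a') = (cmod \<mu>)\<^sup>2 * of_int a"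
      using g \<mu> a by (intro scaled_idl_norm) auto
    also have "\<dots> = (cmod w)\<^sup>2 / of_int a"
      using a unfolding cw[symmetric] by (simp add: norm_divide power_divide power2_eq_square)
    also have "\<dots> = of_int (a * x\<^sup>2 + (2 * k + 1) * x * y + c * y\<^sup>2)"
      unfolding xy W_norm using a by simp
    finally have "(x, y) \<in> ?A" using g(2) by (simp del: of_int_add of_int_mult)
    moreover have "I = \<psi> (x, y)" unfolding \<psi>_def xy[symmetric] cw using \<mu> by simp
    ultimately show "I \<in> \<psi> ` ?A" by blast
  qed (use psi_B in auto)
  show "card {v \<in> ?A. \<psi> v = I} = 2" if I: "I \<in> ?B" for I
  proof -
    obtain x y where xy: "(x, y) \<in> ?A" "\<psi> (x, y) = I" using I \<open>\<psi> ` ?A = ?B\<close> by (metis (no_types, lifting) imageE surj_pair)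
    have sub: "v \<in> {(x, y), (- x, - y)}" if "v \<in> ?A" "\<psi> v = I" for v
    proof -
      have "\<psi> v = \<psi> (x, y)" using that xy by simp
      moreover have "cmod (W v) = cmod (W (x, y))"
      proof -
        have "(cmod (W v))\<^sup>2 = (cmod (W (x, y)))\<^sup>2" using W_norm_A[OF that(1)] W_norm_A[OF xy(1)] by simp
        then show ?thesis by (simp add: power2_eq_iff_nonneg)
      qed
      ultimately have "W v = W (x, y) \<or> W v = - W (x, y)"
        using W_A[OF that(1)] W_A[OF xy(1)] unfolding \<psi>_def by (intro idl_same_multiple[OF a]) auto
      then show ?thesis unfolding W_minus[symmetric] W_inj by simp
    qed
    have "\<psi> (- x, - y) = \<psi> (x, y)"
    proof -
      have neg: "- z \<in> ?J" if z: "z \<in> ?J" for z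
      proof -
        have "ideal ?J R" "- 1 \<in> carrier R" using J by (simp_all add: nonzero_ideals_def elt_1 elt_minus)
        then have "- 1 * z \<in> ?J" using z unfolding ideal_R_iff by blast
        then show ?thesis by simp
      qed
      have "\<psi> (- x, - y) = (\<lambda>z. cnj (W (x, y)) / of_int a * z) ` uminus ` ?J"
        unfolding \<psi>_def W_minus image_image by simp
      also have "uminus ` ?J = ?J"
      proof (intro equalityI subsetI)
        fix z assume "z \<in> ?J"
        then show "z \<in> uminus ` ?J" using neg by (intro image_eqI[of _ _ "- z"]) auto
      qed (use neg in auto)
      finally show ?thesis unfolding \<psi>_def .
    qed
    then have "{v \<in> ?A. \<psi> v = I} = {(x, y), (- x, - y)}"
      using xy sub by auto
    \<comment> \<open>As \<open>m > 0\<close>, the origin is not a solution, so the fibre really has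
      two points.\<close>
    moreover have "(x, y) \<noteq> (- x, - y)" using xy(1) m by auto
    ultimately show ?thesis by simp
  qed
qed

section \<open>Reduction and finiteness of the class group\<close>

definition ideal_classes :: "complex set set set" where
  "ideal_classes = nonzero_ideals R // ideal_class_rel R"

lemma equiv_rel_R: "equiv (nonzero_ideals R) (ideal_class_rel R)"
  using domain_R by (rule domain.equiv_ideal_class_rel)

lemma class_eq_Image:
  "C \<in> ideal_classes \<Longrightarrow> I \<in> C \<Longrightarrow> C = ideal_class_rel R `` {I}"
proof -
  assume C: "C \<in> ideal_classes" and I: "I \<in> C"
  obtain J where J: "C = ideal_class_rel R `` {J}" using C unfolding ideal_classes_def by (elim quotientE)
  then have "(J, I) \<in> ideal_class_rel R" using I by simp
  then have "ideal_class_rel R `` {J} = ideal_class_rel R `` {I}" by (rule equiv_class_eq[OF equiv_rel_R])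
  then show ?thesis by (simp add: J)
qed

lemma idl_mod: "a > 0 \<Longrightarrow> idl g a (k mod a) = idl g a k"
proof -
  assume "a > 0"
  have "elt (g * (a * x + k mod a * y)) (g * y) = elt (g * (a * (x - k div a * y) + k * y)) (g * y)" for x y
    by (simp add: algebra_simps flip: minus_mult_div_eq_mod)
  moreover have "elt (g * (a * x + k * y)) (g * y) = elt (g * (a * (x + k div a * y) + k mod a * y)) (g * y)" for x y
    by (simp add: algebra_simps flip: minus_mult_div_eq_mod)
  ultimately show ?thesis unfolding idl_def by (intro equalityI subsetI) blast+
qed

lemma P_mod: "a > 0 \<Longrightarrow> b dvd a \<Longrightarrow> b dvd P (k mod a) \<longleftrightarrow> b dvd P k"
proof -
  assume "a > 0" "b dvd a"
  have "P (a * q + r) = P r + a * (q * (a * q + r + r + 1))" for q r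
    by (simp add: P_def power2_eq_square algebra_simps)
  from this[of "k div a" "k mod a"] have "P k = P (k mod a) + a * (k div a * (k + k mod a + 1))"
    by simp
  then show ?thesis using \<open>b dvd a\<close> by (metis dvd_add_left_iff dvd_mult2)
qed

lemma primitive_ideal_in_class:
  assumes "C \<in> ideal_classes"
  shows "\<exists>a k. valid 1 a k \<and> idl 1 a k \<in> C"
proof -
  obtain I where I: "I \<in> nonzero_ideals R" "C = ideal_class_rel R `` {I}" using assms unfolding ideal_classes_def by (elim quotientE)
  obtain g a k where g: "valid g a k" "I = idl g a k" using nonzero_ideal_eq_idl[OF I(1)] by blast
  have J: "idl 1 a k \<in> nonzero_ideals R" using g(1) by (intro idl_ideal) (auto simp: valid_def)
  have "of_int g * elt (1 * (a * x + k * y)) (1 * y) = elt (g * (a * x + k * y)) (g * y)" for x y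
    by (simp add: elt_def algebra_simps)
  then have "(\<lambda>x. 1 * x) ` idl g a k = (\<lambda>x. of_int g * x) ` idl 1 a k"
    unfolding idl_def by (auto simp: image_iff) metis+
  moreover have "of_int g \<in> carrier R - {0}" "1 \<in> carrier R - {0}"
    using g(1) R_of_int[of g] R_of_int[of 1] by (auto simp: valid_def)
  ultimately have "(I, idl 1 a k) \<in> ideal_class_rel R"
    unfolding ideal_class_rel_R_iff g(2) using J I(1) g(2) by blast
  then show ?thesis using I(2) g(1) by (intro exI[of _ a] exI[of _ k]) (auto simp: valid_def)
qed

text \<open>Multiplication by the conjugate of \<open>k + \<omega>\<close> turns one ideal into
  \<open>a\<close> times the other, because \<open>a * c\<close> is the norm of
  \<open>k + \<omega>\<close>. On forms this is a rotation of the variables, which exchanges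
  \<open>a\<close> and \<open>c\<close> and negates the middle coefficient.\<close>

lemma idl_flip:
  assumes "a > 0" "c > 0" "a * c = P k"
  shows "(idl 1 a k, idl 1 c (- k - 1)) \<in> ideal_class_rel R"
proof -
  have c0: "c0 = a * c - k * k - k" using assms(3) by (simp add: P_def power2_eq_square)
  have P': "P (- k - 1) = P k" by (simp add: P_def power2_eq_square algebra_simps)
  have eq: "cnj (elt k 1) * elt (1 * (a * x + k * y)) (1 * y) =
      of_int a * elt (1 * (c * y + (- k - 1) * - x)) (1 * - x)" for x y
    unfolding cnj_elt elt_of_int elt_mult elt_eq_iff c0 by (simp add: algebra_simps)
  have "(\<lambda>x. cnj (elt k 1) * x) ` idl 1 a k = (\<lambda>x. of_int a * x) ` idl 1 c (- k - 1)"
  proof (intro equalityI subsetI)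
    fix z assume "z \<in> (\<lambda>x. cnj (elt k 1) * x) ` idl 1 a k"
    then obtain x y where "z = cnj (elt k 1) * elt (1 * (a * x + k * y)) (1 * y)"
      unfolding idl_def by blast
    moreover have "elt (1 * (c * y + (- k - 1) * - x)) (1 * - x) \<in> idl 1 c (- k - 1)"
      unfolding idl_def by blast
    ultimately show "z \<in> (\<lambda>x. of_int a * x) ` idl 1 c (- k - 1)" unfolding eq by blast
  next
    fix z assume "z \<in> (\<lambda>x. of_int a * x) ` idl 1 c (- k - 1)"
    then obtain x y where "z = of_int a * elt (1 * (c * x + (- k - 1) * y)) (1 * y)"
      unfolding idl_def by blast
    then have "z = cnj (elt k 1) * elt (1 * (a * (- y) + k * x)) (1 * x)" unfolding eq by simp
    moreover have "elt (1 * (a * (- y) + k * x)) (1 * x) \<in> idl 1 a k" unfolding idl_def by blast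
    ultimately show "z \<in> (\<lambda>x. cnj (elt k 1) * x) ` idl 1 a k" by blast
  qed
  moreover have "cnj (elt k 1) \<in> carrier R - {0}" "of_int a \<in> carrier R - {0}"
    using assms R_cnj[OF elt_in_R[of k 1]] R_of_int by auto
  moreover have "idl 1 a k \<in> nonzero_ideals R" "idl 1 c (- k - 1) \<in> nonzero_ideals R"
    using assms P' by (auto intro!: idl_ideal simp flip: assms(3))
  ultimately show ?thesis unfolding ideal_class_rel_R_iff by blast
qed

text \<open>A primitive ideal of least norm in its class corresponds to a reduced form.\<close>

lemma reduced_ideal_in_class:
  assumes C: "C \<in> ideal_classes"
  shows "\<exists>a k. valid 1 a k \<and> a \<le> int p \<and> idl 1 a k \<in> C"
proof -
  let ?Q = "\<lambda>n. n > 0 \<and> (\<exists>k. int n dvd P k \<and> idl 1 (int n) k \<in> C)"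
  obtain a0 k0 where "valid 1 a0 k0" "idl 1 a0 k0 \<in> C" using primitive_ideal_in_class[OF C] by blast
  then have "?Q (nat a0)" by (auto simp: valid_def)
  then have ex: "\<exists>n. ?Q n" by blast
  define n where "n = (LEAST n. ?Q n)"
  have n: "?Q n" unfolding n_def using ex by (rule LeastI_ex)
  have least: "n \<le> m" if "?Q m" for m unfolding n_def using that by (rule Least_le)
  define a where "a = int n"
  obtain k1 where k1: "a dvd P k1" "idl 1 a k1 \<in> C" and a: "a > 0" using n by (auto simp: a_def)
  define k2 where "k2 = k1 mod a"
  \<comment> \<open>The centred representative, chosen so that the middle coefficient
    \<open>2 * k + 1\<close> is at most \<open>a\<close> in absolute value.\<close>
  define k where "k = (if 2 * k2 + 1 \<le> a then k2 else k2 - a)"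
  have k2: "0 \<le> k2" "k2 < a" using a by (auto simp: k2_def)
  have km: "k mod a = k2" unfolding k_def using k2 by simp
  have k_le: "\<bar>2 * k + 1\<bar> \<le> a" using k2 by (auto simp: k_def)
  have eqk: "idl 1 a k = idl 1 a k1" using idl_mod[OF a, of 1 k] idl_mod[OF a, of 1 k1] km k2_def by simp
  have "a dvd P k" using P_mod[OF a dvd_refl, of k] P_mod[OF a dvd_refl, of k1] km k2_def k1(1) by simp
  then obtain c where c: "P k = a * c" by (elim dvdE)
  have c_pos: "c > 0" using P_pos[of k] a c by (simp add: zero_less_mult_iff)
  have "(idl 1 a k, idl 1 c (- k - 1)) \<in> ideal_class_rel R"
    using a c_pos c by (intro idl_flip) auto
  then have "idl 1 c (- k - 1) \<in> C"
    using class_eq_Image[OF C k1(2)] eqk by auto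
  moreover have "c dvd P (- k - 1)" using c by (simp add: P_def power2_eq_square algebra_simps)
  ultimately have "?Q (nat c)" using c_pos by auto
  then have "a \<le> c" using least[of "nat c"] c_pos by (simp add: a_def)
  \<comment> \<open>The classical reduction bound:
    \<open>4 * a^2 \<le> 4 * a * c = (2 * k + 1)^2 + p \<le> a^2 + p\<close>.\<close>
  then have "a * a \<le> a * c" using a by simp
  then have "4 * (a * a) \<le> (2 * k + 1)\<^sup>2 + int p" using four_P[of k] c by simp
  also have "(2 * k + 1)\<^sup>2 \<le> a * a"
    using k_le power_mono[of "\<bar>2 * k + 1\<bar>" a 2] by (simp add: power2_eq_square)
  finally have "3 * (a * a) \<le> int p" by simp
  moreover have "a \<le> a * a" using a by simp
  ultimately have "a \<le> int p" by linarith
  moreover have "valid 1 a (k mod a)"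
    using a \<open>a dvd P k\<close> P_mod[OF a dvd_refl, of k] by (simp add: valid_def)
  moreover have "idl 1 a (k mod a) \<in> C" using k1(2) eqk idl_mod[OF a, of 1 k] by simp
  ultimately show ?thesis by blast
qed

lemma finite_ideal_classes: "finite ideal_classes"
proof (rule finite_subset)
  show "ideal_classes \<subseteq> (\<lambda>(a, k). ideal_class_rel R `` {idl 1 a k}) ` ({0..int p} \<times> {0..int p})"
  proof
    fix C assume C: "C \<in> ideal_classes"
    obtain a k where ak: "valid 1 a k" "a \<le> int p" "idl 1 a k \<in> C" using reduced_ideal_in_class[OF C] by blast
    then have "C = ideal_class_rel R `` {idl 1 a k}"
      using C by (intro class_eq_Image)
    then show "C \<in> (\<lambda>(a, k). ideal_class_rel R `` {idl 1 a k}) ` ({0..int p} \<times> {0..int p})"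
      using ak by (intro image_eqI[of _ _ "(a, k)"]) (auto simp: valid_def)
  qed
qed simp

definition rep :: "complex set set \<Rightarrow> int \<times> int" where
  "rep C = (SOME (a, k). valid 1 a k \<and> idl 1 a k \<in> C)"

lemma rep:
  assumes "C \<in> ideal_classes"
  shows "valid 1 (fst (rep C)) (snd (rep C))" "idl 1 (fst (rep C)) (snd (rep C)) \<in> C"
proof -
  have "\<exists>x. case x of (a, k) \<Rightarrow> valid 1 a k \<and> idl 1 a k \<in> C"
    using primitive_ideal_in_class[OF assms] by auto
  from someI_ex[OF this] show "valid 1 (fst (rep C)) (snd (rep C))" "idl 1 (fst (rep C)) (snd (rep C)) \<in> C"
    by (simp_all add: rep_def case_prod_unfold)
qed

text \<open>The classes partition the ideals of norm \<open>m\<close>, and the form of each class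
  represents \<open>m\<close> twice as often as the class contains such ideals.\<close>

lemma sum_representations_eq_norm_triples:
  assumes m: "m > 0"
  shows "(\<Sum>C\<in>ideal_classes. card {(x, y). fst (rep C) * x\<^sup>2 + (2 * snd (rep C) + 1) * x * y +
      P (snd (rep C)) div fst (rep C) * y\<^sup>2 = m}) = 2 * card (norm_triples m)"
proof -
  have "card {(x, y). fst (rep C) * x\<^sup>2 + (2 * snd (rep C) + 1) * x * y +
      P (snd (rep C)) div fst (rep C) * y\<^sup>2 = m} = 2 * card (ideals_norm m \<inter> C)"
    if C: "C \<in> ideal_classes" for C
  proof -
    define a k where "a = fst (rep C)" and "k = snd (rep C)"
    have v: "valid 1 a k" and mem: "idl 1 a k \<in> C"
      using rep[OF C] by (auto simp: a_def k_def)
    have ac: "a * (P k div a) = P k" using v by (simp add: valid_def)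
    have "I \<in> C \<longleftrightarrow> (idl 1 a k, I) \<in> ideal_class_rel R" for I
      by (subst class_eq_Image[OF C mem]) simp
    then have "{I \<in> ideals_norm m. (idl 1 a k, I) \<in> ideal_class_rel R} = ideals_norm m \<inter> C"
      by blast
    then show ?thesis
      using card_representations_eq_ideals[OF v ac m] unfolding a_def[symmetric] k_def[symmetric] by simp
  qed
  then have "(\<Sum>C\<in>ideal_classes. card {(x, y). fst (rep C) * x\<^sup>2 + (2 * snd (rep C) + 1) * x * y +
      P (snd (rep C)) div fst (rep C) * y\<^sup>2 = m}) = (\<Sum>C\<in>ideal_classes. 2 * card (ideals_norm m \<inter> C))"
    by (rule sum.cong[OF refl])
  also have "\<dots> = 2 * (\<Sum>C\<in>ideal_classes. card (ideals_norm m \<inter> C))" by (rule sum_distrib_left[symmetric])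
  also have "(\<Sum>C\<in>ideal_classes. card (ideals_norm m \<inter> C)) = card (\<Union>C\<in>ideal_classes. ideals_norm m \<inter> C)"
  proof (rule card_UN_disjoint[symmetric, OF finite_ideal_classes])
    show "\<forall>C\<in>ideal_classes. \<forall>D\<in>ideal_classes. C \<noteq> D \<longrightarrow>
        (ideals_norm m \<inter> C) \<inter> (ideals_norm m \<inter> D) = {}"
    proof (intro ballI impI)
      fix C D assume "C \<in> ideal_classes" "D \<in> ideal_classes" "C \<noteq> D"
      then have "C \<inter> D = {}" using quotient_disj[OF equiv_rel_R] unfolding ideal_classes_def by metis
      then show "(ideals_norm m \<inter> C) \<inter> (ideals_norm m \<inter> D) = {}" by auto
    qed
  qed (use finite_ideals_norm in simp)
  also have "(\<Union>C\<in>ideal_classes. ideals_norm m \<inter> C) = ideals_norm m"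
  proof -
    have "\<Union> ideal_classes = nonzero_ideals R" unfolding ideal_classes_def by (rule Union_quotient[OF equiv_rel_R])
    moreover have "ideals_norm m \<subseteq> nonzero_ideals R"
      by (auto simp: ideals_norm_def valid_def intro!: idl_ideal)
    ultimately show ?thesis by blast
  qed
  finally show ?thesis by (simp add: card_ideals_norm)
qed

end

section \<open>Ideals of given norm\<close>

definition dconv :: "(nat \<Rightarrow> int) \<Rightarrow> (nat \<Rightarrow> int) \<Rightarrow> nat \<Rightarrow> int" where
  "dconv f g n = (\<Sum>d | d dvd n. f d * g (n div d))"

definition mult_fun :: "(nat \<Rightarrow> int) \<Rightarrow> bool" where
  "mult_fun f \<longleftrightarrow> f 1 = 1 \<and> (\<forall>a b. a > 0 \<longrightarrow> b > 0 \<longrightarrow> coprime a b \<longrightarrow> f (a * b) = f a * f b)"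

lemma gcd_mult_of_coprime:
  fixes a b m :: nat
  assumes "a dvd m" "coprime b m"
  shows "gcd (a * b) m = a"
proof (rule dvd_antisym)
  have "coprime (gcd (a * b) m) b"
    using assms(2) by (meson coprime_commute coprime_divisors dvd_refl gcd_dvd2)
  moreover have "gcd (a * b) m dvd a * b" by simp
  ultimately show "gcd (a * b) m dvd a" by (simp only: coprime_dvd_mult_left_iff)
qed (use assms(1) in simp)

text \<open>For coprime \<open>m\<close> and \<open>n\<close>, a divisor of \<open>m * n\<close> is
  the product of its gcds with \<open>m\<close> and with \<open>n\<close>, uniquely.\<close>

lemma mult_fun_dconv:
  assumes "mult_fun f" "mult_fun g"
  shows "mult_fun (dconv f g)"
proof -
  have "dconv f g (m * n) = dconv f g m * dconv f g n" if mn: "m > 0" "n > 0" "coprime m n" for m n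
  proof -
    have "dconv f g m * dconv f g n =
      (\<Sum>(a, b)\<in>{a. a dvd m} \<times> {b. b dvd n}. (f a * g (m div a)) * (f b * g (n div b)))"
      unfolding dconv_def by (simp add: sum_product sum.cartesian_product)
    also have "\<dots> = (\<Sum>d | d dvd m * n. f d * g (m * n div d))"
    proof (rule sum.reindex_bij_witness[of _ "\<lambda>d. (gcd d m, gcd d n)" "\<lambda>(a, b). a * b"], goal_cases)
      case (1 x)
      then obtain a b where x: "x = (a, b)" "a dvd m" "b dvd n" by auto
      have "coprime a n" "coprime b m" using x mn by (meson coprime_divisors dvd_refl coprime_commute)+
      then have "gcd (a * b) m = a" "gcd (a * b) n = b"
        using gcd_mult_of_coprime[of a m b] gcd_mult_of_coprime[of b n a] x by (simp_all add: mult.commute)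
      then show ?case using x by simp
    next
      case (3 d)
      then obtain a b where d: "d = a * b" "a dvd m" "b dvd n"
        using division_decomp[of d m n] by auto
      have "coprime a n" "coprime b m" using d mn by (meson coprime_divisors dvd_refl coprime_commute)+
      then have "gcd d m = a" "gcd d n = b"
        using gcd_mult_of_coprime[of a m b] gcd_mult_of_coprime[of b n a] d by (simp_all add: mult.commute)
      then show ?case using d by simp
    next
      case (5 x)
      then obtain a b where x: "x = (a, b)" "a dvd m" "b dvd n" by auto
      have ab: "coprime a b" "coprime (m div a) (n div b)"
      proof -
        have "m div a dvd m" "n div b dvd n" using x by (metis dvd_div_mult_self dvd_triv_left)+
        then show "coprime a b" "coprime (m div a) (n div b)" using x mn coprime_divisors by blast+
      qed
      have pos: "a > 0" "b > 0" "m div a > 0" "n div b > 0"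
        using x mn by (auto elim!: dvdE)
      have "m * n div (a * b) = (m div a) * (n div b)" using x by (simp add: div_mult_div_if_dvd)
      then show ?case using assms ab pos unfolding x mult_fun_def by simp
    qed (auto intro: mult_dvd_mono)
    finally show ?thesis by (simp add: dconv_def)
  qed
  moreover have "dconv f g 1 = 1" using assms by (simp add: dconv_def mult_fun_def)
  ultimately show ?thesis by (simp add: mult_fun_def)
qed

lemma mult_fun_eqI:
  assumes "mult_fun f" "mult_fun g" and eq: "\<And>q e. prime q \<Longrightarrow> f (q ^ e) = g (q ^ e)"
  shows "n > 0 \<Longrightarrow> f n = g n"
proof (induction n rule: less_induct)
  case (less n)
  show ?case
  proof (cases "n = 1")
    case True
    then show ?thesis using assms by (simp add: mult_fun_def)
  next
    case False
    then obtain q where q: "prime q" "q dvd n" using prime_factor_nat by blast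
    define e where "e = multiplicity q n"
    obtain y where y: "n = q ^ e * y" "\<not> q dvd y"
      unfolding e_def using multiplicity_decompose'[of n q] q less.prems
      by (metis not_prime_unit not_gr0)
    have "e > 0" using y q by (cases "e = 0") auto
    then have "1 < q ^ e" using prime_gt_1_nat[OF q(1)] by (intro one_less_power)
    moreover have "y > 0" using y less.prems by (cases "y = 0") auto
    ultimately have "y < n" using y by simp
    moreover have "coprime (q ^ e) y" using q y by (simp add: prime_imp_coprime)
    ultimately show ?thesis using less.IH[of y] \<open>y > 0\<close> assms(1,2) eq[OF q(1), of e] q(1)
      unfolding y(1) mult_fun_def by (simp add: prime_gt_0_nat)
  qed
qed

lemma dconv_prime_power:
  assumes "prime q"
  shows "dconv f g (q ^ e) = (\<Sum>i\<le>e. f (q ^ i) * g (q ^ (e - i)))"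
proof -
  have q: "q > 1" using assms by (rule prime_gt_1_nat)
  have "{d. d dvd q ^ e} = (\<lambda>i. q ^ i) ` {..e}"
    using assms by (auto simp: divides_primepow_nat)
  then have "dconv f g (q ^ e) = (\<Sum>i\<le>e. f (q ^ i) * g (q ^ e div q ^ i))"
    unfolding dconv_def using q by (simp add: sum.reindex inj_on_def)
  also have "\<dots> = (\<Sum>i\<le>e. f (q ^ i) * g (q ^ (e - i)))"
    using q by (intro sum.cong refl) (simp add: power_diff)
  finally show ?thesis .
qed

section \<open>Roots of the norm polynomial modulo prime powers\<close>

context imag_quadratic
begin

definition roots :: "int \<Rightarrow> int set" where "roots a = {k. 0 \<le> k \<and> k < a \<and> a dvd P k}"

text \<open>The number of ideals of norm \<open>a\<close> that are primitive, that is, have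
  \<open>g = 1\<close>.\<close>

definition \<rho> :: "nat \<Rightarrow> int" where "\<rho> a = int (card (roots (int a)))"

lemma finite_roots: "finite (roots a)"
  by (rule finite_subset[of _ "{0..a}"]) (auto simp: roots_def)

lemma mult_fun_rho: "mult_fun \<rho>"
proof -
  have "\<rho> (a * b) = \<rho> a * \<rho> b" if ab: "a > 0" "b > 0" "coprime a b" for a b
  proof -
    let ?a = "int a" and ?b = "int b"
    have cop: "coprime ?a ?b" using ab by simp
    have pos: "?a > 0" "?b > 0" "?a * ?b > 0" using ab by auto
    have "bij_betw (\<lambda>k. (k mod ?a, k mod ?b)) (roots (?a * ?b)) (roots ?a \<times> roots ?b)"
      unfolding bij_betw_def
    proof
      show "inj_on (\<lambda>k. (k mod ?a, k mod ?b)) (roots (?a * ?b))"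
      proof (rule inj_onI)
        fix k l assume kl: "k \<in> roots (?a * ?b)" "l \<in> roots (?a * ?b)" "(k mod ?a, k mod ?b) = (l mod ?a, l mod ?b)"
        then have "?a dvd k - l" "?b dvd k - l" by (auto simp: mod_eq_dvd_iff)
        then have "?a * ?b dvd k - l" using cop by (simp add: divides_mult)
        then have "k mod (?a * ?b) = l mod (?a * ?b)" by (simp add: mod_eq_dvd_iff)
        then show "k = l" using kl by (simp add: roots_def)
      qed
      show "(\<lambda>k. (k mod ?a, k mod ?b)) ` roots (?a * ?b) = roots ?a \<times> roots ?b"
      proof (intro equalityI subsetI)
        fix w assume "w \<in> (\<lambda>k. (k mod ?a, k mod ?b)) ` roots (?a * ?b)"
        then show "w \<in> roots ?a \<times> roots ?b"
          using pos P_mod[of ?a ?a] P_mod[of ?b ?b] by (auto simp: roots_def dest: dvd_mult_left dvd_mult_right)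
      next
        fix w assume w: "w \<in> roots ?a \<times> roots ?b"
        obtain x where x: "[x = fst w] (mod ?a)" "[x = snd w] (mod ?b)"
          using binary_chinese_remainder_int[OF cop] by blast
        define k where "k = x mod (?a * ?b)"
        have k: "k mod ?a = fst w" "k mod ?b = snd w"
          using x w by (auto simp: k_def mod_mod_cancel unique_euclidean_semiring_class.cong_def roots_def)
        then have "?a dvd P k" "?b dvd P k"
          using w P_mod[of ?a ?a k] P_mod[of ?b ?b k] pos by (auto simp: roots_def)
        then have "?a * ?b dvd P k" using cop by (simp add: divides_mult)
        then have "k \<in> roots (?a * ?b)" using pos by (simp add: roots_def k_def)
        then show "w \<in> (\<lambda>k. (k mod ?a, k mod ?b)) ` roots (?a * ?b)"
          using k by (intro image_eqI[of _ _ k]) auto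
      qed
    qed
    then have "card (roots (?a * ?b)) = card (roots ?a \<times> roots ?b)" by (rule bij_betw_same_card)
    then show ?thesis by (simp add: \<rho>_def card_cartesian_product)
  qed
  moreover have "roots 1 = {0}" by (auto simp: roots_def)
  then have "\<rho> 1 = 1" by (simp add: \<rho>_def)
  ultimately show ?thesis by (simp add: mult_fun_def)
qed

text \<open>\<open>2 * k + 1\<close> is the derivative of \<open>P\<close>, and
  \<open>4 * P k - (2 * k + 1)^2 = p\<close>; so away from \<open>p\<close> all roots modulo a prime
  are simple.\<close>

lemma not_dvd_P_and_derivative:
  assumes "prime (q :: int)" "q dvd P k" "q dvd 2 * k + 1"
  shows "q = int p"
proof -
  have "q dvd 4 * P k - (2 * k + 1)\<^sup>2" using assms by (simp add: dvd_diff power2_eq_square)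
  then have "q dvd int p" unfolding four_P by simp
  then show ?thesis using prime_p assms(1) by (simp add: primes_dvd_imp_eq)
qed

text \<open>Hensel lifting. In the expansion of \<open>P (k + t * M)\<close> the quadratic term
  drops out, so the condition on \<open>t\<close> is linear modulo \<open>q\<close> with the
  invertible coefficient \<open>2 * k + 1\<close>: each root modulo \<open>M\<close> has exactly one
  lift.\<close>

lemma rho_hensel:
  assumes q: "prime q" "q \<noteq> p" and e: "e > 0"
  shows "\<rho> (q ^ Suc e) = \<rho> (q ^ e)"
proof -
  define M where "M = int (q ^ e)"
  have qi: "prime (int q)" using q by simp
  have pos: "M > 0" "int q > 0" using prime_gt_0_nat[OF q(1)] by (auto simp: M_def)
  have qM: "int q dvd M" using e by (simp add: M_def)
  have MM: "int (q ^ Suc e) = M * int q" by (simp add: M_def)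
  have expand: "P (k + t * M) = P k + t * M * (2 * k + 1) + t * t * M * M" for k t
    by (simp add: P_def power2_eq_square algebra_simps)
  have cop: "coprime (2 * k + 1) (int q)" if "M dvd P k" for k
  proof -
    have "int q dvd P k" using qM that by (rule dvd_trans)
    then have "\<not> int q dvd 2 * k + 1" using not_dvd_P_and_derivative[OF qi, of k] q by auto
    then show ?thesis using qi by (metis coprime_commute prime_imp_coprime)
  qed
  have lift: "M * int q dvd P (k + t * M) \<longleftrightarrow> int q dvd u + t * (2 * k + 1)" if u: "P k = M * u" for k t u
  proof -
    have "P (k + t * M) = M * (u + t * (2 * k + 1) + t * t * M)" unfolding expand u by (simp add: algebra_simps)
    then have "M * int q dvd P (k + t * M) \<longleftrightarrow> int q dvd u + t * (2 * k + 1) + t * t * M" using pos by simp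
    also have "\<dots> \<longleftrightarrow> int q dvd u + t * (2 * k + 1)" using qM by (simp add: dvd_add_left_iff)
    finally show ?thesis .
  qed
  have "bij_betw (\<lambda>k. k mod M) (roots (M * int q)) (roots M)"
    unfolding bij_betw_def
  proof
    show "inj_on (\<lambda>k. k mod M) (roots (M * int q))"
    proof (rule inj_onI)
      fix k l assume kl: "k \<in> roots (M * int q)" "l \<in> roots (M * int q)" "k mod M = l mod M"
      then obtain t where t: "l - k = M * t" by (metis dvdE mod_eq_dvd_iff)
      have kd: "M * int q dvd P k" "M * int q dvd P l" using kl by (auto simp: roots_def)
      have "M dvd P k" using kd(1) by (rule dvd_mult_left)
      then obtain u where u: "P k = M * u" by (elim dvdE)
      have "l = k + t * M" using t by (simp add: algebra_simps)
      then have "int q dvd u + t * (2 * k + 1)" "int q dvd u + 0 * (2 * k + 1)"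
        using lift[OF u, of t] lift[OF u, of 0] kd by auto
      then have "int q dvd t * (2 * k + 1)" by (simp add: dvd_add_right_iff)
      then have "int q dvd t" using cop[OF \<open>M dvd P k\<close>] by (simp add: coprime_dvd_mult_left_iff coprime_commute)
      then have "M * int q dvd l - k" unfolding t using pos by simp
      then have "l mod (M * int q) = k mod (M * int q)" by (simp add: mod_eq_dvd_iff)
      then show "k = l" using kl by (simp add: roots_def)
    qed
    show "(\<lambda>k. k mod M) ` roots (M * int q) = roots M"
    proof (intro equalityI subsetI)
      fix w assume "w \<in> (\<lambda>k. k mod M) ` roots (M * int q)"
      then show "w \<in> roots M" using pos P_mod[of M M] by (auto simp: roots_def dest: dvd_mult_left)
    next
      fix k assume k: "k \<in> roots M"
      then obtain u where u: "P k = M * u" by (auto simp: roots_def elim: dvdE)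
      obtain x where x: "[(2 * k + 1) * x = 1] (mod int q)"
        using cop[of k] k cong_solve_coprime_int[of "2 * k + 1" "int q"] by (auto simp: roots_def)
      define t where "t = (- u * x) mod int q"
      have "int q dvd u + t * (2 * k + 1)"
      proof -
        have "[u + t * (2 * k + 1) = u + (- u * x) * (2 * k + 1)] (mod int q)"
          by (intro cong_add cong_mult cong_refl) (simp add: t_def)
        also have "u + (- u * x) * (2 * k + 1) = u - u * ((2 * k + 1) * x)" by (simp add: algebra_simps)
        also have "[u - u * ((2 * k + 1) * x) = u - u * 1] (mod int q)"
          by (intro cong_diff cong_mult cong_refl x)
        finally show ?thesis by (simp add: cong_0_iff)
      qed
      then have d: "M * int q dvd P (k + t * M)" using lift[OF u] by blast
      have t: "0 \<le> t" "t < int q" using pos by (auto simp: t_def)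
      have "k + t * M < M * int q"
      proof -
        have "(t + 1) * M \<le> int q * M" using t pos by (intro mult_right_mono) auto
        then show ?thesis using k by (simp add: roots_def algebra_simps)
      qed
      then have "k + t * M \<in> roots (M * int q)" using d k t pos by (simp add: roots_def)
      moreover have "(k + t * M) mod M = k" using k by (simp add: roots_def)
      ultimately show "k \<in> (\<lambda>k. k mod M) ` roots (M * int q)" by (metis imageI)
    qed
  qed
  then have "card (roots (M * int q)) = card (roots M)" by (rule bij_betw_same_card)
  then show ?thesis unfolding \<rho>_def MM by (simp add: M_def)
qed

lemma odd_imp_coprime_4:
  fixes m :: int
  assumes "odd m"
  shows "coprime m 4"
proof -
  have "coprime m 2" using assms by (simp add: coprime_commute)
  then have "coprime m (2 * 2)" by (simp only: coprime_mult_right_iff)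
  then show ?thesis by simp
qed

lemma dvd_P_iff_odd:
  assumes "coprime m (4 :: int)"
  shows "m dvd P k \<longleftrightarrow> m dvd (2 * k + 1)\<^sup>2 + int p"
  unfolding four_P[symmetric] using assms by (simp add: coprime_dvd_mult_right_iff)

text \<open>Modulo \<open>p\<close> there is a double root, where \<open>2 * k + 1\<close> vanishes.
  It does not lift: if \<open>p^2\<close> divided \<open>P k\<close>, it would divide
  \<open>(2 * k + 1)^2\<close> too, hence their combination \<open>p\<close>.\<close>

lemma rho_p: "\<rho> p = 1" and rho_p_power: "\<rho> (p ^ (e + 2)) = 0"
proof -
  have pi: "prime (int p)" using prime_p by simp
  have odd: "odd p" using p_mod_4 by presburger
  have cop: "coprime (int p) 4" using odd by (intro odd_imp_coprime_4) simp
  have key: "int p dvd P k \<longleftrightarrow> int p dvd 2 * k + 1" for k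
    using dvd_P_iff_odd[OF cop, of k] pi by (simp add: dvd_add_left_iff prime_dvd_power_iff)
  obtain n where n: "p = 2 * n + 1" using odd by (elim oddE)
  have "roots (int p) = {int n}"
  proof (intro equalityI subsetI)
    fix k assume "k \<in> roots (int p)"
    then have k: "0 \<le> k" "k < int p" "int p dvd 2 * k + 1" using key by (auto simp: roots_def)
    then obtain c where c: "2 * k + 1 = int p * c" by (elim dvdE)
    have "c > 0" using c k by (smt (verit) mult_nonneg_nonpos of_nat_0_le_iff)
    moreover have "c < 2"
    proof (rule ccontr)
      assume "\<not> c < 2"
      then have "int p * 2 \<le> int p * c" by (intro mult_left_mono) auto
      then show False using c k by linarith
    qed
    ultimately have "c = 1" by simp
    then show "k \<in> {int n}" using c n by simp
  next
    fix k assume "k \<in> {int n}"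
    then have "k = int n" by simp
    have "2 * int n + 1 = int p" using n by simp
    moreover have "int n < int p" using n by simp
    moreover have "int p dvd P (int n)" unfolding key \<open>2 * int n + 1 = int p\<close> by simp
    ultimately show "k \<in> roots (int p)" using \<open>k = int n\<close> by (simp add: roots_def)
  qed
  then show "\<rho> p = 1" by (simp add: \<rho>_def)
  have "roots (int (p ^ (e + 2))) = {}"
  proof (rule ccontr)
    assume "roots (int (p ^ (e + 2))) \<noteq> {}"
    then obtain k where "int (p ^ (e + 2)) dvd P k" by (auto simp: roots_def)
    then have 2: "(int p)\<^sup>2 dvd P k"
      by (metis dvd_trans le_add2 le_imp_power_dvd of_nat_power)
    then have "(int p)\<^sup>2 dvd 4 * P k" by simp
    moreover have "int p dvd 2 * k + 1" using 2 key by (metis dvd_mult_left power2_eq_square)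
    then have "(int p)\<^sup>2 dvd (2 * k + 1)\<^sup>2" by (rule dvd_power_same)
    ultimately have "(int p)\<^sup>2 dvd int p" unfolding four_P by (simp add: dvd_add_right_iff)
    then have "(int p)\<^sup>2 \<le> int p" using p_gt_3 by (intro zdvd_imp_le) auto
    then have "p\<^sup>2 \<le> p" by (metis of_nat_le_iff of_nat_power)
    then show False using p_gt_3 by (simp add: power2_eq_square)
  qed
  then show "\<rho> (p ^ (e + 2)) = 0" by (simp add: \<rho>_def)
qed

text \<open>Since 2 is invertible modulo \<open>q\<close>, completing the square identifies the
  roots of \<open>P\<close> with the square roots of \<open>- p\<close>.\<close>

lemma rho_prime:
  assumes q: "prime q" "q \<noteq> p" "odd q"
  shows "\<rho> q = 1 + Legendre (- int p) (int q)"
proof -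
  have qi: "prime (int q)" using q by simp
  have q2: "int q > 0" using q prime_gt_0_nat by simp
  have ndp: "\<not> int q dvd int p" using q prime_p by (metis of_nat_dvd_iff primes_dvd_imp_eq)
  have cop: "coprime (int q) 4" using q by (intro odd_imp_coprime_4) simp
  have dvd: "int q dvd P k \<longleftrightarrow> int q dvd (2 * k + 1)\<^sup>2 + int p" for k by (rule dvd_P_iff_odd[OF cop])
  have root_iff: "[y\<^sup>2 = - int p] (mod int q) \<longleftrightarrow> int q dvd y\<^sup>2 + int p" for y
    by (simp add: cong_iff_dvd_diff)
  have nz: "\<not> [- int p = 0] (mod int q)" using ndp by (simp add: cong_0_iff)
  show ?thesis
  proof (cases "QuadRes (int q) (- int p)")
    case False
    then have "\<not> int q dvd P k" for k using dvd root_iff unfolding QuadRes_def by blast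
    then have "roots (int q) = {}" by (auto simp: roots_def)
    then show ?thesis using False nz by (simp add: \<rho>_def Legendre_def)
  next
    case True
    then obtain y where y: "int q dvd y\<^sup>2 + int p" using root_iff unfolding QuadRes_def by blast
    \<comment> \<open>To be of the form \<open>2 * k + 1\<close> the root must be odd; adding the
      odd \<open>q\<close> repairs an even one.\<close>
    obtain y' where y': "odd y'" "int q dvd y'\<^sup>2 + int p"
    proof (cases "odd y")
      case False
      have "(y + int q)\<^sup>2 + int p = (y\<^sup>2 + int p) + int q * (2 * y + int q)"
        by (simp add: power2_eq_square algebra_simps)
      then have "int q dvd (y + int q)\<^sup>2 + int p" using y by (simp only: dvd_add dvd_triv_left)
      then show ?thesis using that[of "y + int q"] False q(3) by simp
    qed (use that y in blast)
    then obtain k where k: "y' = 2 * k + 1" by (elim oddE)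
    have kP: "int q dvd P k" using y' k dvd by simp
    have Pneg: "P (- 1 - l) = P l" for l by (simp add: P_def power2_eq_square algebra_simps)
    \<comment> \<open>The other root is the reflection \<open>- 1 - k\<close>. It is different
      because the derivative at \<open>k\<close> does not vanish modulo \<open>q\<close>.\<close>
    let ?a = "k mod int q" and ?b = "(- 1 - k) mod int q"
    have "roots (int q) = {?a, ?b}"
    proof (intro equalityI subsetI)
      fix l assume l: "l \<in> roots (int q)"
      have "P l - P k = (l - k) * (l - (- 1 - k))" by (simp add: P_def power2_eq_square algebra_simps)
      moreover have "int q dvd P l - P k" using l kP by (simp add: roots_def dvd_diff)
      ultimately have "int q dvd l - k \<or> int q dvd l - (- 1 - k)"
        using qi by (simp only: prime_dvd_mult_iff)
      then have "l mod int q = ?a \<or> l mod int q = ?b" by (simp add: mod_eq_dvd_iff)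
      then show "l \<in> {?a, ?b}" using l by (auto simp: roots_def)
    next
      fix l assume "l \<in> {?a, ?b}"
      then show "l \<in> roots (int q)"
        using q2 kP P_mod[of "int q" "int q" k] P_mod[of "int q" "int q" "- 1 - k"] Pneg
        by (auto simp: roots_def)
    qed
    moreover have "?a \<noteq> ?b"
    proof
      assume "?a = ?b"
      then have "int q dvd k - (- 1 - k)" by (simp only: mod_eq_dvd_iff)
      then have "int q dvd 2 * k + 1" by simp
      then show False using not_dvd_P_and_derivative[OF qi kP] q by simp
    qed
    ultimately have "\<rho> q = 2" by (simp add: \<rho>_def)
    then show ?thesis using True nz by (simp add: Legendre_def)
  qed
qed

text \<open>As \<open>(p - 1) / 2\<close> is odd, quadratic reciprocity produces the sign
  \<open>(- 1)^((q - 1) / 2)\<close>, which is the symbol of -1 modulo \<open>q\<close>.\<close>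

lemma Legendre_neg_p:
  assumes q: "prime q" "q \<noteq> p" "odd q"
  shows "Legendre (- int p) (int q) = Legendre (int q) (int p)"
proof -
  have q2: "q > 2" using q prime_ge_2_nat[OF q(1)] by (cases "q = 2") auto
  have "[Legendre (- 1) (int q) = (- 1) ^ ((q - 1) div 2)] (mod int q)"
    by (rule euler_criterion[OF q(1) q2])
  then have m1: "Legendre (- 1) (int q) = (- 1) ^ ((q - 1) div 2)"
    using q2 Legendre_values minus_one_power_iff[of "(q - 1) div 2", where 'a = int]
    by (intro cong_imp_eq_sign[of _ _ "int q"]) auto
  have odd: "odd ((p - 1) div 2)" using p_mod_4 by presburger
  have "Legendre (int p) (int q) * Legendre (int q) (int p) = (- 1) ^ ((p - 1) div 2 * ((q - 1) div 2))"
    using prime_p p_gt_3 q q2 by (intro Quadratic_Reciprocity) auto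
  then have QR: "Legendre (int p) (int q) * Legendre (int q) (int p) = (- 1) ^ ((q - 1) div 2)"
    using odd by (simp add: power_mult)
  have "Legendre (- int p) (int q) = (- 1) ^ ((q - 1) div 2) * Legendre (int p) (int q)"
    using Legendre_mult[OF q(1) q2, of "- 1" "int p"] m1 by simp
  also have "\<dots> = Legendre (int q) (int p) * (Legendre (int p) (int q) * Legendre (int p) (int q))"
    unfolding QR[symmetric] by simp
  also have "Legendre (int p) (int q) * Legendre (int p) (int q) = 1"
  proof -
    have "\<not> int q dvd int p" using q prime_p by (metis of_nat_dvd_iff primes_dvd_imp_eq)
    then show ?thesis using Legendre_values[of "int p" "int q"] Legendre_eq_0_iff[of "int p" "int q"] by auto
  qed
  finally show ?thesis by simp
qed

end

section \<open>The case of \<open>p\<close> congruent to 7 modulo 8, where 2 splits\<close>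

locale imag_quadratic_split_2 = imag_quadratic +
  assumes p_mod_8: "p mod 8 = 7"
begin

abbreviation eps :: "nat \<Rightarrow> int" where "eps d \<equiv> Legendre (int d) (int p)"

lemma eps_mult: "eps (a * b) = eps a * eps b"
  using Legendre_mult[OF prime_p, of "int a" "int b"] p_gt_3 by simp

lemma eps_2: "eps 2 = 1"
proof -
  define k where "k = p div 8"
  have "p = 2 * (4 * k + 3) + 1" using p_mod_8 mult_div_mod_eq[of 8 p] by (simp add: k_def)
  then have "eps 2 = (- 1) ^ (4 * k + 3 - (4 * k + 3) div 2)" using Legendre_two[OF prime_p] by simp
  moreover have "4 * k + 3 - (4 * k + 3) div 2 = 2 * (k + 1)" by simp
  ultimately show ?thesis by simp
qed

lemma eps_1: "eps 1 = 1"
  using Legendre_one[of "int p"] p_gt_3 by simp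

lemma rho_prime_eq_eps:
  assumes "prime q" "q \<noteq> p"
  shows "\<rho> q = 1 + eps q"
proof (cases "odd q")
  case True
  then show ?thesis using rho_prime Legendre_neg_p assms by simp
next
  case False
  then have "2 dvd q" by simp
  then have q: "q = 2" using primes_dvd_imp_eq[OF two_is_prime_nat assms(1)] by simp
  have "even c0" using p_mod_8 unfolding c0_def by presburger
  then have "even (P k)" for k by (simp add: P_def)
  then have "roots (int 2) = {0..<2}" by (auto simp: roots_def)
  then have "\<rho> 2 = 2" by (simp add: \<rho>_def)
  then show ?thesis using eps_2 by (simp only: q)
qed

text \<open>One expression for three behaviours: constantly 2 for split \<open>q\<close>, constantly
  0 for inert \<open>q\<close>, and for \<open>q = p\<close>, where \<open>0 ^ 0 = 1\<close>
  matters, 1 for \<open>e = 0\<close> and 0 beyond.\<close>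

lemma rho_prime_power_eq_eps:
  assumes q: "prime q"
  shows "\<rho> (q ^ Suc e) = eps q ^ e * (1 + eps q)"
proof (cases "q = p")
  case True
  have 0: "eps p = 0" by (simp add: Legendre_def cong_0_iff)
  show ?thesis using rho_p rho_p_power[of "e - 1"] by (cases e) (simp_all add: True 0)
next
  case False
  have "eps q = 1 \<or> eps q = - 1"
  proof -
    have "\<not> int p dvd int q" using q prime_p False by (metis of_nat_dvd_iff primes_dvd_imp_eq)
    then show ?thesis using Legendre_values[of "int q" "int p"] Legendre_eq_0_iff[of "int q" "int p"] by auto
  qed
  moreover have "\<rho> (q ^ Suc e) = 1 + eps q"
  proof (induction e)
    case (Suc e)
    then show ?case using rho_hensel[OF q False, of "Suc e"] by simp
  qed (simp add: rho_prime_eq_eps[OF q False])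
  ultimately show ?thesis by auto
qed

definition square_ind :: "nat \<Rightarrow> int" where "square_ind n = (if is_nth_power 2 n then 1 else 0)"

lemma mult_fun_square_ind: "mult_fun square_ind"
  by (simp add: mult_fun_def square_ind_def is_nth_power_mult_coprime_nat_iff)

text \<open>In \<open>m = g^2 * a\<close> the positive \<open>g\<close> is determined by
  \<open>a\<close>. A triple is thus a divisor \<open>a\<close> with square cofactor together with a
  root of \<open>P\<close> modulo \<open>a\<close>.\<close>

lemma card_norm_triples_eq_dconv:
  assumes "m > 0"
  shows "int (card (norm_triples (int m))) = dconv \<rho> square_ind m"
proof -
  let ?D = "{a. a dvd m \<and> is_nth_power 2 (m div a)}"
  have "bij_betw (\<lambda>(g, a, k). (nat a, k)) (norm_triples (int m)) (SIGMA a:?D. roots (int a))"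
    unfolding bij_betw_def
  proof
    show "inj_on (\<lambda>(g, a, k). (nat a, k)) (norm_triples (int m))"
    proof (rule inj_onI, clarify)
      fix g a k g' a' k' :: int
      assume "(g, a, k) \<in> norm_triples (int m)" "(g', a', k') \<in> norm_triples (int m)" "nat a = nat a'"
      then have "a = a'" "g\<^sup>2 * a = g'\<^sup>2 * a'" "a > 0" "g > 0" "g' > 0"
        by (auto simp: norm_triples_def valid_def)
      then show "g = g' \<and> (a, k) = (a', k)" by (auto simp: power2_eq_iff)
    qed
    show "(\<lambda>(g, a, k). (nat a, k)) ` norm_triples (int m) = (SIGMA a:?D. roots (int a))"
    proof (intro equalityI subsetI)
      fix w assume "w \<in> (\<lambda>(g, a, k). (nat a, k)) ` norm_triples (int m)"
      then obtain g a k where w: "w = (nat a, k)" and v: "valid g a k" "g\<^sup>2 * a = int m"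
        by (auto simp: norm_triples_def)
      define g' a' where "g' = nat g" and "a' = nat a"
      have ga: "g = int g'" "a = int a'" "a' > 0" using v by (auto simp: g'_def a'_def valid_def)
      have "int (g'\<^sup>2 * a') = int m" using v(2) by (simp add: ga)
      then have "m = g'\<^sup>2 * a'" by (simp only: of_nat_eq_iff)
      then have "a' dvd m" "m div a' = g'\<^sup>2" using ga by auto
      moreover have "is_nth_power 2 (g'\<^sup>2)" unfolding is_nth_power_def by blast
      ultimately show "w \<in> (SIGMA a:?D. roots (int a))"
        using v w ga by (simp add: roots_def valid_def)
    next
      fix w assume "w \<in> (SIGMA a:?D. roots (int a))"
      then obtain a k where w: "w = (a, k)" "a dvd m" "is_nth_power 2 (m div a)" "k \<in> roots (int a)" by auto
      then obtain g where g: "m div a = g\<^sup>2" by (auto elim: is_nth_powerE)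
      have "a > 0" using w assms by (auto intro: dvd_pos_nat)
      have m: "m = g\<^sup>2 * a" using g w(2) by (metis dvd_div_mult_self)
      then have "g > 0" using assms by (cases "g = 0") auto
      have "(int g, int a, k) \<in> norm_triples (int m)"
        using \<open>g > 0\<close> \<open>a > 0\<close> w(4) m by (auto simp: norm_triples_def valid_def roots_def)
      then show "w \<in> (\<lambda>(g, a, k). (nat a, k)) ` norm_triples (int m)"
        using w(1) by (intro image_eqI[of _ _ "(int g, int a, k)"]) auto
    qed
  qed
  then have "card (norm_triples (int m)) = card (SIGMA a:?D. roots (int a))" by (rule bij_betw_same_card)
  also have "\<dots> = (\<Sum>a\<in>?D. card (roots (int a)))"
    using assms finite_roots by (intro card_SigmaI) auto
  finally have "int (card (norm_triples (int m))) = (\<Sum>a\<in>?D. \<rho> a)" by (simp add: \<rho>_def)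
  also have "\<dots> = dconv \<rho> square_ind m"
    unfolding dconv_def square_ind_def using assms
    by (intro sum.mono_neutral_cong_left) auto
  finally show ?thesis .
qed

lemma dconv_eps: "dconv eps (\<lambda>_. 1) m = (\<Sum>d | d dvd m. eps d)"
  by (simp add: dconv_def)

lemma card_norm_triples:
  assumes "m > 0"
  shows "int (card (norm_triples (int m))) = (\<Sum>d | d dvd m. eps d)"
proof -
  have eps_pow: "eps (q ^ i) = eps q ^ i" for q i
  proof (induction i)
    case (Suc i)
    have "eps (q * q ^ i) = eps q * eps (q ^ i)" by (rule eps_mult)
    then show ?case using Suc by (simp only: power_Suc)
  qed (use eps_1 in simp)
  have "dconv \<rho> square_ind m = dconv eps (\<lambda>_. 1) m"
  proof (rule mult_fun_eqI)
    show "mult_fun (dconv \<rho> square_ind)" by (rule mult_fun_dconv[OF mult_fun_rho mult_fun_square_ind])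
    show "mult_fun (dconv eps (\<lambda>_. 1))"
    proof (rule mult_fun_dconv)
      show "mult_fun eps" unfolding mult_fun_def by (intro conjI allI impI eps_mult eps_1)
    qed (simp add: mult_fun_def)
    fix q e :: nat assume q: "prime q"
    have rho_1: "\<rho> (Suc 0) = 1" using mult_fun_rho by (simp add: mult_fun_def)
    have L: "dconv \<rho> square_ind (q ^ e) = (\<Sum>i\<le>e. if even (e - i) then \<rho> (q ^ i) else 0)" for e
      unfolding dconv_prime_power[OF q] square_ind_def
      by (intro sum.cong refl) (simp add: is_nth_power_prime_power_nat_iff[OF q])
    have R: "dconv eps (\<lambda>_. 1) (q ^ e) = (\<Sum>i\<le>e. eps q ^ i)" for e
      unfolding dconv_prime_power[OF q] by (simp only: eps_pow mult_1_right)
    show "dconv \<rho> square_ind (q ^ e) = dconv eps (\<lambda>_. 1) (q ^ e)"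
      unfolding L R
    \<comment> \<open>Steps of two preserve the parity of \<open>e - i\<close>. Passing from
      \<open>e\<close> to \<open>e + 2\<close> adds \<open>\<rho> (q ^ (e + 2))\<close>, which is
      the sum of the powers \<open>e + 1\<close> and \<open>e + 2\<close> of
      \<open>eps q\<close>.\<close>
    proof (induction e rule: induct_nat_012)
      case 1
      then show ?case using rho_prime_power_eq_eps[OF q, of 0] by simp
    next
      case (ge2 e)
      have "(\<Sum>i\<le>Suc (Suc e). if even (Suc (Suc e) - i) then \<rho> (q ^ i) else 0) =
        (\<Sum>i\<le>e. if even (Suc (Suc e) - i) then \<rho> (q ^ i) else 0) + \<rho> (q ^ Suc (Suc e))"
        by simp
      also have "(\<Sum>i\<le>e. if even (Suc (Suc e) - i) then \<rho> (q ^ i) else 0) =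
        (\<Sum>i\<le>e. if even (e - i) then \<rho> (q ^ i) else 0)"
        by (intro sum.cong refl) (simp add: Suc_diff_le)
      finally show ?case using ge2 rho_prime_power_eq_eps[OF q, of "Suc e"]
        by (simp add: algebra_simps)
    qed (simp add: rho_1)
  qed (rule assms)
  then show ?thesis using card_norm_triples_eq_dconv[OF assms] dconv_eps by simp
qed

end

section \<open>The class number formula\<close>

lemma sum_less_odd_reflect:
  fixes g :: "nat \<Rightarrow> 'a :: comm_monoid_add"
  assumes "g 0 = 0"
  shows "(\<Sum>k<2 * n + 1. g k) = (\<Sum>k=1..n. g k + g (2 * n + 1 - k))"
proof -
  have "{..<2 * n + 1} = insert 0 ({1..n} \<union> {n + 1..2 * n})" by auto
  then have "(\<Sum>k<2 * n + 1. g k) = (\<Sum>k=1..n. g k) + (\<Sum>k=n + 1..2 * n. g k)"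
    using assms by (simp add: sum.union_disjoint)
  also have "(\<Sum>k=n + 1..2 * n. g k) = (\<Sum>k=1..n. g (2 * n + 1 - k))"
    by (rule sum.reindex_bij_witness[of _ "\<lambda>k. 2 * n + 1 - k" "\<lambda>k. 2 * n + 1 - k"]) auto
  finally show ?thesis by (simp add: sum.distrib)
qed

text \<open>A listing by parity: the odd numbers are the complements of the even ones in
  \<open>2 * n + 1\<close>. Compared with the listing by halves in
  \<open>sum_less_odd_reflect\<close>, it yields a linear relation between half sums.\<close>

lemma sum_less_odd_double:
  fixes g :: "nat \<Rightarrow> 'a :: comm_monoid_add"
  assumes "g 0 = 0"
  shows "(\<Sum>k<2 * n + 1. g k) = (\<Sum>k=1..n. g (2 * k) + g (2 * n + 1 - 2 * k))"
proof -
  have inj: "inj_on (\<lambda>k. 2 * n + 1 - 2 * k) {1..n}" by (rule inj_onI) auto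
  have "{..<2 * n + 1} = insert 0 ((\<lambda>k. 2 * k) ` {1..n} \<union> (\<lambda>k. 2 * n + 1 - 2 * k) ` {1..n})"
  proof (intro equalityI subsetI)
    fix k assume k: "k \<in> {..<2 * n + 1}"
    show "k \<in> insert 0 ((\<lambda>k. 2 * k) ` {1..n} \<union> (\<lambda>k. 2 * n + 1 - 2 * k) ` {1..n})"
    proof (cases "even k")
      case True
      then obtain j where "k = 2 * j" by (elim evenE)
      then show ?thesis using k by (cases "j = 0") auto
    next
      case False
      then obtain j where "k = 2 * j + 1" by (elim oddE)
      then show ?thesis using k by (intro insertI2 UnI2 image_eqI[of _ _ "n - j"]) auto
    qed
  qed auto
  moreover have "(\<lambda>k. 2 * k) ` {1..n} \<inter> (\<lambda>k. 2 * n + 1 - 2 * k) ` {1..n} = {}"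
  proof -
    have "2 * i \<noteq> 2 * n + 1 - 2 * j" if "j \<le> n" for i j using that by presburger
    then show ?thesis by fastforce
  qed
  moreover have "0 \<notin> (\<lambda>k. 2 * k) ` {1..n} \<union> (\<lambda>k. 2 * n + 1 - 2 * k) ` {1..n}" by auto
  ultimately have "(\<Sum>k<2 * n + 1. g k) =
      sum g ((\<lambda>k. 2 * k) ` {1..n}) + sum g ((\<lambda>k. 2 * n + 1 - 2 * k) ` {1..n})"
    using assms sum.union_disjoint[of "(\<lambda>k. 2 * k) ` {1..n}" "(\<lambda>k. 2 * n + 1 - 2 * k) ` {1..n}" g]
    by (simp only: sum.insert finite_Un finite_imageI finite_atLeastAtMost) simp
  also have "sum g ((\<lambda>k. 2 * k) ` {1..n}) = (\<Sum>k=1..n. g (2 * k))"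
    by (subst sum.reindex) (auto simp: inj_on_def)
  also have "sum g ((\<lambda>k. 2 * n + 1 - 2 * k) ` {1..n}) = (\<Sum>k=1..n. g (2 * n + 1 - 2 * k))"
    by (subst sum.reindex[OF inj]) simp
  finally show ?thesis by (simp only: sum.distrib)
qed

section \<open>The class number as mean of partial sums and as half sum\<close>

context imag_quadratic_split_2
begin

lemma periodic_eps: "periodic_zero_sum eps p"
proof
  define n where "n = p div 2"
  have n: "p = 2 * n + 1" "odd n" using p_mod_4 unfolding n_def by presburger+
  interpret prime_3_mod_4 p n using prime_p n by unfold_locales
  show "p > 0" using p_gt_3 by simp
  show "eps (d + p) = eps d" for d
    by (rule Legendre_cong) (simp add: cong_iff_dvd_diff)
  show "eps 0 = 0" by (simp add: Legendre_def)
  then have "(\<Sum>d<2 * n + 1. eps d) = (\<Sum>k=1..n. eps k + eps (2 * n + 1 - k))"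
    by (rule sum_less_odd_reflect)
  also have "\<dots> = (\<Sum>k=1..n. 0)"
  proof (rule sum.cong[OF refl])
    fix k assume "k \<in> {1..n}"
    then have "int (2 * n + 1 - k) = int p - int k" using n by auto
    then show "eps k + eps (2 * n + 1 - k) = 0" using chi_p_minus by simp
  qed
  finally show "(\<Sum>d<p. eps d) = 0" using n by simp
qed

sublocale periodic_zero_sum eps p
  by (rule periodic_eps)

lemma class_number_eq_psum_mean: "real (class_number K) = psum_mean"
proof -
  have "class_number K = card ideal_classes" by (simp add: class_number_def ideal_classes_def Let_def)
  moreover have "real (card ideal_classes) = psum_mean"
  proof (rule card_forms_eq_psum_mean[OF finite_ideal_classes])
    fix C assume C: "C \<in> ideal_classes"
    define a k where "a = fst (rep C)" and "k = snd (rep C)"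
    have v: "valid 1 a k" using rep(1)[OF C] by (simp add: a_def k_def)
    have "a * (P k div a) = P k" using v by (simp add: valid_def)
    then have "4 * a * (P k div a) - (2 * k + 1)\<^sup>2 = int p" using four_P[of k] by simp
    then have "real_of_int (4 * a * (P k div a) - (2 * k + 1)\<^sup>2) = real p" by simp
    then have "4 * real_of_int a * real_of_int (P k div a) - (real_of_int (2 * k + 1))\<^sup>2 = real p" by simp
    then have "posdef_form (real_of_int a) (real_of_int (2 * k + 1)) (real_of_int (P k div a))"
      using v p_gt_3 by (intro posdef_form.intro) (simp_all add: valid_def)
    then show "posdef_form (real_of_int (fst (rep C))) (real_of_int (2 * snd (rep C) + 1))
        (real_of_int (P (snd (rep C)) div fst (rep C)))"
      by (simp only: a_def k_def)
  next
    fix m :: nat assume "m \<ge> 1"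
    then show "int (\<Sum>C\<in>ideal_classes. rep_count (fst (rep C)) (2 * snd (rep C) + 1)
        (P (snd (rep C)) div fst (rep C)) (int m)) = 2 * (\<Sum>d | d dvd m. eps d)"
      unfolding rep_count_def using sum_representations_eq_norm_triples[of "int m"] card_norm_triples[of m]
      by simp
  qed
  ultimately show ?thesis by simp
qed

text \<open>Listed by halves \<open>W\<close> is \<open>2 * U - p * V\<close>, and listed by parity
  it is \<open>4 * U - p * V\<close>, the latter because \<open>eps 2 = 1\<close>. Hence
  \<open>U = 0\<close> and \<open>W = - (p * V)\<close>, while the partial sums over a period add up
  to \<open>- W\<close>.\<close>

lemma psum_mean_eq_half_sum:
  assumes n: "p = 2 * n + 1"
  shows "psum_mean = real_of_int (\<Sum>k=1..n. eps k)"
proof -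
  have "odd n" using n p_mod_4 by presburger
  then interpret prime_3_mod_4 p n using prime_p n by unfold_locales
  define U V W where "U = (\<Sum>k=1..n. int k * eps k)" and "V = (\<Sum>k=1..n. eps k)"
    and "W = (\<Sum>k<p. int k * eps k)"
  have refl: "eps (2 * n + 1 - k) = - eps k" "int (2 * n + 1 - k) = int p - int k" if "k \<le> 2 * n" for k
  proof -
    show "int (2 * n + 1 - k) = int p - int k" using n that by auto
    then show "eps (2 * n + 1 - k) = - eps k" using chi_p_minus by simp
  qed
  have "W = (\<Sum>k=1..n. int k * eps k + int (2 * n + 1 - k) * eps (2 * n + 1 - k))"
    unfolding W_def n by (rule sum_less_odd_reflect) simp
  also have "\<dots> = (\<Sum>k=1..n. 2 * (int k * eps k) - int p * eps k)"
  proof (rule sum.cong[OF HOL.refl])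
    fix k assume "k \<in> {1..n}"
    then have "k \<le> 2 * n" by simp
    from refl[OF this] show "int k * eps k + int (2 * n + 1 - k) * eps (2 * n + 1 - k) =
        2 * (int k * eps k) - int p * eps k"
      by (simp only:) (simp add: algebra_simps)
  qed
  finally have W1: "W = 2 * U - int p * V"
    by (simp add: U_def V_def sum_subtractf sum_distrib_left)
  have eps2k: "eps (2 * k) = eps k" for k using eps_mult[of 2 k] eps_2 by simp
  have "W = (\<Sum>k=1..n. int (2 * k) * eps (2 * k) + int (2 * n + 1 - 2 * k) * eps (2 * n + 1 - 2 * k))"
    unfolding W_def n by (rule sum_less_odd_double) simp
  also have "\<dots> = (\<Sum>k=1..n. 4 * (int k * eps k) - int p * eps k)"
  proof (rule sum.cong[OF HOL.refl])
    fix k assume "k \<in> {1..n}"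
    then have f: "eps (2 * n + 1 - 2 * k) = - eps k" "int (2 * n + 1 - 2 * k) = int p - 2 * int k"
      using refl[of "2 * k"] eps2k by auto
    show "int (2 * k) * eps (2 * k) + int (2 * n + 1 - 2 * k) * eps (2 * n + 1 - 2 * k) =
        4 * (int k * eps k) - int p * eps k"
      unfolding eps2k f(1) unfolding f(2) by (simp add: algebra_simps)
  qed
  finally have W2: "W = 4 * U - int p * V"
    by (simp add: U_def V_def sum_subtractf sum_distrib_left)
  have W: "W = - (int p * V)" using W1 W2 by simp
  \<comment> \<open>Exchanging the sums, \<open>eps k\<close> is counted once for each of the
    \<open>p - k\<close> indices \<open>d\<close> with \<open>k \<le> d < p\<close>.\<close>
  have "(\<Sum>d<p. \<Sum>k<Suc d. eps k) = (\<Sum>k<p. int (p - k) * eps k)"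
  proof -
    have "(\<Sum>d<N. \<Sum>k<Suc d. eps k) = (\<Sum>k<N. int (N - k) * eps k)" for N
    proof (induction N)
      case (Suc N)
      have "(\<Sum>k<N. int (Suc N - k) * eps k) = (\<Sum>k<N. int (N - k) * eps k + eps k)"
        by (rule sum.cong) (auto simp: Suc_diff_le of_nat_diff algebra_simps)
      then show ?case using Suc by (simp add: sum.distrib)
    qed simp
    then show ?thesis .
  qed
  also have "\<dots> = (\<Sum>k<p. int p * eps k - int k * eps k)"
    by (rule sum.cong) (auto simp: of_nat_diff algebra_simps)
  also have "\<dots> = int p * (\<Sum>k<p. eps k) - W"
    by (simp add: sum_subtractf sum_distrib_left W_def)
  also have "\<dots> = int p * V" using sum_zero W by simp
  finally have "real_of_int (\<Sum>d<p. \<Sum>k<Suc d. eps k) = real_of_int (int p * V)" by (simp only:)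
  then have "(\<Sum>d<p. psum d) = real p * real_of_int V" unfolding psum_def by simp
  then show ?thesis using p_pos by (simp add: psum_mean_def V_def)
qed

theorem class_number_formula:
  assumes "p = 2 * n + 1"
  shows "int (class_number K) = (\<Sum>r=1..int n. Legendre r (int p))"
proof -
  have "real_of_int (int (class_number K)) = real_of_int (\<Sum>k=1..n. eps k)"
    using class_number_eq_psum_mean psum_mean_eq_half_sum[OF assms] by simp
  then have "int (class_number K) = (\<Sum>k=1..n. eps k)" by (simp only: of_int_eq_iff)
  also have "\<dots> = (\<Sum>r=1..int n. Legendre r (int p))"
    by (rule sum.reindex_bij_witness[of _ nat int]) auto
  finally show ?thesis .
qed

end

section \<open>The order of shifted quadratic residues\<close>

text \<open>Since -1 is its own inverse, the sign of the exponent is immaterial and natural powers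
  suffice.\<close>

lemma minus_one_powi_eq_power_abs: "(- 1 :: real) powi z = (- 1) ^ nat \<bar>z\<bar>"
  by (simp add: power_int_def abs_if)

theorem theorem3p2:
  fixes p n :: nat and a b :: int
  assumes "prime p" and "p = 2 * n + 1" and "odd n"
    and "a \<in> {1..int p - 1}" and "b \<in> {1..int p - 1}"
  shows "(-1 :: real) powi
      (int (card {(s :: int, t :: int). 0 \<le> t \<and> t < s \<and> s \<le> int n \<and>
                    (a * s\<^sup>2 - b) mod int p > (a * t\<^sup>2 - b) mod int p})
       - int (card {r :: int. 0 < r \<and> r < b \<and> Legendre r (int p) = Legendre a (int p)}))
    = (if p mod 8 = 3 then 1
       else (-1) powi ((int (class_number (quadratic_field (- int p))) - 1) div 2)
              * real_of_int (Legendre a (int p)))"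
proof -
  interpret prime_3_mod_4 p n using assms by unfold_locales
  have a: "\<not> int p dvd a" using assms(4) by (intro not_dvd_small) auto
  have b: "0 < b" "b < int p" using assms(5) by auto
  define A where "A = card {(s :: int, t :: int). 0 \<le> t \<and> t < s \<and> s \<le> int n \<and>
    (a * s\<^sup>2 - b) mod int p > (a * t\<^sup>2 - b) mod int p}"
  define B where "B = card {r :: int. 0 < r \<and> r < b \<and> Legendre r (int p) = Legendre a (int p)}"
  have "(- 1 :: real) powi (int A - int B) = real_of_int ((- 1) ^ A * (- 1) ^ B)"
    by (simp add: power_int_diff divide_inverse power_inverse[symmetric])
  also have "(- 1 :: int) ^ A * (- 1) ^ B =
      (if chi 2 = 1 then (- 1) ^ card {x \<in> chi_class a. x \<le> int n} else 1)"
    unfolding A_def B_def by (rule order_parity_shift[OF a b])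
  also have "real_of_int \<dots> = (if p mod 8 = 3 then 1
       else (-1) powi ((int (class_number (quadratic_field (- int p))) - 1) div 2)
              * real_of_int (Legendre a (int p)))"
  \<comment> \<open>In the first case \<open>chi 2 = - 1\<close>, and no class number enters; this
    covers \<open>p = 3\<close>. In the second case \<open>p\<close> is at least 7, as the field
    arithmetic demands.\<close>
  proof (cases "p mod 8 = 3")
    case True
    then show ?thesis using chi_2_eq_1_iff by simp
  next
    case False
    have p4: "p mod 4 = 3" using assms(2,3) by presburger
    then have p8: "p mod 8 = 7" using False by presburger
    interpret imag_quadratic_split_2 p
      using assms(1) p4 p8 by unfold_locales auto
    show ?thesis
      unfolding class_number_formula[OF assms(2)] minus_one_powi_eq_power_abs
      using False chi_2_eq_1_iff by (simp only: neg_one_power_card_chi_half[OF a p8]) simp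
  qed
  finally show ?thesis unfolding A_def B_def .
qed

end
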